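(* Write $x=\cos\theta$, $\theta\in[0,\pi]$. (i) For every integer $n\ge0$, $$F_{n,\frac12,-\frac12}(x)=\sqrt{\tfrac2\pi}\,\bigl|\sin\bigl((n+\tfrac12)\theta\bigr)\bigr|,\quad F_{n,-\frac12,\frac12}(x)=\sqrt{\tfrac2\pi}\,\bigl|\cos\bigl((n+\tfrac12)\theta\bigr)\bigr|,\quad F_{n,\frac12,\frac12}(x)=\sqrt{\tfrac2\pi}\,\bigl|\sin\bigl((n+1)\theta\bigr)\bigr|,$$ while $F_{n,-\frac12,-\frac12}(x)=\sqrt{2/\pi}\,|\cos n\theta|$ for $n\ge1$ and $F_{0,-\frac12,-\frac12}\equiv\pi^{-1/2}$. Apart from this degree-zero exception, the maxima over $x\in[-1,1]$ of these functions are all equal to $\sqrt{2/\pi}$. In particular, if $C$ is a constant such that $F_{n,\alpha,\beta}(x)\le C\,\mathcal{E}_n(\alpha+\beta+1)$ for all integers $n\ge0$, all $\alpha,\beta\ge-1/2$ and all $x\in[-1,1]$, or such that $F_{n,\alpha,\beta}(x)\le C\max\{1,(\alpha+\beta+1)^{1/4}\}$ for all such $n,\alpha,\beta,x$, then $C\ge\sqrt{2/\pi}$. (ii) For every fixed integer $n\ge0$ and every real $\alpha\ge-1/2$, $$F_{n,\alpha,-\frac12}(-1)^2=\frac{(2n+\alpha+\tfrac12)\,\Gamma(n+\tfrac12)\,\Gamma(n+\alpha+\tfrac12)}{\pi\,\Gamma(n+1)\,\Gamma(n+\alpha+1)},$$ the right-hand side being read by continuous extension at $(n,\alpha)=(0,-\tfrac12)$,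 where it equals $1/\pi$. Consequently, for fixed $n$, $$F_{n,\alpha,-\frac12}(-1)\sim\Bigl(\frac{\Gamma(n+\tfrac12)}{\pi\,\Gamma(n+1)}\Bigr)^{1/2}\alpha^{1/4}\qquad(\alpha\to\infty),$$ so the fixed-degree exponent $1/4$ of $S$ in $\mathcal{E}_n(S)$ cannot be lowered (for fixed $n$ and any $\gamma<1/4$, no bound $F_{n,\alpha,\beta}(x)\le C\max\{1,(\alpha+\beta+1)^{\gamma}\}$ with $C$ independent of $\alpha,\beta,x$ holds for all $\alpha,\beta\ge-1/2$, $x\in[-1,1]$). (iii) For every fixed real $A\ge-1/2$ and $z>0$, $$\lim_{n\to\infty}F_{n,A,A}\bigl(\cos(z/n)\bigr)=\sqrt z\,|J_A(z)|.$$ Moreover, there is an absolute constant $c>0$ such that, for every sufficiently large real $A$, there exists an integer $n_A$ with $n_A+1\ge(2A+1)^3$ and $$F_{n_A,A,A}\bigl(\cos(A/n_A)\bigr)\ge cA^{1/6}.$$ Hence, along this sequence, $S=2A+1$, and the term $S^{1/6}$ in $\mathcal{E}_n(S)$ cannot be omitted even though $S^{1/4}(n_A+1)^{-1/12}\le1$ there (that is, there is no constant $C$ with $F_{n,\alpha,\beta}(x)\le C\max\{1,S^{1/4}(n+1)^{-1/12}\}$, $S=\alpha+\beta+1$, for all integers $n\ge0$, all $\alpha,\beta\ge-1/2$ and all $x\in[-1,1]$).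
   Context: For real $\alpha,\beta\ge-1/2$ put $w_{\alpha,\beta}(x)=(1-x)^\alpha(1+x)^\beta$, $-1<x<1$. For an integer $n\ge0$, $p_n^{(\alpha,\beta)}$ denotes the (Jacobi) polynomial of degree $n$ orthonormal in $L^2([-1,1],w_{\alpha,\beta}\,dx)$ (unique up to sign). Define, for $-1<x<1$, $$F_{n,\alpha,\beta}(x)=(1-x^2)^{1/4}\,w_{\alpha,\beta}(x)^{1/2}\,|p_n^{(\alpha,\beta)}(x)|,$$ so that $F_{n,\alpha,\beta}(x)^2=(1-x)^{\alpha+1/2}(1+x)^{\beta+1/2}|p_n^{(\alpha,\beta)}(x)|^2$. Values at $x=\pm1$ are understood as one-sided limits from $(-1,1)$ (these exist and are finite). For $S\ge0$ and an integer $n\ge 0$, $$\Phi_n(S)=\max\left\{1,S^{1/3},\frac{S^{1/2}}{(n+1)^{1/6}}\right\},\qquad \mathcal{E}_n(S)=\Phi_n(S)^{1/2}=\max\left\{1,S^{1/6},\frac{S^{1/4}}{(n+1)^{1/12}}\right\}.$$ $J_A$ is the Bessel function of the first kind of order $A$. *)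

theory Defs
  imports "HOL-Analysis.Analysis" "HOL-Computational_Algebra.Polynomial"
    "HOL-Library.Landau_Symbols"
begin

definition jacobi_weight :: "real \<Rightarrow> real \<Rightarrow> real \<Rightarrow> real" where
  "jacobi_weight \<alpha> \<beta> x = (1 - x) powr \<alpha> * (1 + x) powr \<beta>"

definition jacobi_inner :: "real \<Rightarrow> real \<Rightarrow> real poly \<Rightarrow> real poly \<Rightarrow> real" where
  "jacobi_inner \<alpha> \<beta> p q =
     (LINT x:{-1..1}|lborel. poly p x * poly q x * jacobi_weight \<alpha> \<beta> x)"

definition orthonormal_jacobi_system :: "real \<Rightarrow> real \<Rightarrow> (nat \<Rightarrow> real poly) \<Rightarrow> bool" where
  "orthonormal_jacobi_system \<alpha> \<beta> P \<longleftrightarrow>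
     (\<forall>n. degree (P n) = n) \<and>
     (\<forall>m n. jacobi_inner \<alpha> \<beta> (P m) (P n) = (if m = n then 1 else 0))"

text \<open>
  For parameters greater than \<open>-1\<close> such a system exists and is unique up to the sign of each
  member; \<open>SOME\<close> fixes the signs arbitrarily, and only absolute values are used below.
\<close>

definition jacobi_poly :: "nat \<Rightarrow> real \<Rightarrow> real \<Rightarrow> real poly" where
  "jacobi_poly n \<alpha> \<beta> = (SOME P. orthonormal_jacobi_system \<alpha> \<beta> P) n"

definition jacobi_F_interior :: "nat \<Rightarrow> real \<Rightarrow> real \<Rightarrow> real \<Rightarrow> real" where
  "jacobi_F_interior n \<alpha> \<beta> x =
     (1 - x\<^sup>2) powr (1/4) * jacobi_weight \<alpha> \<beta> x powr (1/2) * \<bar>poly (jacobi_poly n \<alpha> \<beta>) x\<bar>"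

text \<open>
  The limits at \<open>1\<close> and \<open>-1\<close> are genuine limits: the interior expression equals
  \<open>(1 - x) powr (\<alpha>/2 + 1/4) * (1 + x) powr (\<beta>/2 + 1/4)\<close> times the absolute value of a
  polynomial, and both exponents are nonnegative. Direct evaluation there would be wrong when
  a parameter is \<open>-1/2\<close>, since \<open>0 powr a = 0\<close>.
\<close>

definition jacobi_F :: "nat \<Rightarrow> real \<Rightarrow> real \<Rightarrow> real \<Rightarrow> real" where
  "jacobi_F n \<alpha> \<beta> x =
     (if x = 1 then Lim (at_left 1) (jacobi_F_interior n \<alpha> \<beta>)
      else if x = -1 then Lim (at_right (-1)) (jacobi_F_interior n \<alpha> \<beta>)
      else jacobi_F_interior n \<alpha> \<beta> x)"

definition Phi_bound :: "nat \<Rightarrow> real \<Rightarrow> real" where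
  "Phi_bound n S =
     Max {1, S powr (1/3), S powr (1/2) / (real n + 1) powr (1/6)}"

definition E_bound :: "nat \<Rightarrow> real \<Rightarrow> real" where
  "E_bound n S = Phi_bound n S powr (1/2)"

text \<open>
  The power series of the Bessel function of the first kind, for positive real arguments
  (where the real power \<open>powr\<close> is the intended one). \<open>rGamma\<close> is the entire function
  \<open>1/Gamma\<close>.
\<close>

definition bessel_J :: "real \<Rightarrow> real \<Rightarrow> real" where
  "bessel_J A z =
     (\<Sum>k. (-1) ^ k / fact k * rGamma (real k + A + 1) * (z / 2) powr (2 * real k + A))"

end

theory Submission
  imports Defs "HOL-Real_Asymp.Real_Asymp"
begin

text \<open>
  An orthonormal system is unique up to signs, so any explicit one may be used. For parameters
  \<open>\<plusminus>1/2\<close> the substitution \<open>x = cos \<theta>\<close> turns the weight into the square of a trigonometric factor, and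
  the Chebyshev recurrence gives the system. In general the hypergeometric polynomial expanded at
  \<open>-1\<close> is orthogonal to \<open>(1 - x)\<^sup>j\<close>, \<open>j < n\<close>, because the Beta integrals reduce the inner product
  to an \<open>n\<close>-th difference of a polynomial of degree less than \<open>n\<close>; the same computation with
  \<open>j = n\<close> gives the norm, hence the endpoint value. Tannery's theorem applied to the hypergeometric
  sum, reflected to \<open>1\<close>, gives the Bessel limit.

  For \<open>J\<^sub>A(A) \<ge> c A\<^sup>-\<^sup>1\<^sup>/\<^sup>3\<close> write Bessel's equation as \<open>t (t B')' = (\<nu>\<^sup>2 - t\<^sup>2) B\<close>. It makes \<open>B\<close> positive and
  increasing on \<open>(0, \<nu>]\<close>. A second order WKB ansatz with a correction term is a subsolution as long as
  \<open>y\<^sup>3 \<ge> 2 \<nu>\<^sup>2\<close>, where \<open>y = sqrt (\<nu>\<^sup>2 - t\<^sup>2)\<close>, and the quotient of \<open>B\<close> by it is nondecreasing. Comparing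
  the quotient at \<open>0\<close> and at \<open>y\<^sup>3 = 2 \<nu>\<^sup>2\<close> loses only a constant factor against \<open>A\<^sup>-\<^sup>1\<^sup>/\<^sup>3\<close>.
\<close>
section \<open>Orthonormal systems for the Jacobi weight\<close>

text \<open>Expanding at -1 makes the endpoint value a question of normalisation only: the
  polynomial is 1 there.

  The growth A^(1/6) comes from the transition region of J_A. Before the turning point t = \<nu>,
  WKB gives, up to normalisation, the amplitude y^(-1/2) times exp (-(\<nu> artanh (y/\<nu>) - y)),
  and this exponent is about -y^3/(3 \<nu>^2). Once y is of order \<nu>^(2/3), the exponential is
  bounded below while the amplitude is already of order \<nu>^(-1/3). Following the approximation
  closer to \<nu>, where it breaks down, would gain nothing: monotonicity covers the rest. The
  correction to ln \<open>wkb\<close> at the same scale is \<nu>^2/(3 y^3), again bounded. Since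
  every constant may be lost, Stirling's formula enters only as an upper bound for the Gamma factor
  that normalises J_A.

  The limit in the degree is taken for each fixed A separately. Hence n_A is not explicit, but it
  can be taken as large as desired, in particular beyond (2 A + 1)^3.\<close>

lemma jacobi_weight_nonneg: "x \<in> {-1..1} \<Longrightarrow> jacobi_weight \<alpha> \<beta> x \<ge> 0"
  by (simp add: jacobi_weight_def)

lemma has_integral_Beta_symmetric:
  fixes a b :: real
  assumes "a > -1" "b > -1"
  shows "((\<lambda>x. (1 - x) powr a * (1 + x) powr b) has_integral
            2 powr (a + b + 1) * Beta (a + 1) (b + 1)) {-1..1}"
proof -
  have "((\<lambda>t. t powr (b + 1 - 1) * (1 - t) powr (a + 1 - 1)) has_integral Beta (b + 1) (a + 1)) {0..1}"
    using assms by (intro has_integral_Beta_real) auto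
  then have I: "((\<lambda>t. t powr b * (1 - t) powr a) has_integral Beta (b + 1) (a + 1)) (cbox 0 1)"
    by simp
  have "((\<lambda>x. (1/2 * x + 1/2) powr b * (1 - (1/2 * x + 1/2)) powr a) has_integral
          (1 / \<bar>1/2\<bar> ^ DIM(real)) *\<^sub>R Beta (b + 1) (a + 1))
        ((\<lambda>x. (1 / (1/2)) *\<^sub>R x + - ((1 / (1/2)) *\<^sub>R (1/2))) ` cbox 0 1)"
    using has_integral_affinity[OF I, of "1/2" "1/2"] by simp
  moreover have "(\<lambda>x::real. (1 / (1/2)) *\<^sub>R x + - ((1 / (1/2)) *\<^sub>R (1/2))) ` cbox 0 1 = {-1..1}"
    by (auto simp: image_def field_simps intro!: bexI[of _ "(_ + 1)/2"])
  ultimately have "((\<lambda>x. (1/2 * x + 1/2) powr b * (1 - (1/2 * x + 1/2)) powr a) has_integral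
          2 * Beta (b + 1) (a + 1)) {-1..1}" by simp
  then have J: "((\<lambda>x. 2 powr (a + b) * ((1/2 * x + 1/2) powr b * (1 - (1/2 * x + 1/2)) powr a)) has_integral
          2 powr (a + b) * (2 * Beta (b + 1) (a + 1))) {-1..1}"
    by (intro has_integral_mult_right)
  have e1: "2 powr (a + b) * (2 * Beta (b + 1) (a + 1)) = 2 powr (a + b + 1) * Beta (a + 1) (b + 1)"
    by (simp add: powr_add Beta_commute)
  have e2: "2 powr (a + b) * ((1/2 * x + 1/2) powr b * (1 - (1/2 * x + 1/2)) powr a)
      = (1 - x) powr a * (1 + x) powr b" if "x \<in> {-1..1}" for x
  proof -
    have 1: "(1 - x) powr a = (2 * (1 - (1/2 * x + 1/2))) powr a" by (simp add: algebra_simps)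
    have 2: "(1 + x) powr b = (2 * (1/2 * x + 1/2)) powr b" by (simp add: algebra_simps)
    show ?thesis unfolding 1 2 using that
      by (subst (1 2) powr_mult) (auto simp: powr_add)
  qed
  show ?thesis using has_integral_eq[OF e2 J] by (simp only: e1)
qed

lemma jacobi_weight_measurable [measurable]: "jacobi_weight \<alpha> \<beta> \<in> borel_measurable borel"
  unfolding jacobi_weight_def by measurable

text \<open>With a negative parameter the weight is unbounded at an endpoint, so integrability is
  read off from the Beta integral. For a nonnegative function a gauge integral is absolute, and
  Borel measurability carries it over to \<open>lborel\<close>.\<close>

lemma set_integrable_jacobi_weight:
  assumes "\<alpha> > -1" "\<beta> > -1"
  shows "set_integrable lborel {-1..1} (jacobi_weight \<alpha> \<beta>)"
proof -
  have "(jacobi_weight \<alpha> \<beta> has_integral 2 powr (\<alpha> + \<beta> + 1) * Beta (\<alpha> + 1) (\<beta> + 1)) {-1..1}"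
    unfolding jacobi_weight_def by (rule has_integral_Beta_symmetric[OF assms])
  then have "jacobi_weight \<alpha> \<beta> absolutely_integrable_on {-1..1}"
    by (intro nonnegative_absolutely_integrable_1 jacobi_weight_nonneg) (auto simp: has_integral_iff)
  then show ?thesis unfolding set_integrable_def
    by (subst (asm) integrable_completion) auto
qed

lemma set_integrable_poly_jacobi_weight:
  assumes "\<alpha> > -1" "\<beta> > -1"
  shows "set_integrable lborel {-1..1} (\<lambda>x. poly p x * jacobi_weight \<alpha> \<beta> x)"
proof -
  have "compact (poly p ` {-1..1})" by (intro compact_continuous_image continuous_intros) auto
  then obtain M where M: "\<And>x. x \<in> {-1..1} \<Longrightarrow> \<bar>poly p x\<bar> \<le> M"
    using compact_imp_bounded bounded_iff by (metis imageI real_norm_def)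
  have [measurable]: "poly p \<in> borel_measurable borel"
    by (intro borel_measurable_continuous_onI continuous_intros)
  have "integrable lborel (\<lambda>x. M * (indicator {-1..1} x *\<^sub>R jacobi_weight \<alpha> \<beta> x))"
    using set_integrable_jacobi_weight[OF assms] unfolding set_integrable_def
    by (intro integrable_mult_right)
  then show ?thesis unfolding set_integrable_def
    using M by (elim Bochner_Integration.integrable_bound)
      (auto intro!: mult_right_mono order_trans[OF M] simp: indicator_def abs_mult jacobi_weight_nonneg)
qed

section \<open>Bilinearity and uniqueness up to sign\<close>

lemma jacobi_inner_commute: "jacobi_inner \<alpha> \<beta> p q = jacobi_inner \<alpha> \<beta> q p"
  by (simp add: jacobi_inner_def mult.commute)

lemma jacobi_inner_add_left:
  assumes "\<alpha> > -1" "\<beta> > -1"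
  shows "jacobi_inner \<alpha> \<beta> (p + q) r = jacobi_inner \<alpha> \<beta> p r + jacobi_inner \<alpha> \<beta> q r"
  using set_integral_add(2)[OF set_integrable_poly_jacobi_weight[OF assms, of "p * r"]
      set_integrable_poly_jacobi_weight[OF assms, of "q * r"]]
  by (simp add: jacobi_inner_def algebra_simps)

lemma jacobi_inner_smult_left: "jacobi_inner \<alpha> \<beta> (smult c p) q = c * jacobi_inner \<alpha> \<beta> p q"
  by (simp add: jacobi_inner_def mult.assoc)

lemma jacobi_inner_0_left [simp]: "jacobi_inner \<alpha> \<beta> 0 q = 0"
  by (simp add: jacobi_inner_def)

lemma jacobi_inner_sum_left:
  assumes "\<alpha> > -1" "\<beta> > -1"
  shows "jacobi_inner \<alpha> \<beta> (\<Sum>i\<in>I. f i) q = (\<Sum>i\<in>I. jacobi_inner \<alpha> \<beta> (f i) q)"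
  by (induction I rule: infinite_finite_induct) (simp_all add: jacobi_inner_add_left[OF assms])

lemma jacobi_inner_sum_smult_left:
  assumes "\<alpha> > -1" "\<beta> > -1"
  shows "jacobi_inner \<alpha> \<beta> (\<Sum>i\<in>I. smult (a i) (f i)) q = (\<Sum>i\<in>I. a i * jacobi_inner \<alpha> \<beta> (f i) q)"
  by (simp add: jacobi_inner_sum_left[OF assms] jacobi_inner_smult_left)

text \<open>Leading terms are removed one degree at a time. \<open>P 0 \<noteq> 0\<close> is assumed
  separately because the zero polynomial also has degree 0; in positive degree the degree itself
  excludes zero.\<close>

lemma poly_basis_expansion:
  fixes P :: "nat \<Rightarrow> 'a::field poly"
  assumes deg: "\<And>k. degree (P k) = k" and P0: "P 0 \<noteq> 0" and p: "degree p < n"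
  shows "\<exists>a. p = (\<Sum>k<n. smult (a k) (P k))"
  using p
proof (induction n arbitrary: p)
  case (Suc n)
  have lc: "coeff (P n) n \<noteq> 0"
    using deg[of n] P0 by (cases n) (metis leading_coeff_0_iff, metis degree_0 leading_coeff_0_iff nat.distinct(1))
  define q where "q = p - smult (coeff p n / coeff (P n) n) (P n)"
  have "degree q \<le> n" unfolding q_def using Suc.prems deg[of n]
    by (intro degree_diff_le) (auto intro: order_trans[OF degree_smult_le])
  moreover have "coeff q n = 0" using lc by (simp add: q_def)
  ultimately have q: "q = 0 \<or> degree q < n"
    by (metis le_neq_implies_less leading_coeff_0_iff)
  have "\<exists>a. q = (\<Sum>k<n. smult (a k) (P k))"
  proof (cases "q = 0")
    case True
    then show ?thesis by (intro exI[of _ "\<lambda>_. 0"]) simp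
  qed (use q Suc.IH in auto)
  then obtain a where "q = (\<Sum>k<n. smult (a k) (P k))" by blast
  then have "p = (\<Sum>k<Suc n. smult ((a(n := coeff p n / coeff (P n) n)) k) (P k))"
    by (simp add: q_def algebra_simps)
  then show ?case by blast
qed simp

lemma orthonormal_jacobi_systemD:
  assumes "orthonormal_jacobi_system \<alpha> \<beta> P"
  shows "degree (P n) = n" "jacobi_inner \<alpha> \<beta> (P m) (P n) = (if m = n then 1 else 0)" "P n \<noteq> 0"
proof -
  show "P n \<noteq> 0"
  proof
    assume "P n = 0"
    then have "jacobi_inner \<alpha> \<beta> (P n) (P n) = 0" by simp
    with assms show False by (simp add: orthonormal_jacobi_system_def)
  qed
qed (use assms in \<open>auto simp: orthonormal_jacobi_system_def\<close>)

lemma orthonormal_jacobi_system_orthogonal: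
  assumes "\<alpha> > -1" "\<beta> > -1" "orthonormal_jacobi_system \<alpha> \<beta> P" "degree q < n"
  shows "jacobi_inner \<alpha> \<beta> q (P n) = 0"
proof -
  obtain a where "q = (\<Sum>k<n. smult (a k) (P k))"
    using poly_basis_expansion[of P q n] orthonormal_jacobi_systemD[OF assms(3)] assms(4) by metis
  then show ?thesis
    by (simp add: jacobi_inner_sum_smult_left[OF assms(1,2)] orthonormal_jacobi_systemD[OF assms(3)])
qed

text \<open>In the expansion of \<open>Q n\<close> along \<open>P\<close> the coefficients below n
  vanish by orthogonality to lower degrees, and the unit norms leave a last coefficient of absolute
  value 1.\<close>

lemma orthonormal_jacobi_system_unique:
  assumes "\<alpha> > -1" "\<beta> > -1"
    and P: "orthonormal_jacobi_system \<alpha> \<beta> P" and Q: "orthonormal_jacobi_system \<alpha> \<beta> Q"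
  shows "\<bar>poly (P n) x\<bar> = \<bar>poly (Q n) x\<bar>"
proof -
  note oP = orthonormal_jacobi_system_orthogonal[OF assms(1,2) P]
  note oQ = orthonormal_jacobi_system_orthogonal[OF assms(1,2) Q]
  note dP = orthonormal_jacobi_systemD[OF P] and dQ = orthonormal_jacobi_systemD[OF Q]
  obtain a where a: "Q n = (\<Sum>k<Suc n. smult (a k) (P k))"
    using poly_basis_expansion[of P "Q n" "Suc n"] dP dQ by (metis lessI)
  have "a k = 0" if "k < n" for k
  proof -
    have "jacobi_inner \<alpha> \<beta> (Q n) (P k) = (\<Sum>i<Suc n. a i * jacobi_inner \<alpha> \<beta> (P i) (P k))"
      unfolding a by (rule jacobi_inner_sum_smult_left[OF assms(1,2)])
    also have "\<dots> = (\<Sum>i<Suc n. if i = k then a i else 0)" by (intro sum.cong) (auto simp: dP)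
    also have "\<dots> = a k" using that by (subst sum.delta) auto
    finally show ?thesis using oQ[of "P k" n] that dP by (simp add: jacobi_inner_commute)
  qed
  then have eq: "Q n = smult (a n) (P n)" using a by simp
  have "1 = jacobi_inner \<alpha> \<beta> (Q n) (Q n)" by (simp add: dQ)
  also have "\<dots> = a n * jacobi_inner \<alpha> \<beta> (Q n) (P n)"
    by (metis eq jacobi_inner_smult_left jacobi_inner_commute)
  also have "\<dots> = a n * a n" by (subst eq) (simp add: jacobi_inner_smult_left dP)
  finally have "\<bar>a n\<bar> = 1"
    by (metis abs_1 abs_mult_self_eq abs_ge_zero mult_cancel_right1 power2_eq_1_iff power2_eq_square abs_minus)
  then show ?thesis by (simp add: eq abs_mult)
qed

text \<open>The system \<open>P\<close> serves twice: it witnesses existence, so that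
  \<open>SOME\<close> picks a genuine orthonormal system, and uniqueness then identifies the
  absolute values.\<close>

lemma abs_poly_jacobi_poly:
  assumes "\<alpha> > -1" "\<beta> > -1" "orthonormal_jacobi_system \<alpha> \<beta> P"
  shows "\<bar>poly (jacobi_poly n \<alpha> \<beta>) x\<bar> = \<bar>poly (P n) x\<bar>"
  unfolding jacobi_poly_def
  using orthonormal_jacobi_system_unique[OF assms(1,2) someI[of "orthonormal_jacobi_system \<alpha> \<beta>"]]
    assms(3) by metis

section \<open>Reflection of the interval\<close>

lemma jacobi_inner_reflect:
  "jacobi_inner \<alpha> \<beta> (pcompose p [:0, -1:]) (pcompose q [:0, -1:]) = jacobi_inner \<beta> \<alpha> p q"
proof -
  have "(LINT x:{-1..1}|lborel. poly p (-x) * poly q (-x) * jacobi_weight \<beta> \<alpha> (-x)) =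
     (LINT x:{-1..1}|lborel. poly p x * poly q x * jacobi_weight \<beta> \<alpha> x)"
    unfolding set_lebesgue_integral_def
    by (subst (2) lborel_integral_real_affine[where c="-1" and t=0])
      (auto intro!: Bochner_Integration.integral_cong simp: indicator_def)
  then show ?thesis by (simp add: jacobi_inner_def poly_pcompose jacobi_weight_def mult_ac)
qed

lemma orthonormal_jacobi_system_reflect:
  assumes "orthonormal_jacobi_system \<alpha> \<beta> P"
  shows "orthonormal_jacobi_system \<beta> \<alpha> (\<lambda>n. pcompose (P n) [:0, -1:])"
  using assms by (simp add: orthonormal_jacobi_system_def jacobi_inner_reflect degree_pcompose)

text \<open>Real powers with the convention \<open>0\<^sup>0 = 1\<close>, which makes them continuous at \<open>0\<close> for every
  nonnegative exponent.\<close>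

definition rpow :: "real \<Rightarrow> real \<Rightarrow> real" where
  "rpow t a = (if a = 0 then 1 else t powr a)"

lemma rpow_0_right [simp]: "rpow t 0 = 1"
  by (simp add: rpow_def)

lemma rpow_nonneg [simp]: "rpow t a \<ge> 0"
  by (simp add: rpow_def)

lemma rpow_eq_powr: "t > 0 \<Longrightarrow> rpow t a = t powr a"
  by (simp add: rpow_def)

lemma rpow_half: "t \<ge> 0 \<Longrightarrow> rpow t (1/2) = sqrt t"
  by (simp add: rpow_def powr_half_sqrt)

lemma continuous_on_rpow: "a \<ge> 0 \<Longrightarrow> continuous_on {0..} (\<lambda>t. rpow t a)"
  by (cases "a = 0") (auto simp: rpow_def intro!: continuous_intros continuous_on_powr')

lemma continuous_on_rpow' [continuous_intros]:
  assumes "a \<ge> 0" "continuous_on S f" "\<And>x. x \<in> S \<Longrightarrow> f x \<ge> 0"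
  shows "continuous_on S (\<lambda>x. rpow (f x) a)"
  by (rule continuous_on_compose2[OF continuous_on_rpow[OF assms(1)] assms(2)]) (use assms(3) in auto)

lemma jacobi_F_interior_eq:
  assumes "\<alpha> > -1" "\<beta> > -1" "orthonormal_jacobi_system \<alpha> \<beta> P" "-1 < x" "x < 1"
  shows "jacobi_F_interior n \<alpha> \<beta> x =
    rpow (1 - x) (\<alpha>/2 + 1/4) * rpow (1 + x) (\<beta>/2 + 1/4) * \<bar>poly (P n) x\<bar>"
proof -
  have *: "1 - x\<^sup>2 = (1 - x) * (1 + x)" by (simp add: power2_eq_square algebra_simps)
  show ?thesis using assms(4,5)
    by (simp add: jacobi_F_interior_def abs_poly_jacobi_poly[OF assms(1-3)] * jacobi_weight_def
        powr_mult powr_powr powr_add rpow_eq_powr)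
qed

text \<open>Holds at the endpoints too, where \<open>jacobi_F\<close> is defined as a limit.\<close>

lemma jacobi_F_eq:
  assumes "\<alpha> \<ge> -1/2" "\<beta> \<ge> -1/2" and P: "orthonormal_jacobi_system \<alpha> \<beta> P" and x: "x \<in> {-1..1}"
  shows "jacobi_F n \<alpha> \<beta> x =
    rpow (1 - x) (\<alpha>/2 + 1/4) * rpow (1 + x) (\<beta>/2 + 1/4) * \<bar>poly (P n) x\<bar>"
proof -
  define f where "f x = rpow (1 - x) (\<alpha>/2 + 1/4) * rpow (1 + x) (\<beta>/2 + 1/4) * \<bar>poly (P n) x\<bar>" for x
  have ab: "\<alpha> > -1" "\<beta> > -1" using assms by auto
  note int = jacobi_F_interior_eq[OF ab P, folded f_def]
  have cont: "continuous_on {-1..1} f"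
    unfolding f_def using assms by (intro continuous_intros) auto
  consider "-1 < x" "x < 1" | "x = 1" | "x = -1" using x by force
  then have "jacobi_F n \<alpha> \<beta> x = f x"
  proof cases
    case 1
    then show ?thesis using int[of x] by (simp add: jacobi_F_def f_def)
  next
    case 2
    have "(f \<longlongrightarrow> f 1) (at 1 within {-1..1})" using cont by (simp add: continuous_on)
    then have "(f \<longlongrightarrow> f 1) (at_left 1)" by (simp add: at_within_Icc_at_left)
    moreover have "\<forall>\<^sub>F x in at_left 1. f x = jacobi_F_interior n \<alpha> \<beta> x"
      using eventually_at_left_real[of "-1" "1::real", OF less_trans[OF neg_less_0_iff_less[THEN iffD2, OF zero_less_one] zero_less_one]] by eventually_elim (auto simp: int f_def)
    ultimately have "(jacobi_F_interior n \<alpha> \<beta> \<longlongrightarrow> f 1) (at_left 1)"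
      by (rule Lim_transform_eventually)
    then show ?thesis using 2 by (simp add: jacobi_F_def tendsto_Lim)
  next
    case 3
    have "(f \<longlongrightarrow> f (-1)) (at (-1) within {-1..1})" using cont by (simp add: continuous_on)
    then have "(f \<longlongrightarrow> f (-1)) (at_right (-1))" by (simp add: at_within_Icc_at_right)
    moreover have "\<forall>\<^sub>F x in at_right (-1). f x = jacobi_F_interior n \<alpha> \<beta> x"
      using eventually_at_right_real[of "-1" "1::real", OF less_trans[OF neg_less_0_iff_less[THEN iffD2, OF zero_less_one] zero_less_one]] by eventually_elim (auto simp: int f_def)
    ultimately have "(jacobi_F_interior n \<alpha> \<beta> \<longlongrightarrow> f (-1)) (at_right (-1))"
      by (rule Lim_transform_eventually)
    then show ?thesis using 3 by (simp add: jacobi_F_def tendsto_Lim)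
  qed
  then show ?thesis by (simp add: f_def)
qed

section \<open>The hypergeometric form and its norm\<close>

text \<open>An alternating binomial sum is, up to sign, an iterated forward difference at 0;
  Pascal's rule peels off one difference.\<close>

lemma alternating_binomial_sum_Suc:
  fixes f :: "nat \<Rightarrow> 'a::comm_ring_1"
  shows "(\<Sum>k\<le>Suc n. (-1) ^ k * of_nat (Suc n choose k) * f k) =
         (\<Sum>k\<le>n. (-1) ^ k * of_nat (n choose k) * (f k - f (Suc k)))"
proof -
  have "(\<Sum>k\<le>Suc n. (-1) ^ k * of_nat (Suc n choose k) * f k) =
      f 0 + (\<Sum>k\<le>n. (-1) ^ Suc k * of_nat (Suc n choose Suc k) * f (Suc k))"
    by (subst sum.atMost_Suc_shift) simp
  also have "(\<Sum>k\<le>n. (-1) ^ Suc k * of_nat (Suc n choose Suc k) * f (Suc k)) =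
      (\<Sum>k\<le>n. (-1) ^ Suc k * of_nat (n choose Suc k) * f (Suc k)) -
      (\<Sum>k\<le>n. (-1) ^ k * of_nat (n choose k) * f (Suc k))"
    by (subst sum_subtractf[symmetric], rule sum.cong) (simp_all add: algebra_simps)
  also have "f 0 + ((\<Sum>k\<le>n. (-1) ^ Suc k * of_nat (n choose Suc k) * f (Suc k)) -
      (\<Sum>k\<le>n. (-1) ^ k * of_nat (n choose k) * f (Suc k))) =
      (f 0 + (\<Sum>k\<le>n. (-1) ^ Suc k * of_nat (n choose Suc k) * f (Suc k))) -
      (\<Sum>k\<le>n. (-1) ^ k * of_nat (n choose k) * f (Suc k))" by simp
  also have "f 0 + (\<Sum>k\<le>n. (-1) ^ Suc k * of_nat (n choose Suc k) * f (Suc k)) =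
      (\<Sum>k\<le>Suc n. (-1) ^ k * of_nat (n choose k) * f k)"
    by (subst sum.atMost_Suc_shift) (simp add: binomial_eq_0)
  also have "\<dots> = (\<Sum>k\<le>n. (-1) ^ k * of_nat (n choose k) * f k)" by (simp add: binomial_eq_0)
  finally show ?thesis by (simp add: sum_subtractf right_diff_distrib)
qed

text \<open>Rising factorials behave under differences like powers under differentiation: the degree
  m drops by one, a factor m appears and c becomes c + 1. Hence c is generalised in the induction,
  and more than m differences give 0.\<close>

lemma alternating_binomial_sum_pochhammer:
  fixes c :: "'a::comm_ring_1"
  assumes "m < n"
  shows "(\<Sum>k\<le>n. (-1) ^ k * of_nat (n choose k) * pochhammer (of_nat k + c) m) = 0"
  using assms
proof (induction n arbitrary: m c)
  case (Suc n)
  have *: "pochhammer (of_nat k + c) m - pochhammer (of_nat (Suc k) + c) m =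
      - of_nat m * pochhammer (of_nat k + (c + 1)) (m - 1)" for k
  proof (cases m)
    case (Suc l)
    have "pochhammer (of_nat k + c) m = (of_nat k + c) * pochhammer (of_nat k + (c + 1)) l"
      by (simp add: Suc pochhammer_rec add_ac)
    moreover have "pochhammer (of_nat (Suc k) + c) m =
        pochhammer (of_nat k + (c + 1)) l * (of_nat k + c + 1 + of_nat l)"
      by (simp add: Suc pochhammer_Suc add_ac)
    ultimately show ?thesis by (simp add: Suc algebra_simps)
  qed simp
  have "(\<Sum>k\<le>Suc n. (-1) ^ k * of_nat (Suc n choose k) * pochhammer (of_nat k + c) m) =
      - of_nat m * (\<Sum>k\<le>n. (-1) ^ k * of_nat (n choose k) * pochhammer (of_nat k + (c + 1)) (m - 1))"
    unfolding alternating_binomial_sum_Suc * sum_distrib_left by (intro sum.cong) (auto simp: algebra_simps)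
  also have "\<dots> = 0" using Suc by (cases m) auto
  finally show ?case .
qed simp

text \<open>The partial fraction expansion of n! / (x (x + 1) ... (x + n)). It evaluates the inner
  product with the first power that is not orthogonal.\<close>

lemma alternating_binomial_sum_inverse:
  fixes x :: "'a::linordered_field"
  assumes "x > 0"
  shows "(\<Sum>k\<le>n. (-1) ^ k * of_nat (n choose k) * (1 / (of_nat k + x))) = fact n / pochhammer x (Suc n)"
  using assms
proof (induction n arbitrary: x)
  case (Suc n)
  have pos: "pochhammer (x + 1) n > 0" "x > 0" "1 + x + of_nat n > 0"
    using Suc.prems by (auto intro!: pochhammer_pos add_pos_nonneg)
  have "(\<Sum>k\<le>Suc n. (-1) ^ k * of_nat (Suc n choose k) * (1 / (of_nat k + x))) =
      (\<Sum>k\<le>n. (-1) ^ k * of_nat (n choose k) * (1 / (of_nat k + x))) -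
      (\<Sum>k\<le>n. (-1) ^ k * of_nat (n choose k) * (1 / (of_nat k + (x + 1))))"
    unfolding alternating_binomial_sum_Suc by (simp add: sum_subtractf algebra_simps)
  also have "\<dots> = fact n / pochhammer x (Suc n) - fact n / pochhammer (x + 1) (Suc n)"
    using Suc.prems by (subst (1 2) Suc.IH) auto
  also have "\<dots> = fact n / (x * pochhammer (x + 1) n) - fact n / (pochhammer (x + 1) n * (1 + x + of_nat n))"
    unfolding pochhammer_rec[of x n] pochhammer_Suc[of "x + 1" n] by (simp add: add_ac)
  also have "\<dots> = fact (Suc n) / (x * (pochhammer (x + 1) n * (1 + x + of_nat n)))"
    using pos by (simp add: divide_simps) (simp add: algebra_simps)
  also have "\<dots> = fact (Suc n) / pochhammer x (Suc (Suc n))"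
    unfolding pochhammer_rec[of x "Suc n"] pochhammer_Suc[of "x + 1" n] by (simp add: add_ac)
  finally show ?case .
qed simp

lemma Gamma_plus1_real: "x > (0::real) \<Longrightarrow> Gamma (x + 1) = x * Gamma x"
  by (rule Gamma_plus1) (auto elim!: nonpos_Ints_cases)

lemma pochhammer_Gamma_real:
  "x > (0::real) \<Longrightarrow> pochhammer x n = Gamma (x + real n) / Gamma x"
  by (subst pochhammer_Gamma) (auto elim!: nonpos_Ints_cases)

text \<open>The hypergeometric form of the Jacobi polynomial, expanded at \<open>-1\<close> and normalised to be
  \<open>1\<close> there.\<close>

definition jacobi_coeff :: "nat \<Rightarrow> real \<Rightarrow> real \<Rightarrow> nat \<Rightarrow> real" where
  "jacobi_coeff n \<alpha> \<beta> k =
     (-1) ^ k * of_nat (n choose k) * pochhammer (real n + \<alpha> + \<beta> + 1) k / pochhammer (\<beta> + 1) k"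

definition jacobi_hyp :: "nat \<Rightarrow> real \<Rightarrow> real \<Rightarrow> real poly" where
  "jacobi_hyp n \<alpha> \<beta> = (\<Sum>k\<le>n. smult (jacobi_coeff n \<alpha> \<beta> k) ([:1/2, 1/2:] ^ k))"

lemma poly_jacobi_hyp:
  "poly (jacobi_hyp n \<alpha> \<beta>) x = (\<Sum>k\<le>n. jacobi_coeff n \<alpha> \<beta> k * ((1 + x) / 2) ^ k)"
  by (simp add: jacobi_hyp_def poly_sum add_divide_distrib)

lemma poly_jacobi_hyp_minus_1: "poly (jacobi_hyp n \<alpha> \<beta>) (-1) = 1"
proof -
  have "poly (jacobi_hyp n \<alpha> \<beta>) (-1) = (\<Sum>k\<le>n. if k = 0 then 1 else 0)"
    unfolding poly_jacobi_hyp by (intro sum.cong) (auto simp: jacobi_coeff_def)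
  then show ?thesis by simp
qed

text \<open>For \<open>n = 0\<close> the factor \<open>(\<alpha> + \<beta> + 1) \<Gamma>(\<alpha> + \<beta> + 1)\<close> is written as \<open>\<Gamma>(\<alpha> + \<beta> + 2)\<close>: at
  \<open>\<alpha> + \<beta> = -1\<close> the former would be the junk value \<open>0\<close>.\<close>

definition jacobi_norm_sq :: "nat \<Rightarrow> real \<Rightarrow> real \<Rightarrow> real" where
  "jacobi_norm_sq n \<alpha> \<beta> =
     2 powr (\<alpha> + \<beta> + 1) * (Gamma (\<beta> + 1))\<^sup>2 * Gamma (real n + \<alpha> + 1) * fact n /
       (Gamma (real n + \<beta> + 1) *
          (if n = 0 then Gamma (\<alpha> + \<beta> + 2)
           else (2 * real n + \<alpha> + \<beta> + 1) * Gamma (real n + \<alpha> + \<beta> + 1)))"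

context
  fixes \<alpha> \<beta> :: real
  assumes \<alpha>: "\<alpha> > -1" and \<beta>: "\<beta> > -1"
begin

lemma jacobi_inner_half_powers:
  "jacobi_inner \<alpha> \<beta> ([:1/2, 1/2:] ^ k) ([:1/2, -(1/2):] ^ j) =
     2 powr (\<alpha> + \<beta> + 1) * Gamma (\<alpha> + real j + 1) * Gamma (\<beta> + real k + 1) /
       Gamma (\<alpha> + \<beta> + real j + real k + 2)"
proof -
  have "jacobi_inner \<alpha> \<beta> ([:1/2, 1/2:] ^ k) ([:1/2, -(1/2):] ^ j) =
      integral {-1..1} (\<lambda>x. poly ([:1/2, 1/2:] ^ k * [:1/2, -(1/2):] ^ j) x * jacobi_weight \<alpha> \<beta> x)"
    using set_borel_integral_eq_integral(2)[OF set_integrable_poly_jacobi_weight[OF \<alpha> \<beta>]]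
    by (simp only: jacobi_inner_def poly_mult[symmetric])
  also have "\<dots> = integral {-1..1} (\<lambda>x. (1/2) ^ (k + j) *
      ((1 - x) powr (\<alpha> + real j) * (1 + x) powr (\<beta> + real k)))"
  \<comment> \<open>Away from the endpoints both bases are positive, as the passage between
    \<open>powr\<close> and natural powers requires.\<close>
  proof (rule integral_spike[where S = "{-1, 1}"])
    fix x :: real assume "x \<in> {-1..1} - {-1, 1}"
    then have "1 - x > 0" "1 + x > 0" by auto
    moreover have p: "poly [:1/2, 1/2:] x = (1 + x) / 2" "poly [:1/2, -(1/2):] x = (1 - x) / 2"
      by (simp_all add: field_simps)
    ultimately show "(1/2) ^ (k + j) * ((1 - x) powr (\<alpha> + real j) * (1 + x) powr (\<beta> + real k)) =
        poly ([:1/2, 1/2:] ^ k * [:1/2, -(1/2):] ^ j) x * jacobi_weight \<alpha> \<beta> x"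
      by (simp add: jacobi_weight_def powr_add powr_realpow power_add power_divide poly_power p
          del: poly_pCons)
  qed auto
  also have "\<dots> = (1/2) ^ (k + j) * (2 powr (\<alpha> + real j + (\<beta> + real k) + 1) *
      Beta (\<alpha> + real j + 1) (\<beta> + real k + 1))"
    using \<alpha> \<beta> by (intro integral_unique has_integral_mult_right has_integral_Beta_symmetric) auto
  also have "2 powr (\<alpha> + real j + (\<beta> + real k) + 1) = 2 powr (\<alpha> + \<beta> + 1) * 2 ^ (k + j)"
    by (simp add: powr_add[symmetric] powr_realpow[symmetric] add_ac)
  also have "(1/2) ^ (k + j) * (2 powr (\<alpha> + \<beta> + 1) * 2 ^ (k + j) *
      Beta (\<alpha> + real j + 1) (\<beta> + real k + 1)) =
      2 powr (\<alpha> + \<beta> + 1) * Beta (\<alpha> + real j + 1) (\<beta> + real k + 1)"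
    by (simp add: power_divide)
  also have "\<alpha> + real j + 1 + (\<beta> + real k + 1) = \<alpha> + \<beta> + real j + real k + 2" by simp
  then have "Beta (\<alpha> + real j + 1) (\<beta> + real k + 1) =
      Gamma (\<alpha> + real j + 1) * Gamma (\<beta> + real k + 1) / Gamma (\<alpha> + \<beta> + real j + real k + 2)"
    by (simp add: Beta_def add_ac)
  finally show ?thesis by simp
qed

text \<open>Testing powers of (1 + x)/2 against powers of (1 - x)/2 produces \<Gamma>(\<beta> + k +
  1), which cancels the denominator of \<open>jacobi_coeff\<close>. What remains under the sum
  depends on the parameters only through \<alpha> + \<beta>.\<close>

lemma jacobi_inner_hyp_half_power:
  "jacobi_inner \<alpha> \<beta> (jacobi_hyp n \<alpha> \<beta>) ([:1/2, -(1/2):] ^ j) =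
     2 powr (\<alpha> + \<beta> + 1) * Gamma (\<beta> + 1) * Gamma (\<alpha> + real j + 1) *
     (\<Sum>k\<le>n. (-1) ^ k * of_nat (n choose k) *
        (pochhammer (real n + \<alpha> + \<beta> + 1) k / Gamma (\<alpha> + \<beta> + real j + real k + 2)))"
proof -
  have *: "Gamma (\<beta> + real k + 1) = pochhammer (\<beta> + 1) k * Gamma (\<beta> + 1)"
    and **: "pochhammer (\<beta> + 1) k > 0" for k
    using \<beta> Gamma_real_pos[of "\<beta> + 1", THEN less_imp_neq] pochhammer_Gamma_real[of "\<beta> + 1" k]
    by (auto simp: pochhammer_pos add_ac)
  show ?thesis
    unfolding jacobi_hyp_def jacobi_inner_sum_smult_left[OF \<alpha> \<beta>] jacobi_inner_half_powers sum_distrib_left *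
    by (intro sum.cong refl) (use **[THEN less_imp_neq] in \<open>simp add: jacobi_coeff_def field_simps\<close>)
qed

text \<open>Up to the constant 1/\<Gamma>(s), the quotient is \<Gamma>(s + k)/\<Gamma>(t) with s + k
  - t = n - 1 - j. This is a rising factorial of degree n - 1 - j in k, so its n-th difference is
  0.\<close>

lemma jacobi_inner_hyp_orthogonal:
  assumes "j < n"
  shows "jacobi_inner \<alpha> \<beta> (jacobi_hyp n \<alpha> \<beta>) ([:1/2, -(1/2):] ^ j) = 0"
proof -
  define s where "s = real n + \<alpha> + \<beta> + 1"
  have s: "s > 0" using \<alpha> \<beta> assms by (simp add: s_def)
  have Gs: "Gamma s > 0" using s by simp
  have "pochhammer s k / Gamma (\<alpha> + \<beta> + real j + real k + 2) =
      pochhammer (real k + (\<alpha> + \<beta> + real j + 2)) (n - 1 - j) / Gamma s" for k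
  proof -
    define t where "t = \<alpha> + \<beta> + real j + real k + 2"
    have t: "t > 0" using \<alpha> \<beta> by (simp add: t_def)
    have "pochhammer s k = Gamma (s + real k) / Gamma s"
      using s by (rule pochhammer_Gamma_real)
    moreover have "pochhammer t (n - 1 - j) = Gamma (t + real (n - 1 - j)) / Gamma t"
      using t by (rule pochhammer_Gamma_real)
    moreover have "t + real (n - 1 - j) = s + real k"
      using assms by (simp add: t_def s_def of_nat_diff)
    moreover have "real k + (\<alpha> + \<beta> + real j + 2) = t" by (simp add: t_def)
    ultimately show ?thesis using t unfolding t_def[symmetric] by simp
  qed
  then have "jacobi_inner \<alpha> \<beta> (jacobi_hyp n \<alpha> \<beta>) ([:1/2, -(1/2):] ^ j) =
      2 powr (\<alpha> + \<beta> + 1) * Gamma (\<beta> + 1) * Gamma (\<alpha> + real j + 1) *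
      ((\<Sum>k\<le>n. (-1) ^ k * of_nat (n choose k) *
        pochhammer (real k + (\<alpha> + \<beta> + real j + 2)) (n - 1 - j)) / Gamma s)"
    unfolding jacobi_inner_hyp_half_power s_def[symmetric] sum_divide_distrib by simp
  also have "(\<Sum>k\<le>n. (-1) ^ k * real (n choose k) *
        pochhammer (real k + (\<alpha> + \<beta> + real j + 2)) (n - 1 - j)) = 0"
    using assms by (intro alternating_binomial_sum_pochhammer) auto
  finally show ?thesis by simp
qed

text \<open>At j = n the lower Gamma argument exceeds the upper one by 1, and the quotient is 1/(k +
  s) up to a constant. Degree 0 stands apart because s = \<alpha> + \<beta> + 1 need not be positive
  there.\<close>

lemma jacobi_inner_hyp_half_power_n:
  "jacobi_inner \<alpha> \<beta> (jacobi_hyp n \<alpha> \<beta>) ([:1/2, -(1/2):] ^ n) =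
     2 powr (\<alpha> + \<beta> + 1) * Gamma (\<beta> + 1) * Gamma (\<alpha> + real n + 1) *
     (if n = 0 then 1 / Gamma (\<alpha> + \<beta> + 2) else
        fact n / (pochhammer (real n + \<alpha> + \<beta> + 1) (Suc n) * Gamma (real n + \<alpha> + \<beta> + 1)))"
proof (cases "n = 0")
  case True
  then show ?thesis using jacobi_inner_hyp_half_power[of n n] by (simp add: add_ac)
next
  case False
  define s where "s = real n + \<alpha> + \<beta> + 1"
  have s: "s > 0" using \<alpha> \<beta> False by (simp add: s_def)
  have "pochhammer s k / Gamma (\<alpha> + \<beta> + real n + real k + 2) = 1 / (real k + s) / Gamma s" for k
  proof -
    have "pochhammer s k = Gamma (s + real k) / Gamma s"
      using s by (rule pochhammer_Gamma_real)
    moreover have "Gamma (\<alpha> + \<beta> + real n + real k + 2) = (s + real k) * Gamma (s + real k)"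
      using Gamma_plus1_real[of "s + real k"] s by (simp add: s_def add_ac)
    moreover have "Gamma (s + real k) \<noteq> 0"
      by (intro less_imp_neq[THEN not_sym] Gamma_real_pos) (use s in simp)
    ultimately show ?thesis using s by (simp add: add_ac)
  qed
  then have "jacobi_inner \<alpha> \<beta> (jacobi_hyp n \<alpha> \<beta>) ([:1/2, -(1/2):] ^ n) =
      2 powr (\<alpha> + \<beta> + 1) * Gamma (\<beta> + 1) * Gamma (\<alpha> + real n + 1) *
      ((\<Sum>k\<le>n. (-1) ^ k * of_nat (n choose k) * (1 / (real k + s))) / Gamma s)"
    unfolding jacobi_inner_hyp_half_power s_def[symmetric] sum_divide_distrib by simp
  also note alternating_binomial_sum_inverse[OF s]
  finally show ?thesis using False by (simp add: s_def)
qed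

lemma degree_jacobi_hyp_le: "degree (jacobi_hyp n \<alpha> \<beta>) \<le> n"
  unfolding jacobi_hyp_def
  by (intro degree_sum_le) (auto intro!: order_trans[OF degree_smult_le] order_trans[OF degree_power_le])

lemma jacobi_hyp_orthogonal_lower:
  assumes "degree q < n"
  shows "jacobi_inner \<alpha> \<beta> (jacobi_hyp n \<alpha> \<beta>) q = 0"
proof -
  obtain a where "q = (\<Sum>k<n. smult (a k) ([:1/2, -(1/2):] ^ k))"
    using poly_basis_expansion[of "\<lambda>k. [:1/2, -(1/2)::real:] ^ k" q n] assms
    by (auto simp: degree_power_eq)
  then show ?thesis
    by (simp add: jacobi_inner_commute[of _ _ "jacobi_hyp n \<alpha> \<beta>"] jacobi_inner_sum_smult_left[OF \<alpha> \<beta>])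
      (simp add: jacobi_inner_commute[of _ _ _ "jacobi_hyp n \<alpha> \<beta>"] jacobi_inner_hyp_orthogonal)
qed

lemma coeff_jacobi_hyp: "coeff (jacobi_hyp n \<alpha> \<beta>) n = jacobi_coeff n \<alpha> \<beta> n * (1/2) ^ n"
proof -
  have "coeff ([:1/2, 1/2::real:] ^ k) n = (if k = n then (1/2) ^ n else 0)" if "k \<le> n" for k
  proof (cases "k = n")
    case True
    have "coeff ([:1/2, 1/2::real:] ^ n) (degree ([:1/2, 1/2::real:] ^ n)) = (1/2) ^ n"
      by (simp only: lead_coeff_power) simp
    then show ?thesis using True by (simp add: degree_power_eq)
  next
    case False
    then show ?thesis using that by (simp add: coeff_eq_0 degree_power_eq)
  qed
  then show ?thesis unfolding jacobi_hyp_def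
    by (simp add: coeff_sum if_distrib[of "(*) _"] cong: if_cong)
qed

lemma jacobi_coeff_n:
  "jacobi_coeff n \<alpha> \<beta> n = (-1) ^ n * pochhammer (real n + \<alpha> + \<beta> + 1) n / pochhammer (\<beta> + 1) n"
  by (simp add: jacobi_coeff_def)

lemma pochhammer_jacobi_pos: "pochhammer (real n + \<alpha> + \<beta> + 1) n > 0"
  using \<alpha> \<beta> by (cases "n = 0") (auto intro!: pochhammer_pos)

lemma jacobi_coeff_n_nonzero: "jacobi_coeff n \<alpha> \<beta> n \<noteq> 0"
  using pochhammer_jacobi_pos[of n] pochhammer_pos[of "\<beta> + 1" n] \<beta> by (simp add: jacobi_coeff_n)

lemma degree_jacobi_hyp: "degree (jacobi_hyp n \<alpha> \<beta>) = n"
  using degree_jacobi_hyp_le[of n] coeff_jacobi_hyp[of n] jacobi_coeff_n_nonzero[of n]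
  by (intro antisym le_degree) auto

lemma jacobi_inner_hyp_self:
  "jacobi_inner \<alpha> \<beta> (jacobi_hyp n \<alpha> \<beta>) (jacobi_hyp n \<alpha> \<beta>) = jacobi_norm_sq n \<alpha> \<beta>"
proof -
  \<comment> \<open>The quotient of the leading coefficients of \<open>jacobi_hyp\<close> and of ((1
    - x)/2)^n, whose signs (-1)^n cancel. Subtracting this multiple leaves a polynomial of lower
    degree, which is orthogonal to \<open>jacobi_hyp\<close>.\<close>
  define c where "c = pochhammer (real n + \<alpha> + \<beta> + 1) n / pochhammer (\<beta> + 1) n"
  define r where "r = jacobi_hyp n \<alpha> \<beta> - smult c ([:1/2, -(1/2):] ^ n)"
  have "coeff ([:1/2, -(1/2)::real:] ^ n) (degree ([:1/2, -(1/2)::real:] ^ n)) = (-1/2) ^ n"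
    by (simp only: lead_coeff_power) simp
  then have cn: "coeff ([:1/2, -(1/2)::real:] ^ n) n = (-1) ^ n * (1/2) ^ n"
    by (simp add: degree_power_eq power_mult_distrib[symmetric])
  have "degree r \<le> n" unfolding r_def
    by (intro degree_diff_le degree_jacobi_hyp_le order_trans[OF degree_smult_le])
      (simp add: degree_power_eq)
  moreover have "coeff r n = 0"
    unfolding r_def by (simp add: coeff_jacobi_hyp jacobi_coeff_n cn c_def)
  ultimately have r: "r = 0 \<or> degree r < n" by (metis le_neq_implies_less leading_coeff_0_iff)
  have eq: "jacobi_hyp n \<alpha> \<beta> = r + smult c ([:1/2, -(1/2):] ^ n)" by (simp add: r_def)
  have "jacobi_inner \<alpha> \<beta> r (jacobi_hyp n \<alpha> \<beta>) = 0"
    using r jacobi_hyp_orthogonal_lower[of r n] by (auto simp: jacobi_inner_commute[of _ _ r] jacobi_inner_commute[of _ _ _ 0])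
  then have "jacobi_inner \<alpha> \<beta> (r + smult c ([:1/2, -(1/2):] ^ n)) (jacobi_hyp n \<alpha> \<beta>) =
      c * jacobi_inner \<alpha> \<beta> (jacobi_hyp n \<alpha> \<beta>) ([:1/2, -(1/2):] ^ n)"
    unfolding jacobi_inner_add_left[OF \<alpha> \<beta>] jacobi_inner_smult_left
    by (simp add: jacobi_inner_commute[of _ _ "jacobi_hyp n \<alpha> \<beta>"])
  then have *: "jacobi_inner \<alpha> \<beta> (jacobi_hyp n \<alpha> \<beta>) (jacobi_hyp n \<alpha> \<beta>) =
      c * jacobi_inner \<alpha> \<beta> (jacobi_hyp n \<alpha> \<beta>) ([:1/2, -(1/2):] ^ n)"
    by (simp only: eq[symmetric])
  have G: "Gamma (\<beta> + 1) > 0" using \<beta> by simp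
  have p: "pochhammer (\<beta> + 1) n = Gamma (real n + \<beta> + 1) / Gamma (\<beta> + 1)"
    using \<beta> by (simp add: pochhammer_Gamma_real add_ac)
  show ?thesis
  proof (cases "n = 0")
    case True
    then show ?thesis using G unfolding * jacobi_inner_hyp_half_power_n jacobi_norm_sq_def
      by (simp add: c_def power2_eq_square add_ac)
  next
    case False
    define P where "P = pochhammer (real n + \<alpha> + \<beta> + 1) n"
    have P: "P > 0" unfolding P_def by (rule pochhammer_jacobi_pos)
    have "pochhammer (real n + \<alpha> + \<beta> + 1) (Suc n) = P * (2 * real n + \<alpha> + \<beta> + 1)"
      by (simp add: pochhammer_Suc P_def)
    then show ?thesis using G P False
      unfolding * jacobi_inner_hyp_half_power_n jacobi_norm_sq_def c_def p P_def[symmetric]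
      by (simp add: power2_eq_square add_ac)
  qed
qed

lemma jacobi_norm_sq_pos: "jacobi_norm_sq n \<alpha> \<beta> > 0"
proof -
  have "2 * real n + \<alpha> + \<beta> + 1 > 0" "real n + \<alpha> + \<beta> + 1 > 0" if "n \<noteq> 0"
    using that \<alpha> \<beta> by simp_all
  moreover have "real n + \<alpha> + 1 > 0" "real n + \<beta> + 1 > 0" "\<beta> + 1 > 0" "\<alpha> + \<beta> + 2 > 0"
    using \<alpha> \<beta> by simp_all
  ultimately show ?thesis unfolding jacobi_norm_sq_def
    by (auto intro!: divide_pos_pos mult_pos_pos zero_less_power Gamma_real_pos)
qed

lemma orthonormal_jacobi_hyp:
  "orthonormal_jacobi_system \<alpha> \<beta>
     (\<lambda>n. smult (1 / sqrt (jacobi_norm_sq n \<alpha> \<beta>)) (jacobi_hyp n \<alpha> \<beta>))"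
proof -
  have smr: "jacobi_inner \<alpha> \<beta> p (smult c q) = c * jacobi_inner \<alpha> \<beta> p q" for c p q
    by (metis jacobi_inner_commute jacobi_inner_smult_left)
  have "jacobi_inner \<alpha> \<beta> (jacobi_hyp m \<alpha> \<beta>) (jacobi_hyp n \<alpha> \<beta>) = 0" if "m \<noteq> n" for m n
    using that jacobi_hyp_orthogonal_lower degree_jacobi_hyp
    by (metis jacobi_inner_commute linorder_neqE_nat)
  then show ?thesis using jacobi_norm_sq_pos[THEN less_imp_le] jacobi_norm_sq_pos
    by (auto simp: orthonormal_jacobi_system_def degree_jacobi_hyp jacobi_inner_smult_left smr
        jacobi_inner_hyp_self less_imp_neq[OF jacobi_norm_sq_pos, symmetric])
qed

end

section \<open>Chebyshev parameters\<close>

text \<open>The change of variables is made on the open interval, where cos is injective and 1 - cos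
  \<theta>, 1 + cos \<theta> are positive, so that \<open>rpow\<close> is an ordinary power. Since
  sin \<theta> = sqrt ((1 - cos \<theta>) (1 + cos \<theta>)), the Jacobian raises both exponents of
  the weight by 1/2. Absolute integrability is known on the x side and is transported from
  there.\<close>

lemma jacobi_inner_trig:
  assumes "\<alpha> > -1" "\<beta> > -1"
    and I: "((\<lambda>\<theta>. poly p (cos \<theta>) * poly q (cos \<theta>) *
      (rpow (1 - cos \<theta>) (\<alpha>/2 + 1/4) * rpow (1 + cos \<theta>) (\<beta>/2 + 1/4))\<^sup>2) has_integral I) {0..pi}"
  shows "jacobi_inner \<alpha> \<beta> p q = I"
proof -
  define f where "f x = poly (p * q) x * jacobi_weight \<alpha> \<beta> x" for x
  have cos_bounds: "-1 < cos \<theta>" "cos \<theta> < 1" if "\<theta> \<in> {0<..<pi}" for \<theta>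
    using that cos_monotone_0_pi[of 0 \<theta>] cos_monotone_0_pi[of \<theta> pi] by auto
  have img: "cos ` {0<..<pi} = {-1<..<1}"
  proof (intro equalityI subsetI)
    fix y :: real assume "y \<in> {-1<..<1}"
    then have "cos (arccos y) = y" "0 < arccos y" "arccos y < pi"
      using arccos_lt_bounded[of y] by auto
    then show "y \<in> cos ` {0<..<pi}" by force
  qed (use cos_bounds in auto)
  have eq: "\<bar>- sin \<theta>\<bar> * f (cos \<theta>) = poly p (cos \<theta>) * poly q (cos \<theta>) *
      (rpow (1 - cos \<theta>) (\<alpha>/2 + 1/4) * rpow (1 + cos \<theta>) (\<beta>/2 + 1/4))\<^sup>2" if "\<theta> \<in> {0<..<pi}" for \<theta>
  proof -
    define u v where "u = 1 - cos \<theta>" and "v = 1 + cos \<theta>"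
    have uv: "u > 0" "v > 0" using cos_bounds[OF that] by (auto simp: u_def v_def)
    have s: "sin \<theta> > 0" using that by (auto intro: sin_gt_zero)
    have "u * v = (sin \<theta>)\<^sup>2"
      by (simp add: u_def v_def sin_squared_eq power2_eq_square algebra_simps)
    then have "sin \<theta> = sqrt (u * v)" using s by simp
    then have s': "sin \<theta> = u powr (1/2) * v powr (1/2)"
      using uv by (simp add: powr_half_sqrt real_sqrt_mult)
    have "(rpow u (\<alpha>/2 + 1/4) * rpow v (\<beta>/2 + 1/4))\<^sup>2 = u powr (\<alpha> + 1/2) * v powr (\<beta> + 1/2)"
      using uv by (simp add: rpow_eq_powr power2_eq_square powr_add[symmetric] mult_ac)
    also have "\<dots> = sin \<theta> * (u powr \<alpha> * v powr \<beta>)"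
      by (simp add: s' powr_add)
    finally show ?thesis using s by (simp add: f_def jacobi_weight_def u_def v_def)
  qed
  have int: "set_integrable lborel {-1..1} f"
    unfolding f_def by (rule set_integrable_poly_jacobi_weight[OF assms(1,2)])
  have int': "set_integrable lborel {-1<..<1} f"
    by (rule set_integrable_subset[OF int]) auto
  then have "f absolutely_integrable_on {-1<..<1}"
    unfolding set_integrable_def by (intro integrable_completion[THEN iffD2]) auto
  then have f: "f absolutely_integrable_on cos ` {0<..<pi} \<and>
      integral (cos ` {0<..<pi}) f = integral {-1<..<1} f"
    by (simp add: img)
  have "(cos has_field_derivative - sin \<theta>) (at \<theta> within {0<..<pi})" for \<theta> :: real
    using DERIV_cos[of \<theta>] by (rule has_field_derivative_at_within)
  moreover have "inj_on cos {0<..<pi}"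
    by (rule inj_onI) (metis cos_inj_pi greaterThanLessThan_iff less_imp_le)
  ultimately have "integral {0<..<pi} (\<lambda>\<theta>. \<bar>- sin \<theta>\<bar> * f (cos \<theta>)) = integral {-1<..<1} f"
    using has_absolute_integral_change_of_variables_1'[of "{0<..<pi}" cos "\<lambda>\<theta>. - sin \<theta>" f] f by force
  moreover have "integral {0<..<pi} (\<lambda>\<theta>. \<bar>- sin \<theta>\<bar> * f (cos \<theta>)) = I"
  proof -
    have "((\<lambda>\<theta>. poly p (cos \<theta>) * poly q (cos \<theta>) *
      (rpow (1 - cos \<theta>) (\<alpha>/2 + 1/4) * rpow (1 + cos \<theta>) (\<beta>/2 + 1/4))\<^sup>2) has_integral I) {0<..<pi}"
      using I by (simp add: has_integral_Icc_iff_Ioo)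
    then have "((\<lambda>\<theta>. \<bar>- sin \<theta>\<bar> * f (cos \<theta>)) has_integral I) {0<..<pi}"
      by (rule has_integral_eq[rotated]) (use eq in auto)
    then show ?thesis by (rule integral_unique)
  qed
  moreover have "jacobi_inner \<alpha> \<beta> p q = integral {-1..1} f"
    using set_borel_integral_eq_integral(2)[OF int] by (simp add: jacobi_inner_def f_def)
  moreover have "integral {-1..1} f = integral {-1<..<1} f"
    by (simp add: integral_open_interval_real)
  ultimately show ?thesis by simp
qed

text \<open>The substitution \<open>x = cos \<theta>\<close> turns the weight into the square of the factor multiplying
  \<open>\<bar>p\<^sub>n\<bar>\<close> in \<open>jacobi_F\<close>.\<close>

lemma jacobi_F_trig:
  assumes "\<alpha> \<ge> -1/2" "\<beta> \<ge> -1/2" "\<And>n. degree (P n) = n"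
    and t: "\<And>n \<theta>. \<theta> \<in> {0..pi} \<Longrightarrow>
      rpow (1 - cos \<theta>) (\<alpha>/2 + 1/4) * rpow (1 + cos \<theta>) (\<beta>/2 + 1/4) * poly (P n) (cos \<theta>) = t n \<theta>"
    and orth: "\<And>m n. ((\<lambda>\<theta>. t m \<theta> * t n \<theta>) has_integral (if m = n then 1 else 0)) {0..pi}"
    and \<theta>: "\<theta> \<in> {0..pi}"
  shows "jacobi_F n \<alpha> \<beta> (cos \<theta>) = \<bar>t n \<theta>\<bar>"
proof -
  have "jacobi_inner \<alpha> \<beta> (P m) (P n) = (if m = n then 1 else 0)" for m n
  proof (rule jacobi_inner_trig)
    show "((\<lambda>\<theta>. poly (P m) (cos \<theta>) * poly (P n) (cos \<theta>) *
      (rpow (1 - cos \<theta>) (\<alpha>/2 + 1/4) * rpow (1 + cos \<theta>) (\<beta>/2 + 1/4))\<^sup>2) has_integral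
      (if m = n then 1 else 0)) {0..pi}"
      by (rule has_integral_eq[OF _ orth])
        (simp add: t[symmetric] power2_eq_square mult_ac)
  qed (use assms in auto)
  then have "orthonormal_jacobi_system \<alpha> \<beta> P"
    using assms(3) by (simp add: orthonormal_jacobi_system_def)
  from jacobi_F_eq[OF assms(1,2) this, of "cos \<theta>" n] show ?thesis
    by (simp add: t[OF \<theta>, symmetric] abs_mult)
qed

section \<open>Trigonometric orthogonality and the four Chebyshev families\<close>

lemma has_integral_cos_Ints:
  assumes "k \<in> \<int>"
  shows "((\<lambda>\<theta>. cos (k * \<theta>)) has_integral (if k = 0 then pi else 0)) {0..pi}"
proof (cases "k = 0")
  case True
  then show ?thesis using has_integral_const_real[of "1::real" 0 pi] by simp
next
  case False
  have "((\<lambda>\<theta>. cos (k * \<theta>)) has_integral (sin (k * pi) / k - sin (k * 0) / k)) {0..pi}"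
    using False by (intro fundamental_theorem_of_calculus)
      (auto simp flip: has_real_derivative_iff_has_vector_derivative intro!: derivative_eq_intros)
  moreover have "sin (k * pi) = 0" using assms by (metis sin_zero_iff_int2 Ints_cases mult.commute)
  ultimately show ?thesis using False by simp
qed

text \<open>The product formulas reduce both integrals to cosines of integer frequency. In the four
  families below, a + b = 0 occurs only for two constants cos 0; this is the source of the
  exceptional degree 0.\<close>

lemma
  assumes "a - b \<in> \<int>" "a + b \<in> \<int>"
  shows has_integral_cos_cos: "((\<lambda>\<theta>. cos (a * \<theta>) * cos (b * \<theta>)) has_integral
      ((if a = b then pi/2 else 0) + (if a + b = 0 then pi/2 else 0))) {0..pi}"
    and has_integral_sin_sin: "((\<lambda>\<theta>. sin (a * \<theta>) * sin (b * \<theta>)) has_integral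
      ((if a = b then pi/2 else 0) - (if a + b = 0 then pi/2 else 0))) {0..pi}"
proof -
  have eq: "cos (a * \<theta>) * cos (b * \<theta>) = (cos ((a - b) * \<theta>) + cos ((a + b) * \<theta>)) / 2"
    "sin (a * \<theta>) * sin (b * \<theta>) = (cos ((a - b) * \<theta>) - cos ((a + b) * \<theta>)) / 2" for \<theta>
    by (simp_all add: cos_times_cos sin_times_sin algebra_simps)
  note I = has_integral_cos_Ints[OF assms(1)] has_integral_cos_Ints[OF assms(2)]
  show "((\<lambda>\<theta>. cos (a * \<theta>) * cos (b * \<theta>)) has_integral
      ((if a = b then pi/2 else 0) + (if a + b = 0 then pi/2 else 0))) {0..pi}"
    using has_integral_divide[OF has_integral_add[OF I], of 2] unfolding eq
    by (rule has_integral_eq_rhs) auto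
  show "((\<lambda>\<theta>. sin (a * \<theta>) * sin (b * \<theta>)) has_integral
      ((if a = b then pi/2 else 0) - (if a + b = 0 then pi/2 else 0))) {0..pi}"
    using has_integral_divide[OF has_integral_diff[OF I], of 2] unfolding eq
    by (rule has_integral_eq_rhs) auto
qed

text \<open>All four Chebyshev families come from this one recurrence and differ only in their two
  initial polynomials.\<close>

fun chebyshev_rec :: "real poly \<Rightarrow> real poly \<Rightarrow> nat \<Rightarrow> real poly" where
  "chebyshev_rec p q 0 = p"
| "chebyshev_rec p q (Suc 0) = q"
| "chebyshev_rec p q (Suc (Suc n)) = [:0, 2:] * chebyshev_rec p q (Suc n) - chebyshev_rec p q n"

lemma degree_chebyshev_rec:
  assumes "degree p = 0" "degree q = 1"
  shows "degree (chebyshev_rec p q n) = n"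
proof -
  have "degree (chebyshev_rec p q n) = n \<and> degree (chebyshev_rec p q (Suc n)) = Suc n"
  proof (induction n)
    case (Suc n)
    define r where "r = chebyshev_rec p q (Suc n)"
    have r: "degree r = Suc n" "r \<noteq> 0" using Suc by (auto simp: r_def)
    then have d: "degree ([:0, 2:] * r) = Suc (Suc n)" by (subst degree_mult_eq) auto
    have "degree ([:0, 2:] * r + - chebyshev_rec p q n) = Suc (Suc n)"
      using Suc d by (subst degree_add_eq_left) auto
    then show ?case using Suc by (simp add: r_def)
  qed (use assms in auto)
  then show ?thesis ..
qed

lemma poly_chebyshev_rec:
  assumes "g * poly p (cos \<theta>) = t 0" "g * poly q (cos \<theta>) = t 1"
    and "\<And>n. t (Suc (Suc n)) = 2 * cos \<theta> * t (Suc n) - t n"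
  shows "g * poly (chebyshev_rec p q n) (cos \<theta>) = t n"
proof (induction n rule: induct_nat_012)
  case (ge2 n)
  then show ?case using assms(3) by (simp add: algebra_simps)
qed (use assms in auto)

lemma one_plus_cos_nonneg: "0 \<le> 1 + cos (\<theta>::real)"
  using cos_ge_minus_one[of \<theta>] by linarith

lemma sqrt_1_minus_cos:
  assumes "\<theta> \<in> {0..pi}"
  shows "sqrt (1 - cos \<theta>) = sqrt 2 * sin (\<theta>/2)"
proof -
  have "1 - cos \<theta> = 2 * (sin (\<theta>/2))\<^sup>2"
    using cos_double_sin[of "\<theta>/2"] by simp
  moreover have "sin (\<theta>/2) \<ge> 0" using assms by (intro sin_ge_zero) auto
  ultimately show ?thesis by (simp add: real_sqrt_mult)
qed

lemma sqrt_1_plus_cos: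
  assumes "\<theta> \<in> {0..pi}"
  shows "sqrt (1 + cos \<theta>) = sqrt 2 * cos (\<theta>/2)"
proof -
  have "1 + cos \<theta> = 2 * (cos (\<theta>/2))\<^sup>2"
    using cos_double_cos[of "\<theta>/2"] by simp
  moreover have "cos (\<theta>/2) \<ge> 0" using assms by (intro cos_ge_zero) auto
  ultimately show ?thesis by (simp add: real_sqrt_mult)
qed

lemma sqrt_2_div_pi: "sqrt (2/pi) = sqrt 2 * (1 / sqrt pi)"
  by (simp add: real_sqrt_divide)

lemma sqrt_2_div_pi_sq: "sqrt (2/pi) * u * (sqrt (2/pi) * v) = 2/pi * (u * v)"
  by (simp add: real_sqrt_divide field_simps)

lemma half_add_Ints: "real m + 1/2 - (real n + 1/2) \<in> \<int>" "real m + 1/2 + (real n + 1/2) \<in> \<int>"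
proof -
  have "real m + 1/2 - (real n + 1/2) = of_int (int m - int n)" by simp
  then show "real m + 1/2 - (real n + 1/2) \<in> \<int>" by (metis Ints_of_int)
  have "real m + 1/2 + (real n + 1/2) = of_int (int m + int n + 1)" by simp
  then show "real m + 1/2 + (real n + 1/2) \<in> \<int>" by (metis Ints_of_int)
qed

lemma sin_Suc_Suc: "sin ((real (Suc (Suc n)) + a) * \<theta>) =
    2 * cos \<theta> * sin ((real (Suc n) + a) * \<theta>) - sin ((real n + a) * \<theta>)"
proof -
  have "(real (Suc (Suc n)) + a) * \<theta> = (real (Suc n) + a) * \<theta> + \<theta>"
    "(real n + a) * \<theta> = (real (Suc n) + a) * \<theta> - \<theta>" by (simp_all add: algebra_simps)
  then show ?thesis by (simp only: sin_add sin_diff) simp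
qed

lemma cos_Suc_Suc: "cos ((real (Suc (Suc n)) + a) * \<theta>) =
    2 * cos \<theta> * cos ((real (Suc n) + a) * \<theta>) - cos ((real n + a) * \<theta>)"
proof -
  have "(real (Suc (Suc n)) + a) * \<theta> = (real (Suc n) + a) * \<theta> + \<theta>"
    "(real n + a) * \<theta> = (real (Suc n) + a) * \<theta> - \<theta>" by (simp_all add: algebra_simps)
  then show ?thesis by (simp only: cos_add cos_diff) simp
qed

text \<open>Chebyshev polynomials of the fourth kind, sin ((n + 1/2) \<theta>) / sin (\<theta>/2),
  scaled by 1 / sqrt pi.\<close>

lemma jacobi_F_half_minus_half:
  assumes "\<theta> \<in> {0..pi}"
  shows "jacobi_F n (1/2) (-1/2) (cos \<theta>) = sqrt (2/pi) * \<bar>sin ((real n + 1/2) * \<theta>)\<bar>"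
proof -
  define P where "P = chebyshev_rec [:1 / sqrt pi:] [:1 / sqrt pi, 2 / sqrt pi:]"
  define t where "t n \<theta> = sqrt (2/pi) * sin ((real n + 1/2) * \<theta>)" for n :: nat and \<theta> :: real
  have t_Suc: "t (Suc (Suc n)) \<theta> = 2 * cos \<theta> * t (Suc n) \<theta> - t n \<theta>" for n \<theta>
    unfolding t_def sin_Suc_Suc by (simp add: algebra_simps)
  have "jacobi_F n (1/2) (-1/2) (cos \<theta>) = \<bar>t n \<theta>\<bar>"
  proof (rule jacobi_F_trig[where P = P])
    show "degree (P n) = n" for n by (simp add: P_def degree_chebyshev_rec)
    show "rpow (1 - cos \<theta>) (1/2/2 + 1/4) * rpow (1 + cos \<theta>) (-1/2/2 + 1/4) * poly (P n) (cos \<theta>) = t n \<theta>"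
      if "\<theta> \<in> {0..pi}" for n \<theta>
    proof -
      have g: "rpow (1 - cos \<theta>) (1/2/2 + 1/4) * rpow (1 + cos \<theta>) (-1/2/2 + 1/4) = sqrt 2 * sin (\<theta>/2)"
        by (simp add: rpow_half sqrt_1_minus_cos[OF that])
      have "sqrt 2 * sin (\<theta>/2) * poly [:1 / sqrt pi:] (cos \<theta>) = t 0 \<theta>"
        by (simp add: t_def sqrt_2_div_pi)
      moreover have "sqrt 2 * sin (\<theta>/2) * poly [:1 / sqrt pi, 2 / sqrt pi:] (cos \<theta>) = t 1 \<theta>"
        proof -
        \<comment> \<open>The recurrence started at frequency -1/2: as sin is odd, its two initial
          terms are -sin (\<theta>/2) and sin (\<theta>/2).\<close>
        have "sin (\<theta>/2) * (1 + 2 * cos \<theta>) = sin ((real 1 + 1/2) * \<theta>)"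
          using sin_Suc_Suc[of 0 "-1/2" \<theta>] by (simp add: algebra_simps)
        moreover have "sqrt 2 * sin (\<theta>/2) * poly [:1 / sqrt pi, 2 / sqrt pi:] (cos \<theta>) =
            sqrt (2/pi) * (sin (\<theta>/2) * (1 + 2 * cos \<theta>))"
          by (simp add: real_sqrt_divide distrib_left mult_ac)
        ultimately show ?thesis by (simp only: t_def)
      qed
      ultimately show ?thesis unfolding g P_def by (rule poly_chebyshev_rec[where t = "\<lambda>n. t n \<theta>", OF _ _ t_Suc])
    qed
    show "((\<lambda>\<theta>. t m \<theta> * t n \<theta>) has_integral (if m = n then 1 else 0)) {0..pi}" for m n
      unfolding t_def sqrt_2_div_pi_sq
      by (rule has_integral_eq_rhs[OF has_integral_mult_right[OF has_integral_sin_sin]])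
        (auto simp: half_add_Ints)
  qed (use assms in auto)
  then show ?thesis by (simp add: t_def abs_mult)
qed

text \<open>Chebyshev polynomials of the third kind, cos ((n + 1/2) \<theta>) / cos (\<theta>/2).
  That cos is even accounts for the changed sign in degree 1.\<close>

lemma jacobi_F_minus_half_half:
  assumes "\<theta> \<in> {0..pi}"
  shows "jacobi_F n (-1/2) (1/2) (cos \<theta>) = sqrt (2/pi) * \<bar>cos ((real n + 1/2) * \<theta>)\<bar>"
proof -
  define P where "P = chebyshev_rec [:1 / sqrt pi:] [:- 1 / sqrt pi, 2 / sqrt pi:]"
  define t where "t n \<theta> = sqrt (2/pi) * cos ((real n + 1/2) * \<theta>)" for n :: nat and \<theta> :: real
  have t_Suc: "t (Suc (Suc n)) \<theta> = 2 * cos \<theta> * t (Suc n) \<theta> - t n \<theta>" for n \<theta>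
    unfolding t_def cos_Suc_Suc by (simp add: algebra_simps)
  have "jacobi_F n (-1/2) (1/2) (cos \<theta>) = \<bar>t n \<theta>\<bar>"
  proof (rule jacobi_F_trig[where P = P])
    show "degree (P n) = n" for n by (simp add: P_def degree_chebyshev_rec)
    show "rpow (1 - cos \<theta>) (-1/2/2 + 1/4) * rpow (1 + cos \<theta>) (1/2/2 + 1/4) * poly (P n) (cos \<theta>) = t n \<theta>"
      if "\<theta> \<in> {0..pi}" for n \<theta>
    proof -
      have g: "rpow (1 - cos \<theta>) (-1/2/2 + 1/4) * rpow (1 + cos \<theta>) (1/2/2 + 1/4) = sqrt 2 * cos (\<theta>/2)"
        by (simp add: rpow_half one_plus_cos_nonneg sqrt_1_plus_cos[OF that])
      have "sqrt 2 * cos (\<theta>/2) * poly [:1 / sqrt pi:] (cos \<theta>) = t 0 \<theta>"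
        by (simp add: t_def sqrt_2_div_pi)
      moreover have "sqrt 2 * cos (\<theta>/2) * poly [:- 1 / sqrt pi, 2 / sqrt pi:] (cos \<theta>) = t 1 \<theta>"
        proof -
        have "cos (\<theta>/2) * (- 1 + 2 * cos \<theta>) = cos ((real 1 + 1/2) * \<theta>)"
          using cos_Suc_Suc[of 0 "-1/2" \<theta>] by (simp add: algebra_simps)
        moreover have "sqrt 2 * cos (\<theta>/2) * poly [:- 1 / sqrt pi, 2 / sqrt pi:] (cos \<theta>) =
            sqrt (2/pi) * (cos (\<theta>/2) * (- 1 + 2 * cos \<theta>))"
          by (simp add: real_sqrt_divide right_diff_distrib mult_ac)
        ultimately show ?thesis by (simp only: t_def)
      qed
      ultimately show ?thesis unfolding g P_def by (rule poly_chebyshev_rec[where t = "\<lambda>n. t n \<theta>", OF _ _ t_Suc])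
    qed
    show "((\<lambda>\<theta>. t m \<theta> * t n \<theta>) has_integral (if m = n then 1 else 0)) {0..pi}" for m n
      unfolding t_def sqrt_2_div_pi_sq
      by (rule has_integral_eq_rhs[OF has_integral_mult_right[OF has_integral_cos_cos]])
        (auto simp: half_add_Ints)
  qed (use assms in auto)
  then show ?thesis by (simp add: t_def abs_mult)
qed

text \<open>Chebyshev polynomials of the second kind: the two half-angle factors multiply to sin
  \<theta>.\<close>

lemma jacobi_F_half_half:
  assumes "\<theta> \<in> {0..pi}"
  shows "jacobi_F n (1/2) (1/2) (cos \<theta>) = sqrt (2/pi) * \<bar>sin ((real n + 1) * \<theta>)\<bar>"
proof -
  define P where "P = chebyshev_rec [:sqrt (2/pi):] [:0, 2 * sqrt (2/pi):]"
  define t where "t n \<theta> = sqrt (2/pi) * sin ((real n + 1) * \<theta>)" for n :: nat and \<theta> :: real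
  have t_Suc: "t (Suc (Suc n)) \<theta> = 2 * cos \<theta> * t (Suc n) \<theta> - t n \<theta>" for n \<theta>
    unfolding t_def sin_Suc_Suc by (simp add: algebra_simps)
  have "jacobi_F n (1/2) (1/2) (cos \<theta>) = \<bar>t n \<theta>\<bar>"
  proof (rule jacobi_F_trig[where P = P])
    show "degree (P n) = n" for n by (simp add: P_def degree_chebyshev_rec)
    show "rpow (1 - cos \<theta>) (1/2/2 + 1/4) * rpow (1 + cos \<theta>) (1/2/2 + 1/4) * poly (P n) (cos \<theta>) = t n \<theta>"
      if "\<theta> \<in> {0..pi}" for n \<theta>
    proof -
      have g: "rpow (1 - cos \<theta>) (1/2/2 + 1/4) * rpow (1 + cos \<theta>) (1/2/2 + 1/4) = sin \<theta>"
        using sin_double[of "\<theta>/2"]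
        by (simp add: rpow_half one_plus_cos_nonneg sqrt_1_minus_cos[OF that] sqrt_1_plus_cos[OF that])
      have "sin \<theta> * poly [:sqrt (2/pi):] (cos \<theta>) = t 0 \<theta>"
        by (simp add: t_def sqrt_2_div_pi)
      moreover have "sin \<theta> * poly [:0, 2 * sqrt (2/pi):] (cos \<theta>) = t 1 \<theta>"
        using sin_Suc_Suc[of 0 0 \<theta>] by (simp add: t_def)
      ultimately show ?thesis unfolding g P_def by (rule poly_chebyshev_rec[where t = "\<lambda>n. t n \<theta>", OF _ _ t_Suc])
    qed
    show "((\<lambda>\<theta>. t m \<theta> * t n \<theta>) has_integral (if m = n then 1 else 0)) {0..pi}" for m n
      unfolding t_def sqrt_2_div_pi_sq
      by (rule has_integral_eq_rhs[OF has_integral_mult_right[OF has_integral_sin_sin]])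
        (auto simp: Ints_diff Ints_add)
  qed (use assms in auto)
  then show ?thesis by (simp add: t_def abs_mult)
qed

text \<open>Chebyshev polynomials of the first kind. The constant 1 has squared norm pi where the
  others have pi/2, so degree 0 is scaled separately; the recurrence runs on the uniformly scaled
  family \<open>u\<close>.\<close>

lemma jacobi_F_minus_half_minus_half:
  assumes "\<theta> \<in> {0..pi}"
  shows "jacobi_F n (-1/2) (-1/2) (cos \<theta>) =
    (if n = 0 then 1 / sqrt pi else sqrt (2/pi) * \<bar>cos (real n * \<theta>)\<bar>)"
proof -
  define P where "P n = (if n = 0 then [:1 / sqrt pi:] else
    chebyshev_rec [:sqrt (2/pi):] [:0, sqrt (2/pi):] n)" for n
  define t where "t n \<theta> = (if n = 0 then 1 / sqrt pi else sqrt (2/pi) * cos (real n * \<theta>))"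
    for n :: nat and \<theta> :: real
  have "jacobi_F n (-1/2) (-1/2) (cos \<theta>) = \<bar>t n \<theta>\<bar>"
  proof (rule jacobi_F_trig[where P = P])
    show "degree (P n) = n" for n by (simp add: P_def degree_chebyshev_rec)
    show "rpow (1 - cos \<theta>) (-1/2/2 + 1/4) * rpow (1 + cos \<theta>) (-1/2/2 + 1/4) * poly (P n) (cos \<theta>) = t n \<theta>"
      if "\<theta> \<in> {0..pi}" for n \<theta>
    proof -
      define u where "u k = sqrt (2/pi) * cos ((real k + 0) * \<theta>)" for k :: nat
      have u_Suc: "u (Suc (Suc k)) = 2 * cos \<theta> * u (Suc k) - u k" for k
        unfolding u_def cos_Suc_Suc by (simp add: algebra_simps)
      have "1 * poly (chebyshev_rec [:sqrt (2/pi):] [:0, sqrt (2/pi):] n) (cos \<theta>) = u n"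
        by (rule poly_chebyshev_rec[where t = u, OF _ _ u_Suc]) (simp_all add: u_def)
      then show ?thesis by (simp add: P_def t_def u_def)
    qed
    show "((\<lambda>\<theta>. t m \<theta> * t n \<theta>) has_integral (if m = n then 1 else 0)) {0..pi}" for m n
    proof -
      define c where "c k = (if k = 0 then 1 / sqrt pi else sqrt (2/pi))" for k :: nat
      have t: "t k \<theta> = c k * cos (real k * \<theta>)" for k \<theta> by (simp add: t_def c_def)
      have tt: "t m \<theta> * t n \<theta> = c m * c n * (cos (real m * \<theta>) * cos (real n * \<theta>))" for \<theta>
        by (simp add: t)
      have I: "((\<lambda>\<theta>. t m \<theta> * t n \<theta>) has_integral c m * c n *
          ((if real m = real n then pi/2 else 0) + (if real m + real n = 0 then pi/2 else 0))) {0..pi}"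
        unfolding tt by (intro has_integral_mult_right has_integral_cos_cos) auto
      have "c m * c n * ((if real m = real n then pi/2 else 0) +
          (if real m + real n = 0 then pi/2 else 0)) = (if m = n then 1 else 0)"
        by (cases "m = n"; cases "m = 0") (simp_all add: c_def real_sqrt_divide)
      then show ?thesis using I by (simp only:)
    qed
  qed (use assms in auto)
  then show ?thesis by (simp add: t_def abs_mult)
qed

section \<open>Values at the left endpoint\<close>

lemma jacobi_F_hyp:
  assumes "\<alpha> \<ge> -1/2" "\<beta> \<ge> -1/2" "x \<in> {-1..1}"
  shows "jacobi_F n \<alpha> \<beta> x = rpow (1 - x) (\<alpha>/2 + 1/4) * rpow (1 + x) (\<beta>/2 + 1/4) *
    \<bar>poly (jacobi_hyp n \<alpha> \<beta>) x\<bar> / sqrt (jacobi_norm_sq n \<alpha> \<beta>)"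
proof -
  have ab: "\<alpha> > -1" "\<beta> > -1" using assms by auto
  have "sqrt (jacobi_norm_sq n \<alpha> \<beta>) > 0" using jacobi_norm_sq_pos[OF ab] by simp
  then show ?thesis using jacobi_F_eq[OF assms(1,2) orthonormal_jacobi_hyp[OF ab] assms(3), of n]
    by (simp add: abs_mult)
qed

lemma rpow_sq: "t > 0 \<Longrightarrow> (rpow t a)\<^sup>2 = t powr (2 * a)"
  by (simp add: rpow_eq_powr power2_eq_square powr_add[symmetric])

text \<open>At -1 the polynomial and, because \<beta> = -1/2, also the power of 1 + x are 1. The
  square is therefore 2^(\<alpha> + 1/2) over the squared norm, and \<Gamma>(1/2)^2 supplies
  pi.\<close>

lemma jacobi_F_minus_1_sq:
  assumes "\<alpha> \<ge> -1/2"
  shows "(jacobi_F n \<alpha> (-1/2) (-1))\<^sup>2 = Gamma (real n + 1/2) *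
    (if n = 0 then Gamma (\<alpha> + 3/2) else (2 * real n + \<alpha> + 1/2) * Gamma (real n + \<alpha> + 1/2)) /
    (pi * fact n * Gamma (real n + \<alpha> + 1))"
proof -
  have h: "jacobi_norm_sq n \<alpha> (-1/2) > 0" using assms by (intro jacobi_norm_sq_pos) auto
  have "(jacobi_F n \<alpha> (-1/2) (-1))\<^sup>2 = 2 powr (\<alpha> + 1/2) / jacobi_norm_sq n \<alpha> (-1/2)"
    using assms h by (simp add: jacobi_F_hyp power_divide rpow_sq poly_jacobi_hyp_minus_1)
  also have "\<dots> = Gamma (real n + 1/2) *
    (if n = 0 then Gamma (\<alpha> + 3/2) else (2 * real n + \<alpha> + 1/2) * Gamma (real n + \<alpha> + 1/2)) /
    (pi * fact n * Gamma (real n + \<alpha> + 1))"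
    by (simp add: jacobi_norm_sq_def Gamma_one_half_real algebra_simps)
  finally show ?thesis .
qed

text \<open>The excluded pair is the only one where (\<alpha> + 1/2) \<Gamma>(\<alpha> + 1/2) cannot
  stand for \<Gamma>(\<alpha> + 3/2) in degree 0.\<close>

lemma jacobi_F_minus_1_sq_Gamma:
  assumes "\<alpha> \<ge> -1/2" "(n, \<alpha>) \<noteq> (0, -1/2)"
  shows "(jacobi_F n \<alpha> (-1/2) (-1))\<^sup>2 =
    (2 * real n + \<alpha> + 1/2) * Gamma (real n + 1/2) * Gamma (real n + \<alpha> + 1/2) /
      (pi * Gamma (real n + 1) * Gamma (real n + \<alpha> + 1))"
proof -
  have "(if n = 0 then Gamma (\<alpha> + 3/2) else (2 * real n + \<alpha> + 1/2) * Gamma (real n + \<alpha> + 1/2)) =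
      (2 * real n + \<alpha> + 1/2) * Gamma (real n + \<alpha> + 1/2)"
    using Gamma_plus1_real[of "\<alpha> + 1/2"] assms by (auto simp: add_ac)
  moreover have "fact n = Gamma (real n + 1)" by (simp add: Gamma_fact add_ac)
  ultimately show ?thesis using jacobi_F_minus_1_sq[OF assms(1), of n] by (simp only: mult_ac)
qed

section \<open>Gamma quotients at distance 1/2 and growth of the endpoint value\<close>

lemma Gamma_half_log_convex:
  assumes "x > (0::real)"
  shows "(Gamma (x + 1/2))\<^sup>2 \<le> x * (Gamma x)\<^sup>2"
proof -
  have pos: "Gamma x > 0" "Gamma (x + 1) > 0" "Gamma (x + 1/2) > 0" using assms by auto
  have "(ln \<circ> Gamma) ((1 - 1/2) *\<^sub>R x + (1/2) *\<^sub>R (x + 1)) \<le>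
      (1 - 1/2) * (ln \<circ> Gamma) x + (1/2) * (ln \<circ> Gamma) (x + 1)"
    using assms by (intro convex_onD[OF log_convex_Gamma_real]) auto
  also have "(1 - 1/2) *\<^sub>R x + (1/2) *\<^sub>R (x + 1) = x + 1/2" by (simp add: field_simps)
  finally have "ln ((Gamma (x + 1/2))\<^sup>2) \<le> ln (Gamma x * Gamma (x + 1))"
    using pos by (simp add: ln_mult ln_realpow)
  then have "(Gamma (x + 1/2))\<^sup>2 \<le> Gamma x * Gamma (x + 1)"
    using pos by (subst (asm) ln_le_cancel_iff) auto
  also have "\<dots> = x * (Gamma x)\<^sup>2"
    using assms by (simp add: Gamma_plus1_real power2_eq_square)
  finally show ?thesis .
qed

text \<open>Log-convexity at y gives the lower bound; at y - 1/2, together with the functional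
  equation for \<Gamma>(y + 1/2), it gives the upper one.\<close>

lemma Gamma_half_ratio_tendsto:
  "((\<lambda>y::real. Gamma y / Gamma (y + 1/2) * sqrt y) \<longlongrightarrow> 1) at_top"
proof (rule tendsto_sandwich[of "\<lambda>_. 1" _ _ "\<lambda>y. sqrt (y / (y - 1/2))"])
  show "\<forall>\<^sub>F y in at_top. 1 \<le> Gamma y / Gamma (y + 1/2) * sqrt y"
    using eventually_gt_at_top[of 0]
  proof eventually_elim
    case (elim y)
    then have pos: "Gamma y > 0" "Gamma (y + 1/2) > 0" by auto
    have "(Gamma (y + 1/2))\<^sup>2 \<le> y * (Gamma y)\<^sup>2" by (rule Gamma_half_log_convex[OF elim])
    also have "\<dots> = (Gamma y * sqrt y)\<^sup>2" using elim by (simp add: power_mult_distrib)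
    finally have "Gamma (y + 1/2) \<le> Gamma y * sqrt y"
      by (rule power2_le_imp_le) (use pos elim in simp)
    with pos show ?case by (simp only: times_divide_eq_left le_divide_eq_1_pos)
  qed
  show "\<forall>\<^sub>F y in at_top. Gamma y / Gamma (y + 1/2) * sqrt y \<le> sqrt (y / (y - 1/2))"
    using eventually_gt_at_top[of "1/2"]
  proof eventually_elim
    case (elim y)
    define a b where "a = Gamma y" and "b = Gamma (y - 1/2)"
    have pos: "a > 0" "b > 0" "y - 1/2 > 0" using elim by (auto simp: a_def b_def)
    have G: "Gamma (y + 1/2) = (y - 1/2) * b"
      using Gamma_plus1_real[of "y - 1/2"] elim by (simp add: b_def add.commute)
    have "a\<^sup>2 \<le> (y - 1/2) * b\<^sup>2"
      using Gamma_half_log_convex[of "y - 1/2"] elim by (simp add: a_def b_def)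
    also have "\<dots> = (sqrt (y - 1/2) * b)\<^sup>2" using pos by (simp add: power_mult_distrib)
    finally have "a \<le> sqrt (y - 1/2) * b" using pos by (auto intro: power2_le_imp_le)
    then have "a / ((y - 1/2) * b) * sqrt y \<le> sqrt (y - 1/2) * b / ((y - 1/2) * b) * sqrt y"
      using pos by (intro mult_right_mono divide_right_mono) auto
    also have "\<dots> = sqrt (y - 1/2) / (y - 1/2) * sqrt y" using pos by simp
    also have "sqrt (y - 1/2) / (y - 1/2) = 1 / sqrt (y - 1/2)"
      using real_div_sqrt[of "y - 1/2"] pos by (metis inverse_divide inverse_eq_divide less_imp_le)
    also have "1 / sqrt (y - 1/2) * sqrt y = sqrt (y / (y - 1/2))" by (simp add: real_sqrt_divide)
    finally show ?case by (simp only: G a_def)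
  qed
  show "((\<lambda>y::real. sqrt (y / (y - 1/2))) \<longlongrightarrow> 1) at_top" by real_asymp
qed simp

lemma jacobi_F_nonneg:
  assumes "\<alpha> \<ge> -1/2" "\<beta> \<ge> -1/2" "x \<in> {-1..1}"
  shows "jacobi_F n \<alpha> \<beta> x \<ge> 0"
  using jacobi_norm_sq_pos[of \<alpha> \<beta> n] assms by (subst jacobi_F_hyp) auto

text \<open>With y = n + \<alpha> + 1/2 the square is K (2 n + \<alpha> + 1/2) \<Gamma>(y) /
  \<Gamma>(y + 1/2). The Gamma quotient behaves like y^(-1/2), so the square grows like K sqrt
  \<alpha>.\<close>

lemma jacobi_F_minus_1_asymp_ratio:
  "((\<lambda>\<alpha>. jacobi_F n \<alpha> (-1/2) (-1) /
     ((Gamma (real n + 1/2) / (pi * Gamma (real n + 1))) powr (1/2) * \<alpha> powr (1/4))) \<longlongrightarrow> 1) at_top"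
proof -
  define K where "K = Gamma (real n + 1/2) / (pi * Gamma (real n + 1))"
  have K: "K > 0" unfolding K_def by (intro divide_pos_pos mult_pos_pos Gamma_real_pos) auto
  have "filterlim (\<lambda>\<alpha>. real n + \<alpha> + 1/2) at_top at_top" by real_asymp
  from filterlim_compose[OF Gamma_half_ratio_tendsto this]
  have "((\<lambda>\<alpha>. Gamma (real n + \<alpha> + 1/2) / Gamma (real n + \<alpha> + 1/2 + 1/2) * sqrt (real n + \<alpha> + 1/2)) \<longlongrightarrow> 1) at_top" .
  moreover have "((\<lambda>\<alpha>. (2 * real n + \<alpha> + 1/2) / (sqrt (real n + \<alpha> + 1/2) * sqrt \<alpha>)) \<longlongrightarrow> 1) at_top"
    by real_asymp
  ultimately have "((\<lambda>\<alpha>. sqrt ((Gamma (real n + \<alpha> + 1/2) / Gamma (real n + \<alpha> + 1/2 + 1/2) *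
      sqrt (real n + \<alpha> + 1/2)) * ((2 * real n + \<alpha> + 1/2) / (sqrt (real n + \<alpha> + 1/2) * sqrt \<alpha>)))) \<longlongrightarrow>
      sqrt (1 * 1)) at_top"
    by (intro tendsto_intros)
  then have "((\<lambda>\<alpha>. sqrt ((Gamma (real n + \<alpha> + 1/2) / Gamma (real n + \<alpha> + 1/2 + 1/2) *
      sqrt (real n + \<alpha> + 1/2)) * ((2 * real n + \<alpha> + 1/2) / (sqrt (real n + \<alpha> + 1/2) * sqrt \<alpha>)))) \<longlongrightarrow>
      1) at_top" by simp
  moreover have "\<forall>\<^sub>F \<alpha> in at_top. sqrt ((Gamma (real n + \<alpha> + 1/2) / Gamma (real n + \<alpha> + 1/2 + 1/2) *
      sqrt (real n + \<alpha> + 1/2)) * ((2 * real n + \<alpha> + 1/2) / (sqrt (real n + \<alpha> + 1/2) * sqrt \<alpha>))) =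
      jacobi_F n \<alpha> (-1/2) (-1) / (K powr (1/2) * \<alpha> powr (1/4))"
    using eventually_gt_at_top[of 0]
  proof eventually_elim
    case (elim \<alpha>)
    define y where "y = real n + \<alpha> + 1/2"
    have y: "y > 0" using elim by (simp add: y_def)
    have sq: "(jacobi_F n \<alpha> (-1/2) (-1))\<^sup>2 =
        K * ((2 * real n + \<alpha> + 1/2) * (Gamma y / Gamma (y + 1/2)))"
      using elim by (subst jacobi_F_minus_1_sq_Gamma) (auto simp: K_def y_def mult_ac add_ac)
    have "K powr (1/2) * \<alpha> powr (1/4) = sqrt (K * sqrt \<alpha>)"
      using elim K by (simp add: powr_half_sqrt[symmetric] powr_mult powr_powr)
    moreover have "jacobi_F n \<alpha> (-1/2) (-1) = sqrt ((jacobi_F n \<alpha> (-1/2) (-1))\<^sup>2)"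
      using elim by (simp add: jacobi_F_nonneg)
    ultimately have "jacobi_F n \<alpha> (-1/2) (-1) / (K powr (1/2) * \<alpha> powr (1/4)) =
        sqrt (K * ((2 * real n + \<alpha> + 1/2) * (Gamma y / Gamma (y + 1/2))) / (K * sqrt \<alpha>))"
      by (simp only: real_sqrt_divide sq)
    also have "K * ((2 * real n + \<alpha> + 1/2) * (Gamma y / Gamma (y + 1/2))) / (K * sqrt \<alpha>) =
        Gamma y / Gamma (y + 1/2) * sqrt y * ((2 * real n + \<alpha> + 1/2) / (sqrt y * sqrt \<alpha>))"
      using K y elim by simp
    finally show ?case by (simp add: y_def)
  qed
  ultimately show ?thesis unfolding K_def by (rule Lim_transform_eventually)
qed

lemma jacobi_F_no_smaller_exponent:
  assumes "\<gamma> < 1/4"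
  shows "\<not> (\<exists>C::real. \<forall>\<alpha>\<ge>-1/2. \<forall>\<beta>\<ge>-1/2. \<forall>x\<in>{-1..1}.
              jacobi_F n \<alpha> \<beta> x \<le> C * max 1 ((\<alpha> + \<beta> + 1) powr \<gamma>))"
proof
  define K where "K = (Gamma (real n + 1/2) / (pi * Gamma (real n + 1))) powr (1/2)"
  have K: "K > 0" unfolding K_def
    by (subst powr_gt_zero, intro less_imp_neq[THEN not_sym] divide_pos_pos mult_pos_pos Gamma_real_pos) auto
  \<comment> \<open>With the positive part of \<gamma> as exponent, a single power of \<alpha> + 1/2
    dominates both entries of the maximum.\<close>
  define g where "g = max 0 \<gamma>"
  have g: "g \<ge> 0" "g < 1/4" "\<gamma> \<le> g" using assms by (auto simp: g_def)
  assume "\<exists>C::real. \<forall>\<alpha>\<ge>-1/2. \<forall>\<beta>\<ge>-1/2. \<forall>x\<in>{-1..1}.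
              jacobi_F n \<alpha> \<beta> x \<le> C * max 1 ((\<alpha> + \<beta> + 1) powr \<gamma>)"
  then obtain C where C: "\<And>\<alpha>. \<alpha> \<ge> -1/2 \<Longrightarrow>
      jacobi_F n \<alpha> (-1/2) (-1) \<le> C * max 1 ((\<alpha> + -1/2 + 1) powr \<gamma>)" by force
  have le: "\<forall>\<^sub>F \<alpha> in at_top. jacobi_F n \<alpha> (-1/2) (-1) / (K * \<alpha> powr (1/4)) \<le>
      \<bar>C\<bar> / K * ((\<alpha> + 1/2) powr g / \<alpha> powr (1/4))"
    using eventually_gt_at_top[of 1]
  proof eventually_elim
    case (elim \<alpha>)
    have "max 1 ((\<alpha> + 1/2) powr \<gamma>) \<le> (\<alpha> + 1/2) powr g"
      using elim g by (auto intro!: powr_mono ge_one_powr_ge_zero)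
    then have "C * max 1 ((\<alpha> + 1/2) powr \<gamma>) \<le> \<bar>C\<bar> * (\<alpha> + 1/2) powr g"
      by (intro mult_mono) auto
    with C[of \<alpha>] elim have "jacobi_F n \<alpha> (-1/2) (-1) \<le> \<bar>C\<bar> * (\<alpha> + 1/2) powr g"
      by (simp add: add.commute)
    then show ?case using K elim by (simp add: divide_simps)
  qed
  have "((\<lambda>\<alpha>::real. (\<alpha> + 1/2) powr g / \<alpha> powr (1/4)) \<longlongrightarrow> 0) at_top"
    using g by real_asymp
  then have "((\<lambda>\<alpha>::real. \<bar>C\<bar> / K * ((\<alpha> + 1/2) powr g / \<alpha> powr (1/4))) \<longlongrightarrow> \<bar>C\<bar> / K * 0) at_top"
    by (intro tendsto_intros)
  from tendsto_le[OF _ this jacobi_F_minus_1_asymp_ratio[of n, folded K_def] le]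
  show False by simp
qed

lemma pos_notin_nonpos_Ints: "x > 0 \<Longrightarrow> (x::real) \<notin> \<int>\<^sub>\<le>\<^sub>0"
  by (auto elim!: nonpos_Ints_cases)

text \<open>Absorbing the vanishing factor, (\<alpha> + 1/2) \<Gamma>(\<alpha> + 1/2) =
  \<Gamma>(\<alpha> + 3/2), turns an expression of type zero times infinity into a continuous
  one.\<close>

lemma jacobi_F_0_minus_1_limit:
  "((\<lambda>\<alpha>::real. (2 * real 0 + \<alpha> + 1/2) * Gamma (real 0 + 1/2) * Gamma (real 0 + \<alpha> + 1/2)
            / (pi * Gamma (real 0 + 1) * Gamma (real 0 + \<alpha> + 1))) \<longlongrightarrow> 1/pi) (at_right (-1/2))"
proof -
  have "((\<lambda>\<alpha>::real. Gamma (1/2) * Gamma (\<alpha> + 3/2) / (pi * Gamma (\<alpha> + 1))) \<longlongrightarrow>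
      Gamma (1/2) * Gamma (-1/2 + 3/2) / (pi * Gamma (-1/2 + 1))) (at_right (-1/2))"
    using Gamma_real_pos[of "1/2"] pos_notin_nonpos_Ints[of 1] pos_notin_nonpos_Ints[of "1/2"]
    by (intro tendsto_intros) (simp_all del: Gamma_real_pos)
  then have "((\<lambda>\<alpha>::real. Gamma (1/2) * Gamma (\<alpha> + 3/2) / (pi * Gamma (\<alpha> + 1))) \<longlongrightarrow> 1 / pi)
      (at_right (-1/2))"
    by (simp add: Gamma_one_half_real)
  moreover have "\<forall>\<^sub>F \<alpha> in at_right (-1/2). Gamma (1/2) * Gamma (\<alpha> + 3/2) / (pi * Gamma (\<alpha> + 1)) =
      (2 * real 0 + \<alpha> + 1/2) * Gamma (real 0 + 1/2) * Gamma (real 0 + \<alpha> + 1/2)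
            / (pi * Gamma (real 0 + 1) * Gamma (real 0 + \<alpha> + 1))"
    using eventually_at_right_less[of "-1/2::real"]
  proof eventually_elim
    case (elim \<alpha>)
    then show ?case using Gamma_plus1_real[of "\<alpha> + 1/2"] by (simp add: add_ac)
  qed
  ultimately show ?thesis by (rule Lim_transform_eventually)
qed

section \<open>Maxima for the Chebyshev parameters\<close>

lemma cos_arccos_range: "x \<in> {-1..1} \<Longrightarrow> \<exists>\<theta>\<in>{0..pi}. x = cos \<theta>"
  by (rule bexI[of _ "arccos x"]) (auto simp: arccos_lbound arccos_ubound)

lemma jacobi_F_half_max:
  assumes "\<alpha> \<in> {-1/2, 1/2}" "\<beta> \<in> {-1/2, 1/2}" "(n, \<alpha>, \<beta>) \<noteq> (0, -1/2, -1/2)"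
  shows "(\<exists>x\<in>{-1..1}. jacobi_F n \<alpha> \<beta> x = sqrt (2/pi)) \<and>
         (\<forall>x\<in>{-1..1}. jacobi_F n \<alpha> \<beta> x \<le> sqrt (2/pi))"
proof -
  have le: "sqrt (2/pi) * \<bar>u\<bar> \<le> sqrt (2/pi)" if "\<bar>u\<bar> \<le> 1" for u
    using that by (intro mult_left_le) auto
  \<comment> \<open>Shared by the four families: the trigonometric factor reaches 1 at \<theta>', a
    quarter period for the sines and 0 for the cosines.\<close>
  have *: ?thesis if "\<And>\<theta>. \<theta> \<in> {0..pi} \<Longrightarrow> jacobi_F n \<alpha> \<beta> (cos \<theta>) = sqrt (2/pi) * \<bar>f \<theta>\<bar>"
    "\<And>\<theta>. \<bar>f \<theta>\<bar> \<le> 1" "\<theta>' \<in> {0..pi}" "f \<theta>' = 1" for f \<theta>'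
  proof
    show "\<exists>x\<in>{-1..1}. jacobi_F n \<alpha> \<beta> x = sqrt (2/pi)"
      using that(1)[OF that(3)] that(4) by (intro bexI[of _ "cos \<theta>'"]) auto
    show "\<forall>x\<in>{-1..1}. jacobi_F n \<alpha> \<beta> x \<le> sqrt (2/pi)"
      using that(1,2) le cos_arccos_range by metis
  qed
  consider "\<alpha> = 1/2" "\<beta> = -1/2" | "\<alpha> = -1/2" "\<beta> = 1/2" | "\<alpha> = 1/2" "\<beta> = 1/2" |
    "\<alpha> = -1/2" "\<beta> = -1/2" "n \<noteq> 0"
    using assms by auto
  then show ?thesis
  proof cases
    case 1
    show ?thesis
    proof (rule *[of "\<lambda>\<theta>. sin ((real n + 1/2) * \<theta>)" "pi / (2 * real n + 1)"])
      show "jacobi_F n \<alpha> \<beta> (cos \<theta>) = sqrt (2/pi) * \<bar>sin ((real n + 1/2) * \<theta>)\<bar>" if "\<theta> \<in> {0..pi}" for \<theta>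
        unfolding 1 by (rule jacobi_F_half_minus_half[OF that])
      have "(real n + 1/2) * (pi / (2 * real n + 1)) = pi / 2" by (simp add: field_simps)
      then show "sin ((real n + 1/2) * (pi / (2 * real n + 1))) = 1" by (simp only: sin_pi_half)
    qed (auto simp: field_simps)
  next
    case 2
    show ?thesis
    proof (rule *[of "\<lambda>\<theta>. cos ((real n + 1/2) * \<theta>)" "0"])
      show "jacobi_F n \<alpha> \<beta> (cos \<theta>) = sqrt (2/pi) * \<bar>cos ((real n + 1/2) * \<theta>)\<bar>" if "\<theta> \<in> {0..pi}" for \<theta>
        unfolding 2 by (rule jacobi_F_minus_half_half[OF that])
    qed (auto simp: field_simps)
  next
    case 3
    show ?thesis
    proof (rule *[of "\<lambda>\<theta>. sin ((real n + 1) * \<theta>)" "pi / (2 * (real n + 1))"])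
      show "jacobi_F n \<alpha> \<beta> (cos \<theta>) = sqrt (2/pi) * \<bar>sin ((real n + 1) * \<theta>)\<bar>" if "\<theta> \<in> {0..pi}" for \<theta>
        unfolding 3 by (rule jacobi_F_half_half[OF that])
      have "(real n + 1) * (pi / (2 * (real n + 1))) = pi / 2" by (simp add: field_simps)
      then show "sin ((real n + 1) * (pi / (2 * (real n + 1)))) = 1" by (simp only: sin_pi_half)
    qed (auto simp: field_simps)
  next
    case 4
    show ?thesis
    proof (rule *[of "\<lambda>\<theta>. cos (real n * \<theta>)" "0"])
      show "jacobi_F n \<alpha> \<beta> (cos \<theta>) = sqrt (2/pi) * \<bar>cos (real n * \<theta>)\<bar>" if "\<theta> \<in> {0..pi}" for \<theta>
        unfolding 4 using jacobi_F_minus_half_minus_half[OF that] 4(3) by simp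
    qed (auto simp: field_simps)
  qed
qed

text \<open>For both parameters -1/2 one has S = 0, so either hypothesis reads F \<le> C, and in
  degree 1 the value at x = 1 is sqrt (2/pi). Degree 0 would give only 1 / sqrt pi.\<close>

lemma jacobi_F_constant_lower_bound:
  assumes "(\<forall>n::nat. \<forall>\<alpha>\<ge>-1/2. \<forall>\<beta>\<ge>-1/2. \<forall>x\<in>{-1..1}.
           jacobi_F n \<alpha> \<beta> x \<le> C * E_bound n (\<alpha> + \<beta> + 1)) \<or>
        (\<forall>n::nat. \<forall>\<alpha>\<ge>-1/2. \<forall>\<beta>\<ge>-1/2. \<forall>x\<in>{-1..1}.
           jacobi_F n \<alpha> \<beta> x \<le> C * max 1 ((\<alpha> + \<beta> + 1) powr (1/4)))"
  shows "C \<ge> sqrt (2/pi)"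
proof -
  have F: "jacobi_F 1 (-1/2) (-1/2) (cos 0) = sqrt (2/pi)"
    by (subst jacobi_F_minus_half_minus_half) auto
  have E: "E_bound 1 (-1/2 + -1/2 + 1) = 1" by (simp add: E_bound_def Phi_bound_def)
  have M: "max 1 ((-1/2 + -1/2 + 1) powr (1/4)) = (1::real)" by simp
  have "jacobi_F 1 (-1/2) (-1/2) (cos 0) \<le> C * E_bound 1 (-1/2 + -1/2 + 1) \<or>
      jacobi_F 1 (-1/2) (-1/2) (cos 0) \<le> C * max 1 ((-1/2 + -1/2 + 1) powr (1/4))"
    using assms
  proof
    assume *: "\<forall>n::nat. \<forall>\<alpha>\<ge>-1/2. \<forall>\<beta>\<ge>-1/2. \<forall>x\<in>{-1..1}.
      jacobi_F n \<alpha> \<beta> x \<le> C * E_bound n (\<alpha> + \<beta> + 1)"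
    show ?thesis by (intro disjI1 *[rule_format]) auto
  next
    assume *: "\<forall>n::nat. \<forall>\<alpha>\<ge>-1/2. \<forall>\<beta>\<ge>-1/2. \<forall>x\<in>{-1..1}.
           jacobi_F n \<alpha> \<beta> x \<le> C * max 1 ((\<alpha> + \<beta> + 1) powr (1/4))"
    show ?thesis by (intro disjI2 *[rule_format]) auto
  qed
  then show ?thesis unfolding F E M by simp
qed

section \<open>Mehler--Heine asymptotics\<close>

text \<open>The points cos (z/n) tend to 1 whereas \<open>jacobi_hyp\<close> is expanded at -1; for
  equal parameters this moves the argument to -cos (z/n) at no cost.\<close>

lemma jacobi_F_reflect:
  assumes "\<alpha> \<ge> -1/2" "\<beta> \<ge> -1/2" "x \<in> {-1..1}"
  shows "jacobi_F n \<alpha> \<beta> x = jacobi_F n \<beta> \<alpha> (-x)"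
proof -
  have ab: "\<alpha> > -1" "\<beta> > -1" using assms by auto
  note P = orthonormal_jacobi_hyp[OF ab]
  have "-x \<in> {-1..1}" using assms(3) by auto
  from jacobi_F_eq[OF assms(2,1) orthonormal_jacobi_system_reflect[OF P] this, of n]
    jacobi_F_eq[OF assms(1,2) P assms(3), of n]
  show ?thesis by (simp add: poly_pcompose mult_ac)
qed

text \<open>Coefficients of w^k in the hypergeometric function 0F1 with parameter A + 1 at -w. With
  w = z^2/4 this is the Bessel series without its prefactor (z/2)^A / \<Gamma>(A + 1).\<close>

definition bessel_coeff :: "real \<Rightarrow> nat \<Rightarrow> real" where
  "bessel_coeff A k = (-1) ^ k / (fact k * pochhammer (A + 1) k)"

lemma pochhammer_ge_half_power:
  fixes A :: real
  assumes "A \<ge> -1/2"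
  shows "pochhammer (A + 1) k \<ge> (1/2) ^ k"
proof -
  have "(\<Prod>i=0..<k. (1/2)::real) \<le> (\<Prod>i=0..<k. A + 1 + real i)"
    using assms by (intro prod_mono) auto
  then show ?thesis by (simp add: pochhammer_prod)
qed

lemma bessel_coeff_bound:
  assumes "A \<ge> -1/2"
  shows "\<bar>bessel_coeff A k\<bar> \<le> 2 ^ k / fact k"
proof -
  have "\<bar>bessel_coeff A k\<bar> = 1 / (fact k * pochhammer (A + 1) k)"
    using pochhammer_pos[of "A + 1" k] assms by (simp add: bessel_coeff_def abs_mult power_abs)
  also have "\<dots> \<le> 1 / (fact k * (1/2) ^ k)"
    using pochhammer_ge_half_power[OF assms, of k] by (intro frac_le mult_left_mono) simp_all
  also have "\<dots> = 2 ^ k / fact k" by (simp add: power_divide)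
  finally show ?thesis .
qed

lemma summable_bessel_coeff:
  assumes "A \<ge> -1/2"
  shows "summable (\<lambda>k. bessel_coeff A k * w ^ k)"
proof (rule summable_comparison_test)
  show "\<exists>N. \<forall>k\<ge>N. norm (bessel_coeff A k * w ^ k) \<le> inverse (fact k) * (2 * \<bar>w\<bar>) ^ k"
    using bessel_coeff_bound[OF assms] mult_right_mono[of "\<bar>bessel_coeff A _\<bar>" "2 ^ _ / fact _" "\<bar>w\<bar> ^ _"]
    by (auto simp: abs_mult power_abs power_mult_distrib divide_inverse mult_ac)
  show "summable (\<lambda>k. inverse (fact k) * (2 * \<bar>w\<bar>) ^ k)" by (rule summable_exp)
qed

lemma bessel_J_eq:
  assumes "A \<ge> -1/2" "z > 0"
  shows "bessel_J A z = (z/2) powr A / Gamma (A + 1) * (\<Sum>k. bessel_coeff A k * (z\<^sup>2 / 4) ^ k)"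
proof -
  have "(-1) ^ k / fact k * rGamma (real k + A + 1) * (z / 2) powr (2 * real k + A) =
      (z/2) powr A / Gamma (A + 1) * (bessel_coeff A k * (z\<^sup>2 / 4) ^ k)" for k
  proof -
    have G: "Gamma (A + 1) > 0" using assms by simp
    have "pochhammer (A + 1) k = Gamma (real k + A + 1) / Gamma (A + 1)"
      using assms by (simp add: pochhammer_Gamma_real add_ac)
    then have "rGamma (real k + A + 1) = 1 / (Gamma (A + 1) * pochhammer (A + 1) k)"
      using G by (simp add: rGamma_inverse_Gamma divide_inverse)
    moreover have "(z / 2) powr (2 * real k + A) = (z / 2) powr A * (z\<^sup>2 / 4) ^ k"
    proof -
      have "(z / 2) powr (2 * real k) = (z / 2) ^ (2 * k)"
        using assms powr_realpow[of "z/2" "2 * k"] by simp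
      then show ?thesis by (simp add: powr_add power_mult power_divide)
    qed
    ultimately show ?thesis by (simp add: bessel_coeff_def mult_ac)
  qed
  then show ?thesis unfolding bessel_J_def
    by (simp only:) (rule suminf_mult, rule summable_bessel_coeff[OF assms(1)])
qed

text \<open>The k-th term of the hypergeometric sum at -cos (z/n), with the i-th factors of the
  binomial, the Pochhammer symbol and the sine power collected together; each such product tends to
  z^2/4. The factor for i = n is 0, so the terms with k > n vanish and the finite sum may be treated
  as a series.\<close>

definition mehler_term :: "real \<Rightarrow> real \<Rightarrow> nat \<Rightarrow> nat \<Rightarrow> real" where
  "mehler_term A z k n = bessel_coeff A k *
     (\<Prod>i=0..<k. (real n - real i) * (real n + 2 * A + 1 + real i) * (sin (z / (2 * real n)))\<^sup>2)"

lemma poly_jacobi_hyp_mehler: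
  "poly (jacobi_hyp n A A) (- cos (z / real n)) = (\<Sum>k. mehler_term A z k n)"
proof -
  have half: "(1 + - cos (z / real n)) / 2 = (sin (z / (2 * real n)))\<^sup>2"
    using cos_double_sin[of "z / (2 * real n)"] by simp
  have tm: "jacobi_coeff n A A k * ((1 + - cos (z / real n)) / 2) ^ k = mehler_term A z k n" for k
  proof -
    have "real (n choose k) = (\<Prod>i=0..<k. real n - real i) / fact k"
      unfolding binomial_gbinomial by (simp add: gbinomial_prod_rev)
    moreover have "pochhammer (real n + A + A + 1) k = (\<Prod>i=0..<k. real n + 2 * A + 1 + real i)"
      by (simp add: pochhammer_prod algebra_simps)
    ultimately show ?thesis unfolding half
      by (simp add: jacobi_coeff_def mehler_term_def bessel_coeff_def prod.distrib)
  qed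
  have "(\<Sum>k. mehler_term A z k n) = (\<Sum>k\<le>n. mehler_term A z k n)"
    unfolding mehler_term_def by (rule suminf_finite) (auto intro!: bexI[of _ n])
  then show ?thesis unfolding poly_jacobi_hyp tm by simp
qed

text \<open>A majorant independent of n, as Tannery's theorem requires. If k \<le> n, every factor
  lies between 0 and (2 A + 3) z^2/4; if k > n, the product is 0.\<close>

lemma mehler_term_bound:
  assumes "A \<ge> -1/2" "n \<ge> 1"
  shows "\<bar>mehler_term A z k n\<bar> \<le> inverse (fact k) * (2 * ((2 * A + 3) * (z\<^sup>2 / 4))) ^ k"
proof -
  define q where "q = (2 * A + 3) * (z\<^sup>2 / 4)"
  define s where "s = sin (z / (2 * real n))"
  define g where "g i = (real n - real i) * (real n + 2 * A + 1 + real i) * s\<^sup>2" for i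
  have q: "q \<ge> 0" using assms by (simp add: q_def)
  have "\<bar>\<Prod>i=0..<k. g i\<bar> \<le> q ^ k"
  proof (cases "k \<le> n")
    case True
    have sin: "s\<^sup>2 \<le> (z / (2 * real n))\<^sup>2"
      using abs_sin_x_le_abs_x[of "z / (2 * real n)"] unfolding s_def
      by (rule abs_le_square_iff[THEN iffD1])
    have "\<bar>g i\<bar> \<le> q" if "i < k" for i
    proof -
      have i: "real i \<le> real n" using that True by simp
      have "0 \<le> g i"
        unfolding g_def using i assms by (intro mult_nonneg_nonneg zero_le_power2) linarith+
      then have "\<bar>g i\<bar> = g i" by (rule abs_of_nonneg)
      also have "\<dots> \<le> real n * ((2 * A + 3) * real n) * (z / (2 * real n))\<^sup>2"
        unfolding g_def
      proof (intro mult_mono sin)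
        have "(2 * A + 1) * 1 \<le> (2 * A + 1) * real n" using assms by (intro mult_left_mono) auto
        then show "real n + 2 * A + 1 + real i \<le> (2 * A + 3) * real n"
          using i by (simp add: algebra_simps)
        show "0 \<le> real n + 2 * A + 1 + real i" using assms by simp
        show "0 \<le> real n * ((2 * A + 3) * real n)" using assms by simp
      qed simp_all
      also have "\<dots> = q" using assms by (simp add: power2_eq_square q_def)
      finally show ?thesis .
    qed
    then have "(\<Prod>i=0..<k. \<bar>g i\<bar>) \<le> (\<Prod>i=0..<k. q)" by (intro prod_mono) simp_all
    then show ?thesis by (simp add: abs_prod)
  next
    case False
    then have z: "(\<Prod>i=0..<k. g i) = 0" by (intro prod_zero) (auto simp: g_def intro!: bexI[of _ n])
    show ?thesis unfolding z using q by simp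
  qed
  then have "\<bar>bessel_coeff A k\<bar> * \<bar>\<Prod>i=0..<k. g i\<bar> \<le> 2 ^ k / fact k * q ^ k"
    by (intro mult_mono bessel_coeff_bound[OF assms(1)]) simp_all
  also have "2 ^ k / fact k * q ^ k = inverse (fact k) * (2 * q) ^ k"
    by (simp add: power_mult_distrib divide_inverse)
  finally show ?thesis unfolding q_def[symmetric]
    by (simp add: mehler_term_def g_def s_def abs_mult)
qed

lemma mehler_term_limit:
  assumes "z > 0"
  shows "mehler_term A z k \<longlonglongrightarrow> bessel_coeff A k * (z\<^sup>2 / 4) ^ k"
proof -
  have "(\<lambda>n. (real n - real i) * (real n + 2 * A + 1 + real i) * (sin (z / (2 * real n)))\<^sup>2)
      \<longlonglongrightarrow> z\<^sup>2 / 4" for i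
    using assms by (real_asymp simp: field_simps power2_eq_square)
  then have "(\<lambda>n. bessel_coeff A k * (\<Prod>i=0..<k. (real n - real i) * (real n + 2 * A + 1 + real i) *
      (sin (z / (2 * real n)))\<^sup>2)) \<longlonglongrightarrow> bessel_coeff A k * (\<Prod>i=0..<k. z\<^sup>2 / 4)"
    by (intro tendsto_intros)
  then show ?thesis by (simp add: mehler_term_def[abs_def])
qed

lemma poly_jacobi_hyp_limit:
  assumes "A \<ge> -1/2" "z > 0"
  shows "(\<lambda>n. poly (jacobi_hyp n A A) (- cos (z / real n))) \<longlonglongrightarrow>
    (\<Sum>k. bessel_coeff A k * (z\<^sup>2 / 4) ^ k)"
  unfolding poly_jacobi_hyp_mehler
proof (rule tannerys_theorem[THEN conjunct2, THEN conjunct2])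
  show "mehler_term A z k \<longlonglongrightarrow> bessel_coeff A k * (z\<^sup>2 / 4) ^ k" for k
    by (rule mehler_term_limit[OF assms(2)])
  show "\<forall>\<^sub>F (k, n) in at_top \<times>\<^sub>F sequentially.
      norm (mehler_term A z k n) \<le> inverse (fact k) * (2 * ((2 * A + 3) * (z\<^sup>2 / 4))) ^ k"
    unfolding eventually_prod_filter
    by (rule exI[of _ "\<lambda>_. True"], rule exI[of _ "\<lambda>n. n \<ge> 1"])
      (use mehler_term_bound[OF assms(1)] in \<open>auto simp: eventually_ge_at_top\<close>)
  show "summable (\<lambda>k. inverse (fact k) * (2 * ((2 * A + 3) * (z\<^sup>2 / 4))) ^ k)"
    by (rule summable_exp)
qed simp

text \<open>For s > 0 this inverts Euler's limit formula for \<Gamma>(s). The value s = 0 arises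
  from A = -1/2; \<Gamma> has a pole there, but the quotient is 1 for every n > 0.\<close>

lemma Gamma_shift_ratio_limit:
  assumes "s \<ge> (0::real)"
  shows "(\<lambda>n. Gamma (real n + s) / (fact n * real n powr (s - 1))) \<longlonglongrightarrow> 1"
proof (cases "s = 0")
  case True
  have "\<forall>\<^sub>F n in sequentially. 1 = Gamma (real n + s) / (fact n * real n powr (s - 1))"
    using eventually_gt_at_top[of 0]
  proof eventually_elim
    case (elim n)
    then show ?case using Gamma_plus1_real[of "real n"] Gamma_real_pos[of "real n", THEN less_imp_neq]
      by (simp add: True powr_minus Gamma_fact[symmetric] add.commute field_simps)
  qed
  then show ?thesis by (rule Lim_transform_eventually[OF tendsto_const])
next
  case False
  then have s: "s > 0" using assms by simp
  have G: "Gamma s > 0" using s by simp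
  have "(\<lambda>n. Gamma s / Gamma_series' s n) \<longlonglongrightarrow> Gamma s / Gamma s"
    using G by (intro tendsto_intros Gamma_series'_LIMSEQ) auto
  then have "(\<lambda>n. Gamma s / Gamma_series' s n) \<longlonglongrightarrow> 1" using G by simp
  moreover have "\<forall>\<^sub>F n in sequentially. Gamma s / Gamma_series' s n =
      Gamma (real n + s) / (fact n * real n powr (s - 1))"
    using eventually_gt_at_top[of 0]
  proof eventually_elim
    case (elim n)
    have "pochhammer s n = Gamma (real n + s) / Gamma s"
      using s by (simp add: pochhammer_Gamma_real add_ac)
    moreover have "exp (s * ln (real n)) = real n * real n powr (s - 1)"
      using elim by (simp add: powr_def exp_add[symmetric] algebra_simps exp_diff)
    moreover have "fact n = real n * fact (n - 1)" using elim by (simp add: fact_reduce)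
    ultimately show ?case using G elim by (simp add: Gamma_series'_def)
  qed
  ultimately show ?thesis by (rule Lim_transform_eventually)
qed

lemma jacobi_prefactor_limit:
  assumes "A \<ge> -1/2" "z > 0"
  shows "(\<lambda>n. sin (z / real n) powr (A + 1/2) / sqrt (jacobi_norm_sq n A A)) \<longlonglongrightarrow>
    sqrt z * ((z/2) powr A / Gamma (A + 1))"
proof -
  have G: "Gamma (A + 1) > 0" using assms by simp
  define r where "r n = Gamma (real n + (2 * A + 1)) / (fact n * real n powr (2 * A))" for n
  \<comment> \<open>The inserted powers n^(2 A + 1), n^(-1) and n^(-2 A) cancel, and the three
    factors converge separately, to z^(2 A + 1), 2 and 1.\<close>
  define u where "u n = (real n * sin (z / real n)) powr (2 * A + 1) * ((2 * real n + 2 * A + 1) / real n) * r n" for n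
  have "(\<lambda>n. real n * sin (z / real n)) \<longlonglongrightarrow> z" using assms by real_asymp
  moreover have "(\<lambda>n. (2 * real n + 2 * A + 1) / real n) \<longlonglongrightarrow> 2" by real_asymp
  moreover have "r \<longlonglongrightarrow> 1" using Gamma_shift_ratio_limit[of "2 * A + 1"] assms by (simp add: r_def[abs_def])
  ultimately have "u \<longlonglongrightarrow> z powr (2 * A + 1) * 2 * 1"
    unfolding u_def using assms by (intro tendsto_intros) auto
  then have "(\<lambda>n. sqrt (u n) / (2 powr (A + 1/2) * Gamma (A + 1))) \<longlonglongrightarrow>
      sqrt (z powr (2 * A + 1) * 2 * 1) / (2 powr (A + 1/2) * Gamma (A + 1))"
    using G by (intro tendsto_intros) auto
  moreover have "sqrt (z powr (2 * A + 1) * 2 * 1) / (2 powr (A + 1/2) * Gamma (A + 1)) =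
      sqrt z * ((z/2) powr A / Gamma (A + 1))"
  proof -
    have "sqrt (z powr (2 * A + 1)) = z powr (A + 1/2)"
      using assms by (simp add: powr_half_sqrt[symmetric] powr_powr add_divide_distrib)
    then show ?thesis using assms
      by (simp add: real_sqrt_mult powr_add powr_half_sqrt powr_divide)
  qed
  moreover have "\<forall>\<^sub>F n in sequentially. sqrt (u n) / (2 powr (A + 1/2) * Gamma (A + 1)) =
      sin (z / real n) powr (A + 1/2) / sqrt (jacobi_norm_sq n A A)"
  proof -
    have "\<forall>\<^sub>F n in sequentially. z / pi < real n" by real_asymp
    with eventually_gt_at_top[of 0] show ?thesis
    proof eventually_elim
      case (elim n)
      then have "z / real n < pi" using assms by (simp add: field_simps)
      then have s: "sin (z / real n) > 0" using elim assms by (intro sin_gt_zero) auto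
      define N where "N = (2 * real n + 2 * A + 1) * Gamma (real n + (2 * A + 1)) / fact n"
      have G2: "Gamma (real n + A + 1) > 0" "Gamma (real n + (2 * A + 1)) > 0"
        using assms elim by (auto intro!: Gamma_real_pos)
      have "jacobi_norm_sq n A A = 2 powr (2 * A + 1) * (Gamma (A + 1))\<^sup>2 / N"
      proof -
        have e: "A + A + 1 = 2 * A + 1" "2 * real n + A + A + 1 = 2 * real n + 2 * A + 1"
          "real n + A + A + 1 = real n + (2 * A + 1)" by simp_all
        show ?thesis unfolding jacobi_norm_sq_def N_def e using elim G2(1) by simp
      qed
      moreover have "2 powr (2 * A + 1) = (2 powr (A + 1/2))\<^sup>2"
        by (simp add: power2_eq_square powr_add[symmetric])
      ultimately have h: "sqrt (jacobi_norm_sq n A A) = 2 powr (A + 1/2) * Gamma (A + 1) / sqrt N"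
        using G by (simp add: real_sqrt_divide real_sqrt_mult)
      have "u n = sin (z / real n) powr (2 * A + 1) * N"
        using s elim by (simp add: u_def r_def N_def powr_mult powr_add)
      moreover have "sqrt (sin (z / real n) powr (2 * A + 1)) = sin (z / real n) powr (A + 1/2)"
        using s by (simp add: powr_half_sqrt[symmetric] powr_powr add_divide_distrib)
      ultimately show ?case unfolding h by (simp add: real_sqrt_mult)
    qed
  qed
  ultimately show ?thesis using Lim_transform_eventually by fastforce
qed

theorem jacobi_F_mehler_heine:
  assumes "A \<ge> -1/2" "z > 0"
  shows "(\<lambda>n. jacobi_F n A A (cos (z / real n))) \<longlonglongrightarrow> sqrt z * \<bar>bessel_J A z\<bar>"
proof -
  have G: "Gamma (A + 1) > 0" using assms by simp
  have "(\<lambda>n. sin (z / real n) powr (A + 1/2) / sqrt (jacobi_norm_sq n A A) *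
      \<bar>poly (jacobi_hyp n A A) (- cos (z / real n))\<bar>) \<longlonglongrightarrow>
      sqrt z * ((z/2) powr A / Gamma (A + 1)) * \<bar>\<Sum>k. bessel_coeff A k * (z\<^sup>2 / 4) ^ k\<bar>"
    by (intro tendsto_mult tendsto_rabs jacobi_prefactor_limit poly_jacobi_hyp_limit assms)
  also have "sqrt z * ((z/2) powr A / Gamma (A + 1)) * \<bar>\<Sum>k. bessel_coeff A k * (z\<^sup>2 / 4) ^ k\<bar> =
      sqrt z * \<bar>bessel_J A z\<bar>"
    using G by (simp add: bessel_J_eq[OF assms] abs_mult)
  finally show ?thesis
  proof (rule Lim_transform_eventually)
    \<comment> \<open>Only for such n does the angle z/n lie in (0, pi), where the sine is positive
      and the weight factor becomes a power of it.\<close>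
    have "\<forall>\<^sub>F n in sequentially. z / pi < real n" by real_asymp
    with eventually_gt_at_top[of 0]
    show "\<forall>\<^sub>F n in sequentially. sin (z / real n) powr (A + 1/2) / sqrt (jacobi_norm_sq n A A) *
      \<bar>poly (jacobi_hyp n A A) (- cos (z / real n))\<bar> = jacobi_F n A A (cos (z / real n))"
    proof eventually_elim
      case (elim n)
      define \<phi> where "\<phi> = z / real n"
      have "\<phi> < pi" using assms elim by (simp add: field_simps \<phi>_def)
      then have s: "sin \<phi> > 0" using elim assms by (intro sin_gt_zero) (auto simp: \<phi>_def)
      have sq: "(1 + cos \<phi>) * (1 - cos \<phi>) = (sin \<phi>)\<^sup>2"
        by (simp add: sin_squared_eq power2_eq_square algebra_simps)
      then have c: "1 + cos \<phi> > 0" "1 - cos \<phi> > 0"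
        using s cos_ge_minus_one[of \<phi>] cos_le_one[of \<phi>]
        by (auto simp: less_le one_plus_cos_nonneg)
      have "rpow (1 + cos \<phi>) (A/2 + 1/4) * rpow (1 - cos \<phi>) (A/2 + 1/4) =
          ((1 + cos \<phi>) * (1 - cos \<phi>)) powr (A/2 + 1/4)"
        using c by (simp add: rpow_eq_powr powr_mult)
      also have "\<dots> = (sin \<phi> powr 2) powr (A/2 + 1/4)"
        unfolding sq using s powr_realpow[of "sin \<phi>" 2] by simp
      also have "\<dots> = sin \<phi> powr (A + 1/2)" by (simp add: powr_powr)
      finally have *: "rpow (1 + cos \<phi>) (A/2 + 1/4) * rpow (1 - cos \<phi>) (A/2 + 1/4) = sin \<phi> powr (A + 1/2)" .
      have "jacobi_F n A A (cos \<phi>) = jacobi_F n A A (- cos \<phi>)"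
        by (rule jacobi_F_reflect) (use assms in auto)
      also have "\<dots> = rpow (1 + cos \<phi>) (A/2 + 1/4) * rpow (1 - cos \<phi>) (A/2 + 1/4) *
          \<bar>poly (jacobi_hyp n A A) (- cos \<phi>)\<bar> / sqrt (jacobi_norm_sq n A A)"
        using c assms by (subst jacobi_F_hyp) auto
      finally show ?case unfolding * unfolding \<phi>_def by simp
    qed
  qed
qed

section \<open>A WKB subsolution of Bessel's equation\<close>

text \<open>A monotonicity argument that starts from the right limit at 0, since the derivatives
  below are available only for t > 0.\<close>

lemma DERIV_nonneg_limit_bound:
  fixes g :: "real \<Rightarrow> real"
  assumes der: "\<And>t. 0 < t \<Longrightarrow> t \<le> b \<Longrightarrow> (g has_real_derivative g' t) (at t)"
    and nonneg: "\<And>t. 0 < t \<Longrightarrow> t \<le> b \<Longrightarrow> g' t \<ge> 0"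
    and lim: "(g \<longlongrightarrow> l) (at_right 0)" and t: "0 < t" "t \<le> b"
  shows "l \<le> g t"
proof (rule tendsto_upperbound[OF lim])
  have "\<forall>\<^sub>F s in at_right 0. s \<in> {0<..<t}"
    using t by (intro eventually_at_right_real)
  then show "\<forall>\<^sub>F s in at_right 0. g s \<le> g t"
  proof eventually_elim
    case (elim s)
    show ?case
    proof (rule DERIV_nonneg_imp_nondecreasing[of s t g])
      show "\<exists>y. (g has_real_derivative y) (at x) \<and> 0 \<le> y" if "s \<le> x" "x \<le> t" for x
        using der[of x] nonneg[of x] that elim t by force
    qed (use elim in auto)
  qed
qed simp

text \<open>The form of a solution at the regular singular point 0. The operator t d/dt stays in
  this class: it multiplies \<open>c k\<close> by \<nu> + 2 k.\<close>

definition frobenius_series :: "real \<Rightarrow> (nat \<Rightarrow> real) \<Rightarrow> real \<Rightarrow> real" where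
  "frobenius_series \<nu> c t = t powr \<nu> * (\<Sum>k. c k * (t\<^sup>2 / 4) ^ k)"

lemma
  fixes c :: "nat \<Rightarrow> real"
  assumes c: "\<And>w. summable (\<lambda>k. c k * w ^ k)"
  shows summable_index_mult: "summable (\<lambda>k. real k * c k * w ^ k)"
    and power_series_theta_derivative:
      "((\<lambda>w. \<Sum>k. c k * w ^ k) has_real_derivative (\<Sum>k. diffs c k * w ^ k)) (at w)"
      "w * (\<Sum>k. diffs c k * w ^ k) = (\<Sum>k. real k * c k * w ^ k)"
proof -
  have "summable (\<lambda>k. diffs c k * w ^ k)" by (rule termdiff_converges_all[OF c])
  from sums_mult[OF diffs_equiv[OF this], of w]
  have "(\<lambda>k. w * (real k * c k * w ^ (k - Suc 0))) sums (w * (\<Sum>k. diffs c k * w ^ k))" .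
  also have "(\<lambda>k. w * (real k * c k * w ^ (k - Suc 0))) = (\<lambda>k. real k * c k * w ^ k)"
  proof
    show "w * (real k * c k * w ^ (k - Suc 0)) = real k * c k * w ^ k" for k
      by (cases k) auto
  qed
  finally have S: "(\<lambda>k. real k * c k * w ^ k) sums (w * (\<Sum>k. diffs c k * w ^ k))" .
  show "summable (\<lambda>k. real k * c k * w ^ k)" using S by (rule sums_summable)
  show "w * (\<Sum>k. diffs c k * w ^ k) = (\<Sum>k. real k * c k * w ^ k)" using S by (rule sums_unique)
  show "((\<lambda>w. \<Sum>k. c k * w ^ k) has_real_derivative (\<Sum>k. diffs c k * w ^ k)) (at w)"
    by (rule termdiffs_strong_converges_everywhere[OF c])
qed

lemma frobenius_coeff_summable:
  fixes c :: "nat \<Rightarrow> real"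
  assumes c: "\<And>w. summable (\<lambda>k. c k * w ^ k)"
  shows "summable (\<lambda>k. (\<nu> + 2 * real k) * c k * w ^ k)"
proof -
  have "summable (\<lambda>k. \<nu> * (c k * w ^ k) + 2 * (real k * c k * w ^ k))"
    by (intro summable_add summable_mult c summable_index_mult)
  then show ?thesis by (simp add: algebra_simps)
qed

lemma has_derivative_frobenius_series:
  fixes c :: "nat \<Rightarrow> real"
  assumes c: "\<And>w. summable (\<lambda>k. c k * w ^ k)" and t: "t > 0"
  shows "(frobenius_series \<nu> c has_real_derivative
    frobenius_series \<nu> (\<lambda>k. (\<nu> + 2 * real k) * c k) t / t) (at t)"
proof -
  define f where "f w = (\<Sum>k. c k * w ^ k)" for w
  define f' where "f' w = (\<Sum>k. diffs c k * w ^ k)" for w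
  note [derivative_intros] = DERIV_chain2[OF power_series_theta_derivative(1)[OF c, folded f_def f'_def]]
  have D: "((\<lambda>t. t powr \<nu> * f (t\<^sup>2 / 4)) has_real_derivative
      \<nu> * t powr (\<nu> - 1) * f (t\<^sup>2 / 4) + t powr \<nu> * (f' (t\<^sup>2 / 4) * (t / 2))) (at t)"
    using t by (auto intro!: derivative_eq_intros simp: powr_diff)
  have "(\<Sum>k. (\<nu> + 2 * real k) * c k * w ^ k) = \<nu> * f w + 2 * (w * f' w)" for w
  proof -
    have "(\<Sum>k. (\<nu> + 2 * real k) * c k * w ^ k) = (\<Sum>k. \<nu> * (c k * w ^ k) + 2 * (real k * c k * w ^ k))"
      by (simp add: algebra_simps)
    also have "\<dots> = \<nu> * f w + 2 * (\<Sum>k. real k * c k * w ^ k)"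
      unfolding f_def
      by (subst suminf_add[symmetric])
        (intro summable_mult c summable_index_mult | simp add: suminf_mult c summable_index_mult)+
    finally show ?thesis
      by (simp add: f'_def power_series_theta_derivative(2)[OF c])
  qed
  then have "frobenius_series \<nu> (\<lambda>k. (\<nu> + 2 * real k) * c k) t / t =
      t powr \<nu> * (\<nu> * f (t\<^sup>2 / 4) + 2 * (t\<^sup>2 / 4 * f' (t\<^sup>2 / 4))) / t"
    by (simp only: frobenius_series_def)
  also have "\<dots> = \<nu> * (t powr \<nu> / t) * f (t\<^sup>2 / 4) + t powr \<nu> * (f' (t\<^sup>2 / 4) * (t / 2))"
  proof -
    have "u * (\<nu> * v + 2 * (t\<^sup>2 / 4 * v')) / t = \<nu> * (u / t) * v + u * (v' * (t / 2))" for u v v'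
      using t by (simp add: field_simps power2_eq_square)
    then show ?thesis .
  qed
  also have "t powr \<nu> / t = t powr (\<nu> - 1)" using t by (simp add: powr_diff)
  finally show ?thesis using D by (simp only: frobenius_series_def[abs_def] f_def[symmetric])
qed

lemma frobenius_series_ratio_limit:
  fixes c :: "nat \<Rightarrow> real"
  assumes c: "\<And>w. summable (\<lambda>k. c k * w ^ k)"
  shows "((\<lambda>t. \<Sum>k. c k * (t\<^sup>2 / 4) ^ k) \<longlongrightarrow> c 0) (at_right 0)"
proof -
  have "isCont (\<lambda>w. \<Sum>k. c k * w ^ k) 0"
    by (rule DERIV_isCont[OF power_series_theta_derivative(1)[OF c]])
  moreover have "((\<lambda>t::real. t\<^sup>2 / 4) \<longlongrightarrow> 0) (at_right 0)" by real_asymp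
  ultimately have "((\<lambda>t. \<Sum>k. c k * (t\<^sup>2 / 4) ^ k) \<longlongrightarrow> (\<Sum>k. c k * 0 ^ k)) (at_right 0)"
    by (rule isCont_tendsto_compose)
  then show ?thesis by simp
qed

lemma frobenius_series_limit:
  fixes c :: "nat \<Rightarrow> real"
  assumes c: "\<And>w. summable (\<lambda>k. c k * w ^ k)" and "\<nu> > 0"
  shows "(frobenius_series \<nu> c \<longlongrightarrow> 0) (at_right 0)"
proof -
  have "((\<lambda>t::real. t powr \<nu>) \<longlongrightarrow> 0) (at_right 0)" using assms(2) by real_asymp
  from tendsto_mult[OF this frobenius_series_ratio_limit[OF c]] show ?thesis
    by (simp add: frobenius_series_def[abs_def])
qed

text \<open>The recurrence \<open>4 k (k + \<nu>) c\<^sub>k = - 4 c\<^sub>k\<^sub>-\<^sub>1\<close> of the coefficients is Bessel's equation.\<close>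

lemma frobenius_series_bessel_ode:
  assumes "\<nu> > 0"
  shows "frobenius_series \<nu> (\<lambda>k. (\<nu> + 2 * real k) * ((\<nu> + 2 * real k) * bessel_coeff \<nu> k)) t =
    (\<nu>\<^sup>2 - t\<^sup>2) * frobenius_series \<nu> (bessel_coeff \<nu>) t"
proof -
  define w where "w = t\<^sup>2 / 4"
  define f where "f = (\<Sum>k. bessel_coeff \<nu> k * w ^ k)"
  have sm: "summable (\<lambda>k. bessel_coeff \<nu> k * w ^ k)" for w
    using assms by (intro summable_bessel_coeff) auto
  have S: "(\<lambda>k. bessel_coeff \<nu> k * w ^ k) sums f" unfolding f_def using sm by (rule summable_sums)
  have rec: "4 * real (Suc k) * (real (Suc k) + \<nu>) * bessel_coeff \<nu> (Suc k) = -4 * bessel_coeff \<nu> k" for k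
  proof -
    have b: "bessel_coeff \<nu> (Suc k) =
        - ((-1) ^ k / (real (Suc k) * fact k * (pochhammer (\<nu> + 1) k * (\<nu> + 1 + real k))))"
      by (simp add: bessel_coeff_def pochhammer_Suc)
    have x: "real (Suc k) + \<nu> = \<nu> + 1 + real k" by simp
    have alg: "4 * m * x * - (\<sigma> / (m * q * (r * x))) = -4 * (\<sigma> / (q * r))"
      if "m \<noteq> 0" "x \<noteq> 0" for m x q r \<sigma> :: real
      using that by simp
    show ?thesis unfolding b x bessel_coeff_def[of _ k]
      by (rule alg) (use assms in simp_all)
  qed
  have "(\<lambda>k. -4 * w * (bessel_coeff \<nu> k * w ^ k)) sums (-4 * w * f)" by (rule sums_mult[OF S])
  also have "(\<lambda>k. -4 * w * (bessel_coeff \<nu> k * w ^ k)) =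
      (\<lambda>k. 4 * real (Suc k) * (real (Suc k) + \<nu>) * bessel_coeff \<nu> (Suc k) * w ^ Suc k)"
    unfolding rec by (simp add: mult_ac)
  \<comment> \<open>The shift of index costs nothing, as the factor \<open>real k\<close> kills the
    term k = 0.\<close>
  finally have "(\<lambda>k. 4 * real k * (real k + \<nu>) * bessel_coeff \<nu> k * w ^ k) sums (-4 * w * f)"
    by (subst (asm) sums_Suc_iff) simp
  \<comment> \<open>Here (\<nu> + 2 k)^2 = \<nu>^2 + 4 k (k + \<nu>), and 4 w = t^2.\<close>
  from sums_add[OF sums_mult[OF S, of "\<nu>\<^sup>2"] this]
  have "(\<lambda>k. (\<nu> + 2 * real k) * ((\<nu> + 2 * real k) * bessel_coeff \<nu> k) * w ^ k) sums (\<nu>\<^sup>2 * f - 4 * w * f)"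
    by (simp add: algebra_simps power2_eq_square)
  then have "(\<Sum>k. (\<nu> + 2 * real k) * ((\<nu> + 2 * real k) * bessel_coeff \<nu> k) * w ^ k) = (\<nu>\<^sup>2 - t\<^sup>2) * f"
    by (simp add: sums_iff w_def algebra_simps)
  then show ?thesis by (simp add: frobenius_series_def w_def f_def mult_ac)
qed

context
  fixes \<nu> :: real
  assumes \<nu>: "\<nu> > 0"
begin

text \<open>For t > 0 this is 2^\<nu> \<Gamma>(\<nu> + 1) J_\<nu>(t), normalised so that its
  quotient by t^\<nu> tends to 1 at 0.\<close>

definition bes :: "real \<Rightarrow> real" where
  "bes = frobenius_series \<nu> (bessel_coeff \<nu>)"

definition bes_theta :: "real \<Rightarrow> real" where
  "bes_theta = frobenius_series \<nu> (\<lambda>k. (\<nu> + 2 * real k) * bessel_coeff \<nu> k)"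

lemma summable_bessel_coeff': "summable (\<lambda>k. bessel_coeff \<nu> k * w ^ k)"
  using \<nu> by (intro summable_bessel_coeff) auto

lemma bes_deriv: "t > 0 \<Longrightarrow> (bes has_real_derivative bes_theta t / t) (at t)"
  unfolding bes_def bes_theta_def by (rule has_derivative_frobenius_series[OF summable_bessel_coeff'])

lemma bes_theta_deriv:
  "t > 0 \<Longrightarrow> (bes_theta has_real_derivative (\<nu>\<^sup>2 - t\<^sup>2) * bes t / t) (at t)"
  using has_derivative_frobenius_series[OF frobenius_coeff_summable[OF summable_bessel_coeff', of \<nu>], of t \<nu>]
  unfolding bes_def bes_theta_def frobenius_series_bessel_ode[OF \<nu>] .

lemma bes_limit: "(bes \<longlongrightarrow> 0) (at_right 0)"
  unfolding bes_def by (rule frobenius_series_limit[OF summable_bessel_coeff' \<nu>])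

lemma bes_theta_limit: "(bes_theta \<longlongrightarrow> 0) (at_right 0)"
  unfolding bes_theta_def by (rule frobenius_series_limit[OF frobenius_coeff_summable[OF summable_bessel_coeff'] \<nu>])

lemma bes_ratio_limit: "((\<lambda>t. bes t / t powr \<nu>) \<longlongrightarrow> 1) (at_right 0)"
proof -
  have "bessel_coeff \<nu> 0 = 1" by (simp add: bessel_coeff_def)
  then have "((\<lambda>t. \<Sum>k. bessel_coeff \<nu> k * (t\<^sup>2 / 4) ^ k) \<longlongrightarrow> 1) (at_right 0)"
    using frobenius_series_ratio_limit[OF summable_bessel_coeff'] by simp
  then show ?thesis
  proof (rule Lim_transform_eventually)
    show "\<forall>\<^sub>F t in at_right 0. (\<Sum>k. bessel_coeff \<nu> k * (t\<^sup>2 / 4) ^ k) = bes t / t powr \<nu>"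
      using eventually_at_right_less[of "0::real"]
      by eventually_elim (auto simp: bes_def frobenius_series_def)
  qed
qed

section \<open>Positivity and growth up to the turning point\<close>

lemma bes_eventually_pos: "\<forall>\<^sub>F t in at_right 0. bes t > 0"
proof -
  have "\<forall>\<^sub>F t in at_right 0. bes t / t powr \<nu> > 0"
    using order_tendstoD(1)[OF bes_ratio_limit, of 0] by simp
  with eventually_at_right_less[of "0::real"] show ?thesis
    by eventually_elim (auto simp: zero_less_divide_iff)
qed

text \<open>The product vanishes at 0, and its derivative is a sum of squares with nonnegative
  weights up to t = \<nu>. No knowledge of the sign of \<open>bes\<close> enters.\<close>

lemma bes_mult_theta_nonneg:
  assumes "0 < t" "t \<le> \<nu>"
  shows "bes t * bes_theta t \<ge> 0"
proof (rule DERIV_nonneg_limit_bound[OF _ _ _ assms])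
  show "((\<lambda>t. bes t * bes_theta t) \<longlongrightarrow> 0) (at_right 0)"
    using tendsto_mult[OF bes_limit bes_theta_limit] by simp
  show "((\<lambda>t. bes t * bes_theta t) has_real_derivative
      ((bes_theta t)\<^sup>2 + (\<nu>\<^sup>2 - t\<^sup>2) * (bes t)\<^sup>2) / t) (at t)" if "0 < t" for t
    using that by (auto intro!: derivative_eq_intros bes_deriv bes_theta_deriv
        simp: field_simps power2_eq_square)
  show "((bes_theta t)\<^sup>2 + (\<nu>\<^sup>2 - t\<^sup>2) * (bes t)\<^sup>2) / t \<ge> 0" if "0 < t" "t \<le> \<nu>" for t
    using that by (intro divide_nonneg_pos add_nonneg_nonneg mult_nonneg_nonneg)
      (auto simp: power_mono)
qed

text \<open>The square of \<open>bes\<close> is nondecreasing by the preceding product estimate and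
  is positive arbitrarily close to 0. Squaring avoids presupposing the sign that is to be
  established.\<close>

lemma bes_nonzero:
  assumes "0 < t" "t \<le> \<nu>"
  shows "bes t \<noteq> 0"
proof -
  have "\<forall>\<^sub>F s in at_right 0. s \<in> {0<..<t}"
    using assms by (intro eventually_at_right_real)
  with bes_eventually_pos have "\<forall>\<^sub>F s in at_right 0. bes s > 0 \<and> s \<in> {0<..<t}"
    by eventually_elim auto
  then obtain s where s: "bes s > 0" "0 < s" "s < t"
    using eventually_happens[of _ "at_right (0::real)"] by force
  have "(bes s)\<^sup>2 \<le> (bes t)\<^sup>2"
  proof (rule DERIV_nonneg_imp_nondecreasing[of s t "\<lambda>t. (bes t)\<^sup>2"])
    fix x assume x: "s \<le> x" "x \<le> t"
    have "((\<lambda>t. (bes t)\<^sup>2) has_real_derivative 2 * (bes x * bes_theta x) / x) (at x)"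
      using x s by (auto intro!: derivative_eq_intros bes_deriv)
    moreover have "2 * (bes x * bes_theta x) / x \<ge> 0"
      using bes_mult_theta_nonneg[of x] x s assms by simp
    ultimately show "\<exists>y. ((\<lambda>t. (bes t)\<^sup>2) has_real_derivative y) (at x) \<and> 0 \<le> y" by blast
  qed (use s in auto)
  then show ?thesis using s by auto
qed

lemma bes_pos:
  assumes "0 < t" "t \<le> \<nu>"
  shows "bes t > 0"
proof (rule ccontr)
  assume "\<not> bes t > 0"
  then have neg: "bes t \<le> 0" by simp
  have "\<forall>\<^sub>F s in at_right 0. s \<in> {0<..<t}"
    using assms by (intro eventually_at_right_real)
  with bes_eventually_pos have "\<forall>\<^sub>F s in at_right 0. bes s > 0 \<and> s \<in> {0<..<t}"
    by eventually_elim auto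
  then obtain s where s: "bes s > 0" "0 < s" "s < t"
    using eventually_happens[of _ "at_right (0::real)"] by force
  have "\<exists>x\<ge>s. x \<le> t \<and> bes x = 0"
    using s neg by (intro IVT2) (auto intro!: DERIV_isCont[OF bes_deriv])
  then show False using bes_nonzero s assms by force
qed

lemma bes_mono:
  assumes "0 < s" "s \<le> t" "t \<le> \<nu>"
  shows "bes s \<le> bes t"
proof (rule DERIV_nonneg_imp_nondecreasing[of s t bes])
  fix x assume x: "s \<le> x" "x \<le> t"
  have "bes_theta x \<ge> 0"
    using bes_mult_theta_nonneg[of x] bes_pos[of x] x assms by (simp add: zero_le_mult_iff)
  then have "bes_theta x / x \<ge> 0" using x assms by simp
  then show "\<exists>y. (bes has_real_derivative y) (at x) \<and> 0 \<le> y"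
    using bes_deriv[of x] x assms by auto
qed (use assms in auto)

text \<open>The second order WKB approximation has logarithmic derivative \<open>(y + t\<^sup>2 / (2 y\<^sup>2)) / t\<close>. It is not a
  subsolution; the last term of \<open>wkb_slope\<close> makes it one and changes \<open>ln wkb\<close> by a bounded amount
  as long as \<open>y\<^sup>3 \<ge> 2 \<nu>\<^sup>2\<close>.\<close>

definition wkb_y :: "real \<Rightarrow> real" where
  "wkb_y t = sqrt (\<nu>\<^sup>2 - t\<^sup>2)"

definition wkb_slope :: "real \<Rightarrow> real" where
  "wkb_slope t = wkb_y t + t\<^sup>2 / (2 * wkb_y t ^ 2) - \<nu>\<^sup>2 * t\<^sup>2 / wkb_y t ^ 5"

text \<open>An antiderivative of \<open>wkb_slope\<close> divided by t, without the singular part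
  \<nu> ln t, which \<open>wkb\<close> restores as t^\<nu>; hence the finite limit at 0. The terms y
  - \<nu> ln (\<nu> + y), -ln y/2 and the last one belong to the three terms of
  \<open>wkb_slope\<close> in this order.\<close>

definition wkb_reg :: "real \<Rightarrow> real" where
  "wkb_reg t = wkb_y t - \<nu> * ln (\<nu> + wkb_y t) - ln (wkb_y t) / 2 - \<nu>\<^sup>2 / (3 * wkb_y t ^ 3)"

definition wkb :: "real \<Rightarrow> real" where
  "wkb t = t powr \<nu> * exp (wkb_reg t)"

lemma wkb_y_pos: "0 \<le> t \<Longrightarrow> t < \<nu> \<Longrightarrow> wkb_y t > 0"
  by (simp add: wkb_y_def power_strict_mono)

lemma wkb_y_sq: "0 \<le> t \<Longrightarrow> t < \<nu> \<Longrightarrow> (wkb_y t)\<^sup>2 = \<nu>\<^sup>2 - t\<^sup>2"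
  by (simp add: wkb_y_def power_mono)

lemma wkb_y_deriv:
  assumes "0 \<le> t" "t < \<nu>"
  shows "(wkb_y has_real_derivative - t / wkb_y t) (at t)"
proof -
  have "\<nu>\<^sup>2 - t\<^sup>2 > 0" using assms by (simp add: power_strict_mono)
  then show ?thesis unfolding wkb_y_def[abs_def]
    by (auto intro!: derivative_eq_intros simp: field_simps)
qed

lemma wkb_slope_deriv:
  assumes "0 \<le> t" "t < \<nu>"
  defines "y \<equiv> wkb_y t"
  shows "(wkb_slope has_real_derivative
    (- t / y + t / y ^ 2 + t ^ 3 / y ^ 4 - 2 * \<nu>\<^sup>2 * t / y ^ 5 - 5 * \<nu>\<^sup>2 * t ^ 3 / y ^ 7)) (at t)"
proof -
  have y: "y > 0" unfolding y_def using assms by (intro wkb_y_pos)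
  show ?thesis unfolding wkb_slope_def[abs_def]
    using y unfolding y_def
    by (auto intro!: derivative_eq_intros wkb_y_deriv assms)
      (simp add: field_simps power_numeral_reduce)
qed

lemma wkb_deriv:
  assumes "0 < t" "t < \<nu>"
  shows "(wkb has_real_derivative wkb t * wkb_slope t / t) (at t)"
proof -
  define y where "y = wkb_y t"
  have y: "y > 0" unfolding y_def using assms by (intro wkb_y_pos) auto
  have reg: "(wkb_reg has_real_derivative
      (- t / y - \<nu> * (- t / y) / (\<nu> + y) - (- t / y) / (2 * y) + \<nu>\<^sup>2 * (- t / y) / y ^ 4)) (at t)"
    unfolding wkb_reg_def[abs_def] using y \<nu> assms unfolding y_def
    by (auto intro!: derivative_eq_intros wkb_y_deriv)
      (simp add: field_simps power_numeral_reduce)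
  \<comment> \<open>This turns -t^2/(\<nu> + y) into y - \<nu>, whose -\<nu> cancels the
    contribution of the factor t^\<nu>.\<close>
  have t2: "t * t = (\<nu> - y) * (\<nu> + y)"
    using wkb_y_sq[of t] assms by (simp add: y_def power2_eq_square algebra_simps)
  have "1 - \<nu> / (\<nu> + y) = y / (\<nu> + y)" using y \<nu> by (simp add: diff_divide_eq_iff)
  then have "- t / y * (1 - \<nu> / (\<nu> + y)) = - t / (\<nu> + y)" using y by simp
  then have "- t / y - \<nu> * (- t / y) / (\<nu> + y) = - t / (\<nu> + y)"
    by (simp add: algebra_simps)
  then have *: "- t / y - \<nu> * (- t / y) / (\<nu> + y) - (- t / y) / (2 * y) + \<nu>\<^sup>2 * (- t / y) / y ^ 4 =
      - t / (\<nu> + y) + t / (2 * y ^ 2) - \<nu>\<^sup>2 * t / y ^ 5"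
    using y by (simp add: power_numeral_reduce)
  have "t * (- t / (\<nu> + y) + t / (2 * y ^ 2) - \<nu>\<^sup>2 * t / y ^ 5) =
      - (t * t) / (\<nu> + y) + t\<^sup>2 / (2 * y ^ 2) - \<nu>\<^sup>2 * t\<^sup>2 / y ^ 5"
    by (simp add: algebra_simps power2_eq_square)
  also have "- (t * t) / (\<nu> + y) = y - \<nu>" unfolding t2 using y \<nu> by (simp add: field_simps)
  finally have slope: "wkb_slope t =
      \<nu> + t * (- t / (\<nu> + y) + t / (2 * y ^ 2) - \<nu>\<^sup>2 * t / y ^ 5)"
    by (simp add: wkb_slope_def y_def)
  have "((\<lambda>t. t powr \<nu> * exp (wkb_reg t)) has_real_derivative
      \<nu> * t powr (\<nu> - 1) * exp (wkb_reg t) +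
      t powr \<nu> * (exp (wkb_reg t) * (- t / (\<nu> + y) + t / (2 * y ^ 2) - \<nu>\<^sup>2 * t / y ^ 5))) (at t)"
    using reg[unfolded *] assms by (auto intro!: derivative_eq_intros simp: powr_diff)
  also have "\<nu> * t powr (\<nu> - 1) * exp (wkb_reg t) +
      t powr \<nu> * (exp (wkb_reg t) * (- t / (\<nu> + y) + t / (2 * y ^ 2) - \<nu>\<^sup>2 * t / y ^ 5)) =
      t powr \<nu> * exp (wkb_reg t) * wkb_slope t / t"
    unfolding slope using assms by (simp add: powr_diff add_divide_distrib distrib_left)
  finally show ?thesis by (simp add: wkb_def[abs_def])
qed

lemma wkb_subsolution:
  assumes t: "0 < t" "t < \<nu>" and y3: "wkb_y t ^ 3 \<ge> 2 * \<nu>\<^sup>2"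
  defines "y \<equiv> wkb_y t"
  shows "t * (- t / y + t / y ^ 2 + t ^ 3 / y ^ 4 - 2 * \<nu>\<^sup>2 * t / y ^ 5 - 5 * \<nu>\<^sup>2 * t ^ 3 / y ^ 7) +
    (wkb_slope t)\<^sup>2 \<le> \<nu>\<^sup>2 - t\<^sup>2"
proof -
  have y: "y > 0" unfolding y_def using t by (intro wkb_y_pos) auto
  have ysq: "y\<^sup>2 = \<nu>\<^sup>2 - t\<^sup>2" using wkb_y_sq t by (simp add: y_def)
  \<comment> \<open>The hypothesis on y^3 amounts to e \<ge> 0. As e is also at most t^2/(2 y^2),
    the correction does not enlarge the square.\<close>
  define e where "e = t\<^sup>2 / (2 * y ^ 2) - \<nu>\<^sup>2 * t\<^sup>2 / y ^ 5"
  have "e = t\<^sup>2 / (2 * y ^ 5) * (y ^ 3 - 2 * \<nu>\<^sup>2)"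
    using y by (simp add: e_def field_simps power_numeral_reduce)
  then have "0 \<le> e" using y y3 by (simp add: y_def)
  moreover have "e \<le> t\<^sup>2 / (2 * y ^ 2)" using y by (simp add: e_def)
  ultimately have "e\<^sup>2 \<le> (t\<^sup>2 / (2 * y ^ 2))\<^sup>2" by (intro power_mono)
  also have "\<dots> = t ^ 4 / (4 * y ^ 4)" by (simp add: power_divide power_mult_distrib)
  finally have e2: "e\<^sup>2 \<le> t ^ 4 / (4 * y ^ 4)" .
  have "(wkb_slope t)\<^sup>2 = (y + e)\<^sup>2" by (simp add: wkb_slope_def e_def y_def add_diff_eq)
  also have "\<dots> = y\<^sup>2 + 2 * y * e + e\<^sup>2" by (simp add: power2_eq_square algebra_simps)
  also have "2 * y * e = t\<^sup>2 / y - 2 * \<nu>\<^sup>2 * t\<^sup>2 / y ^ 4"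
    using y by (simp add: e_def field_simps power_numeral_reduce)
  finally have s2: "(wkb_slope t)\<^sup>2 \<le> y\<^sup>2 + (t\<^sup>2 / y - 2 * \<nu>\<^sup>2 * t\<^sup>2 / y ^ 4) + t ^ 4 / (4 * y ^ 4)"
    using e2 by simp
  have "t * (- t / y + t / y ^ 2 + t ^ 3 / y ^ 4 - 2 * \<nu>\<^sup>2 * t / y ^ 5 - 5 * \<nu>\<^sup>2 * t ^ 3 / y ^ 7) \<le>
      t * (- t / y + t / y ^ 2 + t ^ 3 / y ^ 4)"
  proof (rule mult_left_mono)
    have "2 * \<nu>\<^sup>2 * t / y ^ 5 \<ge> 0" "5 * \<nu>\<^sup>2 * t ^ 3 / y ^ 7 \<ge> 0" using t y by simp_all
    then show "- t / y + t / y ^ 2 + t ^ 3 / y ^ 4 - 2 * \<nu>\<^sup>2 * t / y ^ 5 - 5 * \<nu>\<^sup>2 * t ^ 3 / y ^ 7 \<le>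
        - t / y + t / y ^ 2 + t ^ 3 / y ^ 4" by linarith
  qed (use t in simp)
  also have "\<dots> = - t\<^sup>2 / y + t\<^sup>2 * (y\<^sup>2 + t\<^sup>2) / y ^ 4"
    using y by (simp add: field_simps power_numeral_reduce)
  also have "y\<^sup>2 + t\<^sup>2 = \<nu>\<^sup>2" using ysq by simp
  finally have s1: "t * (- t / y + t / y ^ 2 + t ^ 3 / y ^ 4 - 2 * \<nu>\<^sup>2 * t / y ^ 5 - 5 * \<nu>\<^sup>2 * t ^ 3 / y ^ 7) \<le>
      - t\<^sup>2 / y + t\<^sup>2 * \<nu>\<^sup>2 / y ^ 4" .
  have "2 * \<nu>\<^sup>2 * t\<^sup>2 / y ^ 4 = 2 * (t\<^sup>2 * \<nu>\<^sup>2 / y ^ 4)" by simp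
  moreover have "(t ^ 4 / 4 - \<nu>\<^sup>2 * t\<^sup>2) / y ^ 4 = t ^ 4 / (4 * y ^ 4) - t\<^sup>2 * \<nu>\<^sup>2 / y ^ 4"
    by (simp add: diff_divide_distrib mult.commute)
  moreover have "- t\<^sup>2 / y = - (t\<^sup>2 / y)" by simp
  ultimately have "t * (- t / y + t / y ^ 2 + t ^ 3 / y ^ 4 - 2 * \<nu>\<^sup>2 * t / y ^ 5 - 5 * \<nu>\<^sup>2 * t ^ 3 / y ^ 7) +
      (wkb_slope t)\<^sup>2 \<le> y\<^sup>2 + (t ^ 4 / 4 - \<nu>\<^sup>2 * t\<^sup>2) / y ^ 4"
    using s1 s2 by linarith
  also have "t ^ 4 / 4 \<le> \<nu>\<^sup>2 * t\<^sup>2"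
  proof -
    have "t\<^sup>2 \<le> \<nu>\<^sup>2" using t by (intro power_mono) auto
    then have "t\<^sup>2 * t\<^sup>2 \<le> \<nu>\<^sup>2 * t\<^sup>2" by (intro mult_right_mono) auto
    moreover have "t ^ 4 = t\<^sup>2 * t\<^sup>2" by simp
    moreover have "0 \<le> t\<^sup>2 * t\<^sup>2" by simp
    ultimately show ?thesis by linarith
  qed
  then have "(t ^ 4 / 4 - \<nu>\<^sup>2 * t\<^sup>2) / y ^ 4 \<le> 0" using y by (intro divide_nonpos_pos) auto
  finally show ?thesis using ysq by simp
qed

lemma wkb_y_antimono: "0 \<le> s \<Longrightarrow> s \<le> t \<Longrightarrow> wkb_y t \<le> wkb_y s"
  by (simp add: wkb_y_def power_mono)

lemma wkb_y_limit: "(wkb_y \<longlongrightarrow> \<nu>) (at_right 0)"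
proof -
  have "((\<lambda>t. sqrt (\<nu>\<^sup>2 - t\<^sup>2)) \<longlongrightarrow> sqrt (\<nu>\<^sup>2 - 0\<^sup>2)) (at_right 0)"
    by (intro tendsto_intros)
  then show ?thesis using \<nu> by (simp add: wkb_y_def[abs_def])
qed

lemma wkb_slope_limit: "(wkb_slope \<longlongrightarrow> \<nu>) (at_right 0)"
proof -
  have "(wkb_slope \<longlongrightarrow> \<nu> + 0\<^sup>2 / (2 * \<nu> ^ 2) - \<nu>\<^sup>2 * 0\<^sup>2 / \<nu> ^ 5) (at_right 0)"
    unfolding wkb_slope_def[abs_def] using \<nu> by (intro tendsto_intros wkb_y_limit) auto
  then show ?thesis by simp
qed

lemma wkb_reg_limit:
  "(wkb_reg \<longlongrightarrow> \<nu> - \<nu> * ln (\<nu> + \<nu>) - ln \<nu> / 2 - \<nu>\<^sup>2 / (3 * \<nu> ^ 3)) (at_right 0)"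
  unfolding wkb_reg_def[abs_def] using \<nu> by (intro tendsto_intros wkb_y_limit) auto

lemma wkb_limit: "(wkb \<longlongrightarrow> 0) (at_right 0)"
proof -
  have "((\<lambda>t::real. t powr \<nu>) \<longlongrightarrow> 0) (at_right 0)" using \<nu> by real_asymp
  from tendsto_mult[OF this tendsto_exp[OF wkb_reg_limit]] show ?thesis
    by (simp add: wkb_def[abs_def])
qed

lemma wkb_pos: "t > 0 \<Longrightarrow> wkb t > 0"
  by (simp add: wkb_def)

text \<open>Sturm comparison: the Wronskian of \<open>bes\<close> and the subsolution \<open>wkb\<close> is nondecreasing and vanishes
  at \<open>0\<close>, so that \<open>bes / wkb\<close> is nondecreasing.\<close>

lemma bes_wronskian_nonneg:
  assumes t: "0 < t" "t < \<nu>" and y3: "wkb_y t ^ 3 \<ge> 2 * \<nu>\<^sup>2"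
  shows "wkb t * (bes_theta t - bes t * wkb_slope t) \<ge> 0"
proof -
  define sd where "sd t = - t / wkb_y t + t / wkb_y t ^ 2 + t ^ 3 / wkb_y t ^ 4 -
    2 * \<nu>\<^sup>2 * t / wkb_y t ^ 5 - 5 * \<nu>\<^sup>2 * t ^ 3 / wkb_y t ^ 7" for t
  show ?thesis
  proof (rule DERIV_nonneg_limit_bound[of t "\<lambda>t. wkb t * (bes_theta t - bes t * wkb_slope t)"
        "\<lambda>t. wkb t * bes t / t * (\<nu>\<^sup>2 - t\<^sup>2 - (t * sd t + (wkb_slope t)\<^sup>2))"])
    fix x assume x: "0 < x" "x \<le> t"
    have dS: "(wkb_slope has_real_derivative sd x) (at x)"
      unfolding sd_def using x t by (intro wkb_slope_deriv) auto
    have dW: "(wkb has_real_derivative wkb x * wkb_slope x / x) (at x)"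
      using x t by (intro wkb_deriv) auto
    have "((\<lambda>t. wkb t * (bes_theta t - bes t * wkb_slope t)) has_real_derivative
        wkb x * wkb_slope x / x * (bes_theta x - bes x * wkb_slope x) +
        ((\<nu>\<^sup>2 - x\<^sup>2) * bes x / x - (bes_theta x / x * wkb_slope x + sd x * bes x)) * wkb x) (at x)"
      by (intro DERIV_mult DERIV_diff dW dS bes_theta_deriv bes_deriv x)
    also have "wkb x * wkb_slope x / x * (bes_theta x - bes x * wkb_slope x) +
        ((\<nu>\<^sup>2 - x\<^sup>2) * bes x / x - (bes_theta x / x * wkb_slope x + sd x * bes x)) * wkb x =
        wkb x * bes x / x * (\<nu>\<^sup>2 - x\<^sup>2 - (x * sd x + (wkb_slope x)\<^sup>2))"
      using x by (simp add: divide_simps) (simp add: algebra_simps power2_eq_square)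
    finally show "((\<lambda>t. wkb t * (bes_theta t - bes t * wkb_slope t)) has_real_derivative
        wkb x * bes x / x * (\<nu>\<^sup>2 - x\<^sup>2 - (x * sd x + (wkb_slope x)\<^sup>2))) (at x)" .
    \<comment> \<open>Since y decreases in t, the condition y^3 \<ge> 2 \<nu>^2 at the right end
      holds on the whole interval.\<close>
    have "wkb_y t ^ 3 \<le> wkb_y x ^ 3"
      using x t wkb_y_antimono[of x t] wkb_y_pos[of t] by (intro power_mono) auto
    then have "x * sd x + (wkb_slope x)\<^sup>2 \<le> \<nu>\<^sup>2 - x\<^sup>2"
      unfolding sd_def using x t y3 by (intro wkb_subsolution) auto
    then show "wkb x * bes x / x * (\<nu>\<^sup>2 - x\<^sup>2 - (x * sd x + (wkb_slope x)\<^sup>2)) \<ge> 0"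
      using x t wkb_pos[of x] bes_pos[of x]
      by (intro mult_nonneg_nonneg divide_nonneg_nonneg) auto
  next
    have "((\<lambda>t. wkb t * (bes_theta t - bes t * wkb_slope t)) \<longlongrightarrow> 0 * (0 - 0 * \<nu>)) (at_right 0)"
      by (intro tendsto_intros wkb_limit bes_theta_limit bes_limit wkb_slope_limit)
    then show "((\<lambda>t. wkb t * (bes_theta t - bes t * wkb_slope t)) \<longlongrightarrow> 0) (at_right 0)" by simp
  qed (use t in auto)
qed

text \<open>The quotient is (\<open>bes t\<close> / t^\<nu>) exp (-\<open>wkb_reg t\<close>), and
  the left-hand side is its limit at 0.\<close>

lemma bes_ge_wkb:
  assumes t: "0 < t" "t < \<nu>" and y3: "wkb_y t ^ 3 \<ge> 2 * \<nu>\<^sup>2"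
  shows "exp (- (\<nu> - \<nu> * ln (\<nu> + \<nu>) - ln \<nu> / 2 - \<nu>\<^sup>2 / (3 * \<nu> ^ 3))) \<le> bes t / wkb t"
proof (rule DERIV_nonneg_limit_bound[of t "\<lambda>t. bes t / wkb t"
      "\<lambda>t. wkb t * (bes_theta t - bes t * wkb_slope t) / (t * (wkb t)\<^sup>2)"])
  fix x assume x: "0 < x" "x \<le> t"
  have W: "wkb x > 0" using x by (intro wkb_pos)
  have dW: "(wkb has_real_derivative wkb x * wkb_slope x / x) (at x)"
    using x t by (intro wkb_deriv) auto
  have "((\<lambda>t. bes t / wkb t) has_real_derivative
      (bes_theta x / x * wkb x - bes x * (wkb x * wkb_slope x / x)) / (wkb x * wkb x)) (at x)"
    using W by (intro DERIV_divide dW bes_deriv x) auto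
  also have "(bes_theta x / x * wkb x - bes x * (wkb x * wkb_slope x / x)) / (wkb x * wkb x) =
      wkb x * (bes_theta x - bes x * wkb_slope x) / (x * (wkb x)\<^sup>2)"
    using W x by (simp add: field_simps power2_eq_square)
  finally show "((\<lambda>t. bes t / wkb t) has_real_derivative
      wkb x * (bes_theta x - bes x * wkb_slope x) / (x * (wkb x)\<^sup>2)) (at x)" .
  have "wkb_y t ^ 3 \<le> wkb_y x ^ 3"
    using x t wkb_y_antimono[of x t] wkb_y_pos[of t] by (intro power_mono) auto
  then have "wkb x * (bes_theta x - bes x * wkb_slope x) \<ge> 0"
    using x t y3 by (intro bes_wronskian_nonneg) auto
  then show "wkb x * (bes_theta x - bes x * wkb_slope x) / (x * (wkb x)\<^sup>2) \<ge> 0"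
    using x by simp
next
  have "((\<lambda>t. bes t / t powr \<nu> * exp (- wkb_reg t)) \<longlongrightarrow>
      1 * exp (- (\<nu> - \<nu> * ln (\<nu> + \<nu>) - ln \<nu> / 2 - \<nu>\<^sup>2 / (3 * \<nu> ^ 3)))) (at_right 0)"
    by (intro tendsto_intros bes_ratio_limit wkb_reg_limit)
  then have "((\<lambda>t. bes t / t powr \<nu> * exp (- wkb_reg t)) \<longlongrightarrow>
      exp (- (\<nu> - \<nu> * ln (\<nu> + \<nu>) - ln \<nu> / 2 - \<nu>\<^sup>2 / (3 * \<nu> ^ 3)))) (at_right 0)"
    by (simp only: mult_1)
  moreover have "\<forall>\<^sub>F t in at_right 0. bes t / t powr \<nu> * exp (- wkb_reg t) = bes t / wkb t"
    by (intro always_eventually allI) (simp add: wkb_def exp_minus field_simps)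
  ultimately show "((\<lambda>t. bes t / wkb t) \<longlongrightarrow>
      exp (- (\<nu> - \<nu> * ln (\<nu> + \<nu>) - ln \<nu> / 2 - \<nu>\<^sup>2 / (3 * \<nu> ^ 3)))) (at_right 0)"
    by (rule Lim_transform_eventually)
qed (use t in auto)

end

section \<open>The Bessel function on the diagonal\<close>

lemma inverse_sum_1_plus_minus:
  assumes "-1 < x" "x < (1::real)"
  shows "1 / (1 + x) + 1 / (1 - x) = 2 / (1 - x\<^sup>2)"
proof -
  have "1 / (1 + x) + 1 / (1 - x) = (1 * (1 - x) + 1 * (1 + x)) / ((1 + x) * (1 - x))"
    by (rule add_frac_eq) (use assms in auto)
  also have "(1 + x) * (1 - x) = 1 - x\<^sup>2" by (simp add: power2_eq_square algebra_simps)
  finally show ?thesis by simp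
qed

lemma ln_ratio_lower:
  assumes "0 \<le> u" "u < 1"
  shows "2 * u \<le> ln (1 + u) - ln (1 - u :: real)"
proof -
  define h where "h u = ln (1 + u) - ln (1 - u) - 2 * u" for u :: real
  have "h 0 \<le> h u"
  proof (rule DERIV_nonneg_imp_nondecreasing[of 0 u h])
    fix x assume x: "0 \<le> x" "x \<le> u"
    have "(h has_real_derivative 1 / (1 + x) + 1 / (1 - x) - 2) (at x)"
      unfolding h_def[abs_def] using x assms by (auto intro!: derivative_eq_intros)
    moreover have "1 / (1 + x) + 1 / (1 - x) - 2 \<ge> 0"
    proof -
      have "x\<^sup>2 < 1" using x assms by (simp add: power_less_one_iff abs_square_less_1)
      then have "2 \<le> 2 / (1 - x\<^sup>2)" by (simp add: le_divide_eq)
      then show ?thesis using inverse_sum_1_plus_minus[of x] x assms by simp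
    qed
    ultimately show "\<exists>y. (h has_real_derivative y) (at x) \<and> 0 \<le> y" by metis
  qed (use assms in auto)
  then show ?thesis by (simp add: h_def)
qed

text \<open>Twice the bound artanh u \<le> u + u^3. Comparing derivatives requires 1/(1 - x^2) \<le>
  1 + 3 x^2, which the range up to 1/2 ensures.\<close>

lemma ln_ratio_upper:
  assumes "0 \<le> u" "u \<le> 1/2"
  shows "ln (1 + u) - ln (1 - u :: real) \<le> 2 * (u + u ^ 3)"
proof -
  define h where "h u = 2 * (u + u ^ 3) - ln (1 + u) + ln (1 - u)" for u :: real
  have "h 0 \<le> h u"
  proof (rule DERIV_nonneg_imp_nondecreasing[of 0 u h])
    fix x assume x: "0 \<le> x" "x \<le> u"
    have "(h has_real_derivative 2 * (1 + 3 * x\<^sup>2) - 1 / (1 + x) - 1 / (1 - x)) (at x)"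
      unfolding h_def[abs_def] using x assms by (auto intro!: derivative_eq_intros)
    moreover have "2 * (1 + 3 * x\<^sup>2) - 1 / (1 + x) - 1 / (1 - x) \<ge> 0"
    proof -
      have x2: "x\<^sup>2 \<le> 1/4" using power_mono[of x "1/2" 2] x assms by (simp add: power2_eq_square)
      then have "x\<^sup>2 * x\<^sup>2 \<le> 1/4 * x\<^sup>2" by (intro mult_right_mono) auto
      moreover have "2 * (1 + 3 * x\<^sup>2) * (1 - x\<^sup>2) = 2 + 4 * x\<^sup>2 - 6 * (x\<^sup>2 * x\<^sup>2)"
        by (simp add: algebra_simps)
      ultimately have "2 \<le> 2 * (1 + 3 * x\<^sup>2) * (1 - x\<^sup>2)" using zero_le_power2[of x] by linarith
      then have "2 / (1 - x\<^sup>2) \<le> 2 * (1 + 3 * x\<^sup>2)" using x2 by (simp add: divide_le_eq)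
      then show ?thesis using inverse_sum_1_plus_minus[of x] x assms by simp
    qed
    ultimately show "\<exists>y. (h has_real_derivative y) (at x) \<and> 0 \<le> y" by metis
  qed (use assms in auto)
  then show ?thesis by (simp add: h_def)
qed

text \<open>The defect \<open>g\<close> does not increase under x -> x + 1, because (x + 1/2) (ln (x
  + 1) - ln x) \<ge> 1. Hence an upper bound for it on the compact interval [1, 2] holds for all x
  \<ge> 1.\<close>

lemma Gamma_stirling_upper:
  "\<exists>C>0. \<forall>x\<ge>1. Gamma (x + 1) \<le> C * exp (x * ln x + ln x / 2 - (x::real))"
proof -
  define g where "g x = ln (Gamma (x + 1)) - (x * ln x + ln x / 2 - x)" for x :: real
  have "continuous_on {1..2} g"
  proof -
    have "Gamma (x + 1) \<noteq> 0" if "x \<in> {1..2}" for x :: real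
      using that Gamma_real_pos[of "x + 1", THEN less_imp_neq] by auto
    moreover have "continuous_on {1..2} (\<lambda>x::real. Gamma (x + 1))"
    proof (rule continuous_on_compose2[of "{2..3}" Gamma])
      have "x \<notin> \<int>\<^sub>\<le>\<^sub>0" if "x \<in> {2..3}" for x :: real
        using that by (intro pos_notin_nonpos_Ints) simp
      then show "continuous_on {2..3} (Gamma :: real \<Rightarrow> real)"
        by (intro continuous_on_Gamma) blast
    qed (auto intro!: continuous_intros)
    ultimately show ?thesis unfolding g_def by (intro continuous_intros) auto
  qed
  then have "compact (g ` {1..2})" by (intro compact_continuous_image) auto
  then obtain M where M: "\<And>x. x \<in> {1..2} \<Longrightarrow> \<bar>g x\<bar> \<le> M"
    using compact_imp_bounded bounded_iff by (metis imageI real_norm_def)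
  have step: "g (x + 1) \<le> g x" if "x \<ge> 1" for x
  proof -
    \<comment> \<open>Chosen so that (1 + u)/(1 - u) = (x + 1)/x and (x + 1/2) 2 u = 1.\<close>
    define u where "u = 1 / (2 * x + 1)"
    have u: "0 \<le> u" "u < 1" using that by (auto simp: u_def)
    have u0: "u > 0" using that by (simp add: u_def)
    have e: "1 + u = (x + 1) * (2 * u)" "1 - u = x * (2 * u)"
      using that by (auto simp: u_def field_simps)
    have "ln (1 + u) - ln (1 - u) = ln (x + 1) - ln x"
      unfolding e using that u0 by (subst (1 2) ln_mult) auto
    then have "2 * u \<le> ln (x + 1) - ln x" using ln_ratio_lower[OF u] by simp
    then have "(x + 1/2) * (2 * u) \<le> (x + 1/2) * (ln (x + 1) - ln x)"
      using that by (intro mult_left_mono) auto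
    moreover have "(x + 1/2) * (2 * u) = 1" using that by (simp add: u_def field_simps)
    ultimately have key: "1 \<le> (x + 1/2) * (ln (x + 1) - ln x)" by simp
    have "ln (Gamma (x + 1 + 1)) = ln (x + 1) + ln (Gamma (x + 1))"
    proof -
      have "Gamma (x + 1) > 0" "x + 1 > 0" using that by auto
      then show ?thesis using Gamma_plus1_real[of "x + 1"] ln_mult_pos[of "x + 1" "Gamma (x + 1)"]
        by (simp only:)
    qed
    then show ?thesis using key by (simp add: g_def algebra_simps add_divide_distrib)
  qed
  have shift: "g (x + real n) \<le> M" if "x \<in> {1..2}" for x n
  proof (induction n)
    case 0
    then show ?case using M[OF that] by simp
  next
    case (Suc n)
    have "g (x + real (Suc n)) \<le> g (x + real n)"
      using step[of "x + real n"] that by (simp add: add_ac)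
    with Suc show ?case by simp
  qed
  have "Gamma (x + 1) \<le> exp M * exp (x * ln x + ln x / 2 - x)" if "x \<ge> 1" for x :: real
  proof -
    define n where "n = nat \<lfloor>x - 1\<rfloor>"
    have "real n = of_int \<lfloor>x - 1\<rfloor>" using that by (simp add: n_def)
    then have "x - real n \<in> {1..2}" by (simp; linarith)
    from shift[OF this, of n] have "g x \<le> M" by simp
    then have "ln (Gamma (x + 1)) \<le> M + (x * ln x + ln x / 2 - x)" by (simp add: g_def)
    then have "exp (ln (Gamma (x + 1))) \<le> exp (M + (x * ln x + ln x / 2 - x))" by simp
    then show ?thesis using that by (simp only: exp_add) simp
  qed
  then show ?thesis by (intro exI[of _ "exp M"]) auto
qed

text \<open>Evaluated where y^3 = 2 \<nu>^2. The constant -13/6 is -2 - 1/6: with u = y/\<nu>, the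
  -2 comes from artanh u \<le> u + u^3, as \<nu> u^3 = y^3/\<nu>^2 = 2, and the -1/6 from the
  correction \<nu>^2/(3 y^3). The terms ln 2/6 + ln \<nu>/3 are ln y/2.\<close>

lemma bes_diagonal_lower:
  assumes \<nu>: "\<nu> \<ge> 16"
  shows "bes \<nu> \<nu> \<ge> exp (- 13/6 - ln 2 / 6 - ln \<nu> / 3) * exp (\<nu> * ln 2) * exp (\<nu> * ln \<nu> + ln \<nu> / 2 - \<nu>)"
proof -
  have \<nu>0: "\<nu> > 0" using \<nu> by simp
  define y where "y = (2 * \<nu>\<^sup>2) powr (1/3)"
  have y0: "y > 0" using \<nu> by (simp add: y_def)
  have "y ^ 3 = y powr 3" using y0 powr_realpow[of y 3] by simp
  also have "\<dots> = 2 * \<nu>\<^sup>2" using \<nu>0 by (simp add: y_def powr_powr)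
  finally have y3: "y ^ 3 = 2 * \<nu>\<^sup>2" .
  \<comment> \<open>Here \<nu> \<ge> 16 enters: it gives (\<nu>/2)^3 \<ge> 2 \<nu>^2 = y^3, so that
    u \<le> 1/2 below.\<close>
  have yle: "y \<le> \<nu> / 2"
  proof (rule ccontr)
    assume "\<not> y \<le> \<nu> / 2"
    then have "(\<nu> / 2) ^ 3 < y ^ 3" using \<nu>0 by (intro power_strict_mono) auto
    moreover have "(\<nu> / 2) ^ 3 = \<nu> * \<nu>\<^sup>2 / 8" by (simp add: power3_eq_cube power2_eq_square)
    moreover have "16 * \<nu>\<^sup>2 \<le> \<nu> * \<nu>\<^sup>2" using \<nu> by (intro mult_right_mono) auto
    ultimately show False using y3 by linarith
  qed
  define t where "t = sqrt (\<nu>\<^sup>2 - y\<^sup>2)"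
  have "y < \<nu>" using yle \<nu> by simp
  then have pos: "\<nu>\<^sup>2 - y\<^sup>2 > 0" using y0 by (simp add: power_strict_mono)
  have t0: "t > 0" using pos by (simp add: t_def)
  have tsq: "t\<^sup>2 = \<nu>\<^sup>2 - y\<^sup>2" using pos by (simp add: t_def)
  have "y\<^sup>2 > 0" using y0 by simp
  then have "t\<^sup>2 < \<nu>\<^sup>2" using tsq by linarith
  then have tlt: "t < \<nu>" by (rule power2_less_imp_less) (use \<nu>0 in simp)
  have ywkb: "wkb_y \<nu> t = y" using y0 by (simp add: wkb_y_def[OF \<nu>0] tsq)
  have lnt: "ln t = (ln (\<nu> - y) + ln (\<nu> + y)) / 2"
  proof -
    have "2 * ln t = ln (t\<^sup>2)" using t0 by (simp add: ln_realpow)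
    also have "t\<^sup>2 = (\<nu> - y) * (\<nu> + y)" unfolding tsq by (simp add: power2_eq_square algebra_simps)
    also have "ln \<dots> = ln (\<nu> - y) + ln (\<nu> + y)" using \<open>y < \<nu>\<close> y0 by (intro ln_mult_pos) auto
    finally show ?thesis by simp
  qed
  define u where "u = y / \<nu>"
  have u: "0 \<le> u" "u \<le> 1/2" using y0 \<nu>0 yle by (auto simp: u_def field_simps)
  have "\<nu> + y = \<nu> * (1 + u)" "\<nu> - y = \<nu> * (1 - u)" using \<nu>0 by (auto simp: u_def field_simps)
  then have "ln (\<nu> + y) - ln (\<nu> - y) = ln (1 + u) - ln (1 - u)"
    using \<nu>0 u by (simp add: ln_mult)
  then have "ln (\<nu> + y) - ln (\<nu> - y) \<le> 2 * (u + u ^ 3)" using ln_ratio_upper[OF u] by simp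
  then have "\<nu> / 2 * (ln (\<nu> + y) - ln (\<nu> - y)) \<le> \<nu> / 2 * (2 * (u + u ^ 3))"
    using \<nu>0 by (intro mult_left_mono) auto
  also have "\<nu> / 2 * (2 * (u + u ^ 3)) = y + y ^ 3 / \<nu>\<^sup>2"
    using \<nu>0 by (simp add: u_def power_divide power2_eq_square power3_eq_cube distrib_left)
  also have "\<dots> = y + 2" using \<nu>0 by (simp add: y3)
  finally have artanh: "\<nu> * ln t - \<nu> * ln (\<nu> + y) + y \<ge> - 2"
    by (simp add: lnt algebra_simps add_divide_distrib)
  have lny: "ln y = (ln 2 + 2 * ln \<nu>) / 3"
    using \<nu>0 by (simp add: y_def ln_powr ln_mult ln_realpow)
  have frac: "\<nu>\<^sup>2 / (3 * y ^ 3) = 1/6" using \<nu>0 by (simp add: y3)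
  define K where "K = \<nu> - \<nu> * ln (\<nu> + \<nu>) - ln \<nu> / 2 - \<nu>\<^sup>2 / (3 * \<nu> ^ 3)"
  have "exp (- K) \<le> bes \<nu> t / wkb \<nu> t"
    unfolding K_def using \<nu>0 t0 tlt by (intro bes_ge_wkb) (auto simp: ywkb y3)
  then have "exp (- K) * wkb \<nu> t \<le> bes \<nu> t"
    using wkb_pos[OF \<nu>0 t0] by (simp only: pos_le_divide_eq)
  \<comment> \<open>The comparison with \<open>wkb\<close> stops short of the turning point;
    monotonicity bridges the gap from t to \<nu>.\<close>
  also have "\<dots> \<le> bes \<nu> \<nu>" using \<nu>0 t0 tlt by (intro bes_mono) auto
  finally have 1: "exp (- K) * wkb \<nu> t \<le> bes \<nu> \<nu>" .
  have "wkb \<nu> t = exp (\<nu> * ln t + (y - \<nu> * ln (\<nu> + y) - ln y / 2 - 1/6))"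
    using t0 by (simp add: wkb_def[OF \<nu>0] wkb_reg_def[OF \<nu>0] ywkb frac powr_def exp_add)
  also have "exp (- K) * \<dots> = exp (- K + (\<nu> * ln t + (y - \<nu> * ln (\<nu> + y) - ln y / 2 - 1/6)))"
    by (rule exp_add[symmetric])
  finally have 2: "exp (- K) * wkb \<nu> t = exp (- K + (\<nu> * ln t + (y - \<nu> * ln (\<nu> + y) - ln y / 2 - 1/6)))" .
  have "ln (\<nu> + \<nu>) = ln 2 + ln \<nu>" using \<nu>0 ln_mult[of 2 \<nu>] by simp
  then have "- K = \<nu>\<^sup>2 / (3 * \<nu> ^ 3) + (\<nu> * ln 2 + \<nu> * ln \<nu>) + ln \<nu> / 2 - \<nu>"
    by (simp add: K_def distrib_left)
  moreover have "\<nu>\<^sup>2 / (3 * \<nu> ^ 3) \<ge> 0" using \<nu>0 by simp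
  ultimately have "- 13/6 - ln 2 / 6 - ln \<nu> / 3 + \<nu> * ln 2 + (\<nu> * ln \<nu> + ln \<nu> / 2 - \<nu>) \<le>
      - K + (\<nu> * ln t + (y - \<nu> * ln (\<nu> + y) - ln y / 2 - 1/6))"
    using artanh unfolding lny by (simp add: add_divide_distrib)
  then have "exp (- 13/6 - ln 2 / 6 - ln \<nu> / 3 + \<nu> * ln 2 + (\<nu> * ln \<nu> + ln \<nu> / 2 - \<nu>)) \<le> bes \<nu> \<nu>"
    using 1 unfolding 2 by (meson exp_le_cancel_iff order_trans)
  then show ?thesis by (simp only: exp_add)
qed

text \<open>The factors 2^\<nu> and \<nu>^\<nu> sqrt \<nu> exp (-\<nu>) in the bound for
  \<open>bes\<close> are those that the normalisation by 2^\<nu> and Stirling's bound for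
  \<Gamma>(\<nu> + 1) remove; \<nu>^(-1/3) remains.\<close>

lemma bessel_J_diagonal_lower:
  "\<exists>c>0. \<forall>\<nu>\<ge>16. bessel_J \<nu> \<nu> \<ge> c * \<nu> powr (-1/3)"
proof -
  from Gamma_stirling_upper obtain C where C0: "C > 0"
    and "\<forall>x\<ge>1. Gamma (x + 1) \<le> C * exp (x * ln x + ln x / 2 - (x::real))"
    by (elim exE conjE)
  then have C: "Gamma (x + 1) \<le> C * exp (x * ln x + ln x / 2 - x)" if "x \<ge> 1" for x :: real
    using that by simp
  define c where "c = exp (- 13/6 - ln 2 / 6) / C"
  have "bessel_J \<nu> \<nu> \<ge> c * \<nu> powr (-1/3)" if \<nu>: "\<nu> \<ge> 16" for \<nu> :: real
  proof -
    have \<nu>0: "\<nu> > 0" using \<nu> by simp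
    define E where "E = exp (\<nu> * ln \<nu> + ln \<nu> / 2 - \<nu>)"
    have G: "0 < Gamma (\<nu> + 1)" "Gamma (\<nu> + 1) \<le> C * E" using C[of \<nu>] \<nu> by (auto simp: E_def)
    define X where "X = exp (- 13/6 - ln 2 / 6 - ln \<nu> / 3)"
    have X: "X > 0" by (simp add: X_def)
    have "exp (- 13/6 - ln 2 / 6) * \<nu> powr (-1/3) = X"
      using \<nu>0 by (simp add: X_def powr_def exp_add[symmetric])
    then have "c * \<nu> powr (-1/3) = X * E / (C * E)" by (simp add: c_def E_def)
    moreover have "X * E / (C * E) \<le> X * E / Gamma (\<nu> + 1)"
    proof (rule divide_left_mono[OF G(2)])
      show "0 \<le> X * E" using X by (simp add: E_def)
      show "0 < C * E * Gamma (\<nu> + 1)" using C0 G(1) by (simp add: E_def)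
    qed
    moreover have "X * E / Gamma (\<nu> + 1) \<le> bes \<nu> \<nu> * 2 powr (- \<nu>) / Gamma (\<nu> + 1)"
    proof -
      have e: "X * exp (\<nu> * ln 2) * E * 2 powr (- \<nu>) = X * E"
        by (simp add: powr_def exp_minus)
      have "X * exp (\<nu> * ln 2) * E \<le> bes \<nu> \<nu>"
        using bes_diagonal_lower[OF \<nu>] by (simp only: E_def X_def)
      then have "X * exp (\<nu> * ln 2) * E * 2 powr (- \<nu>) \<le> bes \<nu> \<nu> * 2 powr (- \<nu>)"
        by (rule mult_right_mono) (rule powr_ge_zero)
      then show ?thesis unfolding e by (rule divide_right_mono) (rule less_imp_le[OF G(1)])
    qed
    moreover have "bes \<nu> \<nu> * 2 powr (- \<nu>) / Gamma (\<nu> + 1) = bessel_J \<nu> \<nu>"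
    proof -
      have "(\<nu> / 2) powr \<nu> = \<nu> powr \<nu> / 2 powr \<nu>" using \<nu>0 by (simp add: powr_divide)
      then have e: "(\<nu> / 2) powr \<nu> = \<nu> powr \<nu> * 2 powr (- \<nu>)"
        by (simp only: powr_minus divide_inverse)
      have "\<nu> \<ge> -1/2" using \<nu> by simp
      from bessel_J_eq[OF this \<nu>0] show ?thesis
        unfolding bes_def[OF \<nu>0] frobenius_series_def e by (simp only: times_divide_eq_left mult_ac)
    qed
    ultimately show ?thesis by linarith
  qed
  moreover have "c > 0" using C0 by (simp add: c_def)
  ultimately show ?thesis by (intro exI[of _ c] conjI allI impI)
qed

text \<open>For fixed A the limit over n is at least c A^(1/2 - 1/3) = c A^(1/6). Halving c leaves
  room for a strict inequality, which then holds for all large n, so n can also be taken beyond (2 A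
  + 1)^3. The last conjunct follows since 3/12 = 1/4.\<close>

lemma jacobi_F_bessel_peak:
  "\<exists>c>0. \<forall>\<^sub>F A::real in at_top. \<exists>n::nat.
        real n + 1 \<ge> (2 * A + 1) ^ 3 \<and>
        jacobi_F n A A (cos (A / real n)) \<ge> c * A powr (1/6) \<and>
        (2 * A + 1) powr (1/4) * (real n + 1) powr (-1/12) \<le> 1"
proof -
  obtain c where c: "c > 0" "\<And>\<nu>. \<nu> \<ge> 16 \<Longrightarrow> bessel_J \<nu> \<nu> \<ge> c * \<nu> powr (-1/3)"
    using bessel_J_diagonal_lower by blast
  have "\<exists>n::nat. real n + 1 \<ge> (2 * A + 1) ^ 3 \<and>
        jacobi_F n A A (cos (A / real n)) \<ge> c / 2 * A powr (1/6) \<and>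
        (2 * A + 1) powr (1/4) * (real n + 1) powr (-1/12) \<le> 1" if A: "A \<ge> 16" for A
  proof -
    have "A powr (1/2) * A powr (-1/3) = A powr (1/6)" by (simp flip: powr_add)
    then have "c * A powr (1/6) = sqrt A * (c * A powr (-1/3))"
      using A by (simp add: powr_half_sqrt mult_ac)
    also have "\<dots> \<le> sqrt A * \<bar>bessel_J A A\<bar>"
      using c(2)[OF A] A by (intro mult_left_mono) auto
    finally have "c * A powr (1/6) \<le> sqrt A * \<bar>bessel_J A A\<bar>" .
    moreover have "c * A powr (1/6) > 0" using c(1) A by simp
    ultimately have "c / 2 * A powr (1/6) < sqrt A * \<bar>bessel_J A A\<bar>" by simp
    moreover have "(\<lambda>n. jacobi_F n A A (cos (A / real n))) \<longlonglongrightarrow> sqrt A * \<bar>bessel_J A A\<bar>"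
      using A by (intro jacobi_F_mehler_heine) auto
    ultimately have "\<forall>\<^sub>F n in sequentially. c / 2 * A powr (1/6) < jacobi_F n A A (cos (A / real n))"
      by (rule order_tendstoD(1)[rotated])
    moreover have "\<forall>\<^sub>F n in sequentially. (2 * A + 1) ^ 3 \<le> real n"
      using filterlim_real_sequentially by (auto simp: filterlim_at_top)
    ultimately have "\<forall>\<^sub>F n in sequentially. c / 2 * A powr (1/6) < jacobi_F n A A (cos (A / real n)) \<and>
        (2 * A + 1) ^ 3 \<le> real n" by (rule eventually_conj)
    then obtain n where n: "c / 2 * A powr (1/6) < jacobi_F n A A (cos (A / real n))"
        "(2 * A + 1) ^ 3 \<le> real n"
      using eventually_happens'[OF sequentially_bot] by blast
    have "(real n + 1) powr (-1/12) \<le> ((2 * A + 1) ^ 3) powr (-1/12)"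
      using n(2) A by (intro powr_mono2') auto
    also have "\<dots> = (2 * A + 1) powr (-1/4)"
      using A powr_realpow[of "2 * A + 1" 3] powr_powr[of "2 * A + 1" 3 "-1/12"] by simp
    finally have "(2 * A + 1) powr (1/4) * (real n + 1) powr (-1/12) \<le>
        (2 * A + 1) powr (1/4) * (2 * A + 1) powr (-1/4)"
      by (intro mult_left_mono) auto
    also have "\<dots> = 1" using A by (simp flip: powr_add)
    finally show ?thesis using n by (intro exI[of _ n]) auto
  qed
  then have "\<forall>\<^sub>F A in at_top. \<exists>n::nat. real n + 1 \<ge> (2 * A + 1) ^ 3 \<and>
        jacobi_F n A A (cos (A / real n)) \<ge> c / 2 * A powr (1/6) \<and>
        (2 * A + 1) powr (1/4) * (real n + 1) powr (-1/12) \<le> 1"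
    by (rule eventually_mono[OF eventually_ge_at_top[of 16]])
  then show ?thesis using c(1) by (intro exI[of _ "c / 2"]) auto
qed

text \<open>Along the Bessel peaks the maximum on the right is 1, so C would have to dominate c
  A^(1/6) for all large A.\<close>

lemma jacobi_F_no_bound_without_sixth_root:
  "\<not> (\<exists>C::real. \<forall>n::nat. \<forall>\<alpha>\<ge>-1/2. \<forall>\<beta>\<ge>-1/2. \<forall>x\<in>{-1..1}.
          jacobi_F n \<alpha> \<beta> x
            \<le> C * max 1 ((\<alpha> + \<beta> + 1) powr (1/4) * (real n + 1) powr (-1/12)))"
proof
  assume "\<exists>C::real. \<forall>n::nat. \<forall>\<alpha>\<ge>-1/2. \<forall>\<beta>\<ge>-1/2. \<forall>x\<in>{-1..1}.
          jacobi_F n \<alpha> \<beta> x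
            \<le> C * max 1 ((\<alpha> + \<beta> + 1) powr (1/4) * (real n + 1) powr (-1/12))"
  then obtain C where C: "\<And>n \<alpha> \<beta> x. \<lbrakk>\<alpha> \<ge> -1/2; \<beta> \<ge> -1/2; x \<in> {-1..1}\<rbrakk> \<Longrightarrow>
      jacobi_F n \<alpha> \<beta> x \<le> C * max 1 ((\<alpha> + \<beta> + 1) powr (1/4) * (real n + 1) powr (-1/12))"
    by blast
  obtain c where c: "c > 0" and ev: "\<forall>\<^sub>F A::real in at_top. \<exists>n::nat.
        real n + 1 \<ge> (2 * A + 1) ^ 3 \<and>
        jacobi_F n A A (cos (A / real n)) \<ge> c * A powr (1/6) \<and>
        (2 * A + 1) powr (1/4) * (real n + 1) powr (-1/12) \<le> 1"
    using jacobi_F_bessel_peak by blast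
  have "filterlim (\<lambda>A::real. c * A powr (1/6)) at_top at_top" using c by real_asymp
  then have "\<forall>\<^sub>F A in at_top. C < c * A powr (1/6)" by (simp add: filterlim_at_top_dense)
  with ev eventually_ge_at_top[of 0]
  have "\<forall>\<^sub>F A in at_top. (\<exists>n::nat. real n + 1 \<ge> (2 * A + 1) ^ 3 \<and>
        jacobi_F n A A (cos (A / real n)) \<ge> c * A powr (1/6) \<and>
        (2 * A + 1) powr (1/4) * (real n + 1) powr (-1/12) \<le> 1) \<and> C < c * A powr (1/6) \<and> 0 \<le> A"
    by eventually_elim auto
  then obtain A n where A: "0 \<le> A" "C < c * A powr (1/6)"
      "jacobi_F n A A (cos (A / real n)) \<ge> c * A powr (1/6)"
      "(2 * A + 1) powr (1/4) * (real n + 1) powr (-1/12) \<le> 1"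
    using eventually_happens'[OF trivial_limit_at_top_linorder] by blast
  have "A + A + 1 = 2 * A + 1" by simp
  then have "max 1 ((A + A + 1) powr (1/4) * (real n + 1) powr (-1/12)) = 1"
    using A(4) by (simp only: max_absorb1)
  then have "jacobi_F n A A (cos (A / real n)) \<le> C"
    using C[of A A "cos (A / real n)" n] A(1) by simp
  with A show False by simp
qed

theorem theorem1p3:
  shows
   "((\<forall>n::nat. \<forall>\<theta>\<in>{0..pi}.
        jacobi_F n (1/2) (-1/2) (cos \<theta>) = sqrt (2/pi) * \<bar>sin ((real n + 1/2) * \<theta>)\<bar> \<and>
        jacobi_F n (-1/2) (1/2) (cos \<theta>) = sqrt (2/pi) * \<bar>cos ((real n + 1/2) * \<theta>)\<bar> \<and>
        jacobi_F n (1/2) (1/2) (cos \<theta>) = sqrt (2/pi) * \<bar>sin ((real n + 1) * \<theta>)\<bar> \<and>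
        (n \<ge> 1 \<longrightarrow> jacobi_F n (-1/2) (-1/2) (cos \<theta>) = sqrt (2/pi) * \<bar>cos (real n * \<theta>)\<bar>)) \<and>
     (\<forall>x\<in>{-1..1}. jacobi_F 0 (-1/2) (-1/2) x = pi powr (-1/2)) \<and>
     (\<forall>n::nat. \<forall>\<alpha>\<in>{-1/2, 1/2}. \<forall>\<beta>\<in>{-1/2, 1/2}.
        (n, \<alpha>, \<beta>) \<noteq> (0, -1/2, -1/2) \<longrightarrow>
          (\<exists>x\<in>{-1..1}. jacobi_F n \<alpha> \<beta> x = sqrt (2/pi)) \<and>
          (\<forall>x\<in>{-1..1}. jacobi_F n \<alpha> \<beta> x \<le> sqrt (2/pi))) \<and>
     (\<forall>C::real.
        (\<forall>n::nat. \<forall>\<alpha>\<ge>-1/2. \<forall>\<beta>\<ge>-1/2. \<forall>x\<in>{-1..1}.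
           jacobi_F n \<alpha> \<beta> x \<le> C * E_bound n (\<alpha> + \<beta> + 1)) \<or>
        (\<forall>n::nat. \<forall>\<alpha>\<ge>-1/2. \<forall>\<beta>\<ge>-1/2. \<forall>x\<in>{-1..1}.
           jacobi_F n \<alpha> \<beta> x \<le> C * max 1 ((\<alpha> + \<beta> + 1) powr (1/4))) \<longrightarrow>
        C \<ge> sqrt (2/pi)))
    \<and>
    ((\<forall>n::nat. \<forall>\<alpha>\<ge>-1/2. (n, \<alpha>) \<noteq> (0, -1/2) \<longrightarrow>
        (jacobi_F n \<alpha> (-1/2) (-1))\<^sup>2 =
          (2 * real n + \<alpha> + 1/2) * Gamma (real n + 1/2) * Gamma (real n + \<alpha> + 1/2)
            / (pi * Gamma (real n + 1) * Gamma (real n + \<alpha> + 1))) \<and>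
     ((\<lambda>\<alpha>::real. (2 * real 0 + \<alpha> + 1/2) * Gamma (real 0 + 1/2) * Gamma (real 0 + \<alpha> + 1/2)
            / (pi * Gamma (real 0 + 1) * Gamma (real 0 + \<alpha> + 1)))
        \<longlongrightarrow> 1/pi) (at_right (-1/2)) \<and>
     (jacobi_F 0 (-1/2) (-1/2) (-1))\<^sup>2 = 1/pi \<and>
     (\<forall>n::nat.
        (\<lambda>\<alpha>. jacobi_F n \<alpha> (-1/2) (-1)) \<sim>[at_top]
        (\<lambda>\<alpha>. (Gamma (real n + 1/2) / (pi * Gamma (real n + 1))) powr (1/2) * \<alpha> powr (1/4))) \<and>
     (\<forall>n::nat. \<forall>\<gamma><1/4.
        \<not> (\<exists>C::real. \<forall>\<alpha>\<ge>-1/2. \<forall>\<beta>\<ge>-1/2. \<forall>x\<in>{-1..1}.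
              jacobi_F n \<alpha> \<beta> x \<le> C * max 1 ((\<alpha> + \<beta> + 1) powr \<gamma>))))
    \<and>
    ((\<forall>A\<ge>-1/2. \<forall>z>0.
        (\<lambda>n::nat. jacobi_F n A A (cos (z / real n))) \<longlonglongrightarrow> sqrt z * \<bar>bessel_J A z\<bar>) \<and>
     (\<exists>c>0. \<forall>\<^sub>F A::real in at_top. \<exists>n::nat.
        real n + 1 \<ge> (2 * A + 1) ^ 3 \<and>
        jacobi_F n A A (cos (A / real n)) \<ge> c * A powr (1/6) \<and>
        (2 * A + 1) powr (1/4) * (real n + 1) powr (-1/12) \<le> 1) \<and>
     \<not> (\<exists>C::real. \<forall>n::nat. \<forall>\<alpha>\<ge>-1/2. \<forall>\<beta>\<ge>-1/2. \<forall>x\<in>{-1..1}.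
          jacobi_F n \<alpha> \<beta> x
            \<le> C * max 1 ((\<alpha> + \<beta> + 1) powr (1/4) * (real n + 1) powr (-1/12))))"
proof (intro conjI)
  show "\<forall>n::nat. \<forall>\<theta>\<in>{0..pi}.
        jacobi_F n (1/2) (-1/2) (cos \<theta>) = sqrt (2/pi) * \<bar>sin ((real n + 1/2) * \<theta>)\<bar> \<and>
        jacobi_F n (-1/2) (1/2) (cos \<theta>) = sqrt (2/pi) * \<bar>cos ((real n + 1/2) * \<theta>)\<bar> \<and>
        jacobi_F n (1/2) (1/2) (cos \<theta>) = sqrt (2/pi) * \<bar>sin ((real n + 1) * \<theta>)\<bar> \<and>
        (n \<ge> 1 \<longrightarrow> jacobi_F n (-1/2) (-1/2) (cos \<theta>) = sqrt (2/pi) * \<bar>cos (real n * \<theta>)\<bar>)"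
  proof (intro allI ballI conjI impI)
    fix n :: nat and \<theta> :: real
    assume \<theta>: "\<theta> \<in> {0..pi}"
    show "jacobi_F n (1/2) (-1/2) (cos \<theta>) = sqrt (2/pi) * \<bar>sin ((real n + 1/2) * \<theta>)\<bar>"
      by (rule jacobi_F_half_minus_half[OF \<theta>])
    show "jacobi_F n (-1/2) (1/2) (cos \<theta>) = sqrt (2/pi) * \<bar>cos ((real n + 1/2) * \<theta>)\<bar>"
      by (rule jacobi_F_minus_half_half[OF \<theta>])
    show "jacobi_F n (1/2) (1/2) (cos \<theta>) = sqrt (2/pi) * \<bar>sin ((real n + 1) * \<theta>)\<bar>"
      by (rule jacobi_F_half_half[OF \<theta>])
    assume "n \<ge> 1"
    then show "jacobi_F n (-1/2) (-1/2) (cos \<theta>) = sqrt (2/pi) * \<bar>cos (real n * \<theta>)\<bar>"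
      using jacobi_F_minus_half_minus_half[OF \<theta>, of n] by simp
  qed
  show "\<forall>x\<in>{-1..1}. jacobi_F 0 (-1/2) (-1/2) x = pi powr (-1/2)"
  proof
    fix x :: real assume "x \<in> {-1..1}"
    then obtain \<theta> where "\<theta> \<in> {0..pi}" "x = cos \<theta>" using cos_arccos_range by blast
    moreover have "pi powr (-1/2) = 1 / sqrt pi"
      using powr_minus[of pi "1/2"] by (simp add: powr_half_sqrt inverse_eq_divide)
    ultimately show "jacobi_F 0 (-1/2) (-1/2) x = pi powr (-1/2)"
      using jacobi_F_minus_half_minus_half[of \<theta> 0] by simp
  qed
  show "\<forall>n::nat. \<forall>\<alpha>\<in>{-1/2, 1/2}. \<forall>\<beta>\<in>{-1/2, 1/2}.
        (n, \<alpha>, \<beta>) \<noteq> (0, -1/2, -1/2) \<longrightarrow>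
          (\<exists>x\<in>{-1..1}. jacobi_F n \<alpha> \<beta> x = sqrt (2/pi)) \<and>
          (\<forall>x\<in>{-1..1}. jacobi_F n \<alpha> \<beta> x \<le> sqrt (2/pi))"
    by (intro allI ballI impI jacobi_F_half_max)
  show "\<forall>C::real.
        (\<forall>n::nat. \<forall>\<alpha>\<ge>-1/2. \<forall>\<beta>\<ge>-1/2. \<forall>x\<in>{-1..1}.
           jacobi_F n \<alpha> \<beta> x \<le> C * E_bound n (\<alpha> + \<beta> + 1)) \<or>
        (\<forall>n::nat. \<forall>\<alpha>\<ge>-1/2. \<forall>\<beta>\<ge>-1/2. \<forall>x\<in>{-1..1}.
           jacobi_F n \<alpha> \<beta> x \<le> C * max 1 ((\<alpha> + \<beta> + 1) powr (1/4))) \<longrightarrow>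
        C \<ge> sqrt (2/pi)"
    by (intro allI impI jacobi_F_constant_lower_bound)
  show "\<forall>n::nat. \<forall>\<alpha>\<ge>-1/2. (n, \<alpha>) \<noteq> (0, -1/2) \<longrightarrow>
        (jacobi_F n \<alpha> (-1/2) (-1))\<^sup>2 =
          (2 * real n + \<alpha> + 1/2) * Gamma (real n + 1/2) * Gamma (real n + \<alpha> + 1/2)
            / (pi * Gamma (real n + 1) * Gamma (real n + \<alpha> + 1))"
    by (intro allI impI jacobi_F_minus_1_sq_Gamma)
  show "((\<lambda>\<alpha>::real. (2 * real 0 + \<alpha> + 1/2) * Gamma (real 0 + 1/2) * Gamma (real 0 + \<alpha> + 1/2)
            / (pi * Gamma (real 0 + 1) * Gamma (real 0 + \<alpha> + 1))) \<longlongrightarrow> 1/pi) (at_right (-1/2))"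
    by (rule jacobi_F_0_minus_1_limit)
  show "(jacobi_F 0 (-1/2) (-1/2) (-1))\<^sup>2 = 1/pi"
  proof -
    have "jacobi_F 0 (-1/2) (-1/2) (-1) = 1 / sqrt pi"
      using jacobi_F_minus_half_minus_half[of pi 0] by simp
    then show ?thesis by (simp add: power_divide)
  qed
  show "\<forall>n::nat. (\<lambda>\<alpha>. jacobi_F n \<alpha> (-1/2) (-1)) \<sim>[at_top]
        (\<lambda>\<alpha>. (Gamma (real n + 1/2) / (pi * Gamma (real n + 1))) powr (1/2) * \<alpha> powr (1/4))"
    by (intro allI asymp_equivI' jacobi_F_minus_1_asymp_ratio)
  show "\<forall>n::nat. \<forall>\<gamma><1/4.
        \<not> (\<exists>C::real. \<forall>\<alpha>\<ge>-1/2. \<forall>\<beta>\<ge>-1/2. \<forall>x\<in>{-1..1}.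
              jacobi_F n \<alpha> \<beta> x \<le> C * max 1 ((\<alpha> + \<beta> + 1) powr \<gamma>))"
    by (intro allI impI jacobi_F_no_smaller_exponent)
  show "\<forall>A\<ge>-1/2. \<forall>z>0. (\<lambda>n::nat. jacobi_F n A A (cos (z / real n))) \<longlonglongrightarrow> sqrt z * \<bar>bessel_J A z\<bar>"
    by (intro allI impI jacobi_F_mehler_heine)
  show "\<exists>c>0. \<forall>\<^sub>F A::real in at_top. \<exists>n::nat.
        real n + 1 \<ge> (2 * A + 1) ^ 3 \<and>
        jacobi_F n A A (cos (A / real n)) \<ge> c * A powr (1/6) \<and>
        (2 * A + 1) powr (1/4) * (real n + 1) powr (-1/12) \<le> 1"
    by (rule jacobi_F_bessel_peak)
  show "\<not> (\<exists>C::real. \<forall>n::nat. \<forall>\<alpha>\<ge>-1/2. \<forall>\<beta>\<ge>-1/2. \<forall>x\<in>{-1..1}.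
          jacobi_F n \<alpha> \<beta> x
            \<le> C * max 1 ((\<alpha> + \<beta> + 1) powr (1/4) * (real n + 1) powr (-1/12)))"
    by (rule jacobi_F_no_bound_without_sixth_root)
qed

end
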